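(* Assume (A1)–(A5). Fix $x_0\in B_{R^*}$ and let $\lambda_n\downarrow0$ be a sequence such that $T_{\lambda_n}\to T_0$ locally uniformly on $\mathbb{R}$ and $\phi_{\lambda_n}\to v_\phi$, $\psi_{\lambda_n}\to v_\psi$ in $\mathcal{C}^3_{\mathrm{loc}}(\Omega_0)$, where $\Omega_0=\{(y,s):y\in\mathbb{R},\ s<T_0(y)\}$. Then there exists $\alpha\in(-1,1)$ such that $T_0(y)=\alpha y$ for all $y\in\mathbb{R}$, and $v_\phi=V_{\phi,\alpha}$, $v_\psi=V_{\psi,\alpha}$.
   Context: Let $p>1$ and $\mu>0$ with $p<1+2/\mu$, and let $R^*,T^*>0$. Write $B_R=\{x\in\mathbb{R}:|x|<R\}$ and $D_\pm=\partial_t\pm\partial_x$. Consider the system $D_-\phi=2^{-p}|\phi+\psi|^p-\frac{\mu}{1+t}\frac{\phi+\psi}{2}$, $D_+\psi=2^{-p}|\phi+\psi|^p-\frac{\mu}{1+t}\frac{\phi+\psi}{2}$, $\phi(x,0)=f(x)$, $\psi(x,0)=g(x)$. Fix $\gamma_1,\gamma_2>0$ with $\gamma_1+\gamma_2>\max\big(1,(\mu p 2^p)^{1/(p-1)}\big)$ and let $T_1=\frac{1}{(p-1)\mu}\ln\Big(\frac{2^{1-p}/\mu}{2^{1-p}/\mu-(\gamma_1+\gamma_2)^{1-p}}\Big)$. Assumptions: (A1) $T_1<T^*$. (A2) $f\ge\gamma_1$, $g\ge\gamma_2$ on $B_{R^*+T^*}$. (A3) $f,g\in\mathcal{C}^4(\overline{B_{R^*+T^*}})$.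 (A4) There is $\varepsilon_0>0$ with $2^{-p}(\gamma_1+\gamma_2)^p-\frac{\mu}{2}(\gamma_1+\gamma_2)\ge(2+\varepsilon_0)\max_{x\in B_{R^*+T^*}}(|f'(x)|+|g'(x)|)$. (A5) There is $\varepsilon_1\neq-1$ with $2^{-p}(2p-1)\big(1+\frac{\varepsilon_1}{2(1+\varepsilon_1)}\big)\big(1-\frac{1}{2p}\big)-2^{-p+1}p-\mu>0$ such that $2^{-p}(\gamma_1+\gamma_2)^p-\frac{\mu}{2}(\gamma_1+\gamma_2)\ge(2+\varepsilon_1)\max_{x\in B_{R^*+T^*}}(|f'(x)|+|g'(x)|)$. Let $K_{R^*,T^*}=\{(x,t):t>0,\ |x-x_0|<T^*-t\ \text{for some } x_0\in B_{R^*}\}$. Define iterates $\phi_0\equiv\gamma_1$, $\psi_0\equiv\gamma_2$ and, with $\mathcal{N}_n(x,s)=2^{-p}|\phi_n+\psi_n|^p(x,s)-\frac{\mu}{1+s}\frac{(\phi_n+\psi_n)(x,s)}{2}$, $\phi_{n+1}(x,t)=f(x+t)+\int_0^t\mathcal{N}_n(x+t-s,s)\,ds$, $\psi_{n+1}(x,t)=g(x-t)+\int_0^t\mathcal{N}_n(x-t+s,s)\,ds$. Set $\phi=\sup_n\phi_n$, $\psi=\sup_n\psi_n$, $T(x)=\sup\{t\in(0,T^* ):(\phi+\psi)(x,t)<\infty\}$ for $x\in B_{R^*}$, and $\Omega=\{(x,t):x\in B_{R^*},\ 0<t<T(x)\}$. With $q=\frac1{p-1}$ and $\lambda>0$, the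 rescaled functions are $\phi_\lambda(y,s)=\lambda^q\phi(x_0+\lambda y,T(x_0)+\lambda s)$, $\psi_\lambda(y,s)=\lambda^q\psi(x_0+\lambda y,T(x_0)+\lambda s)$, and $T_\lambda(y)=\frac{T(x_0+\lambda y)-T(x_0)}{\lambda}$. For $\alpha\in(-1,1)$, the self-similar profiles are $V_{\phi,\alpha}(y,s)=C_{\phi,\alpha}(\alpha y-s)^{-q}$, $V_{\psi,\alpha}(y,s)=C_{\psi,\alpha}(\alpha y-s)^{-q}$ with $C_{\phi,\alpha}=\frac{1-\alpha}{2}A$, $C_{\psi,\alpha}=\frac{1+\alpha}{2}A$, $A^{p-1}=2^{p-1}q(1-\alpha^2)$. *)

theory Defs
  imports "HOL-Analysis.Analysis"
begin

text \<open>Picard-type iterates (phi_n, psi_n) for the damped system, with parameters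
p, mu, gamma1, gamma2 and initial data f, g. Points are (x,t), functions curried.\<close>

fun iter :: "real \<Rightarrow> real \<Rightarrow> real \<Rightarrow> real \<Rightarrow> (real \<Rightarrow> real) \<Rightarrow> (real \<Rightarrow> real) \<Rightarrow> nat
    \<Rightarrow> (real \<Rightarrow> real \<Rightarrow> real) \<times> (real \<Rightarrow> real \<Rightarrow> real)" where
  "iter p \<mu> \<gamma>1 \<gamma>2 f g 0 = ((\<lambda>x t. \<gamma>1), (\<lambda>x t. \<gamma>2))"
| "iter p \<mu> \<gamma>1 \<gamma>2 f g (Suc n) =
     (let \<phi> = fst (iter p \<mu> \<gamma>1 \<gamma>2 f g n); \<psi> = snd (iter p \<mu> \<gamma>1 \<gamma>2 f g n);
          N = (\<lambda>x s. 2 powr (-p) * \<bar>\<phi> x s + \<psi> x s\<bar> powr p - \<mu> / (1 + s) * ((\<phi> x s + \<psi> x s) / 2))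
      in ((\<lambda>x t. f (x + t) + integral {0..t} (\<lambda>s. N (x + t - s) s)),
          (\<lambda>x t. g (x - t) + integral {0..t} (\<lambda>s. N (x - t + s) s))))"

definition phi_lim :: "real \<Rightarrow> real \<Rightarrow> real \<Rightarrow> real \<Rightarrow> (real \<Rightarrow> real) \<Rightarrow> (real \<Rightarrow> real) \<Rightarrow> real \<Rightarrow> real \<Rightarrow> ereal" where
  "phi_lim p \<mu> \<gamma>1 \<gamma>2 f g x t = (SUP n. ereal (fst (iter p \<mu> \<gamma>1 \<gamma>2 f g n) x t))"

definition psi_lim :: "real \<Rightarrow> real \<Rightarrow> real \<Rightarrow> real \<Rightarrow> (real \<Rightarrow> real) \<Rightarrow> (real \<Rightarrow> real) \<Rightarrow> real \<Rightarrow> real \<Rightarrow> ereal" where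
  "psi_lim p \<mu> \<gamma>1 \<gamma>2 f g x t = (SUP n. ereal (snd (iter p \<mu> \<gamma>1 \<gamma>2 f g n) x t))"

text \<open>Blow-up time T(x) (meaningful for x in B_{R*}).\<close>
definition Tblow :: "real \<Rightarrow> real \<Rightarrow> real \<Rightarrow> real \<Rightarrow> (real \<Rightarrow> real) \<Rightarrow> (real \<Rightarrow> real) \<Rightarrow> real \<Rightarrow> real \<Rightarrow> real" where
  "Tblow p \<mu> \<gamma>1 \<gamma>2 f g Ts x =
     Sup {t \<in> {0<..<Ts}. phi_lim p \<mu> \<gamma>1 \<gamma>2 f g x t + psi_lim p \<mu> \<gamma>1 \<gamma>2 f g x t < \<infinity>}"

text \<open>Rescaled functions (q = 1/(p-1)); where phi is infinite, real_of_ereal gives 0,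
 which is irrelevant on compact subsets of Omega_0 for small lambda.\<close>
definition phi_resc where
  "phi_resc p \<mu> \<gamma>1 \<gamma>2 f g Ts x0 lam y s =
     lam powr (1 / (p - 1)) * real_of_ereal (phi_lim p \<mu> \<gamma>1 \<gamma>2 f g (x0 + lam * y) (Tblow p \<mu> \<gamma>1 \<gamma>2 f g Ts x0 + lam * s))"

definition psi_resc where
  "psi_resc p \<mu> \<gamma>1 \<gamma>2 f g Ts x0 lam y s =
     lam powr (1 / (p - 1)) * real_of_ereal (psi_lim p \<mu> \<gamma>1 \<gamma>2 f g (x0 + lam * y) (Tblow p \<mu> \<gamma>1 \<gamma>2 f g Ts x0 + lam * s))"

definition T_resc where
  "T_resc p \<mu> \<gamma>1 \<gamma>2 f g Ts x0 lam y =
     (Tblow p \<mu> \<gamma>1 \<gamma>2 f g Ts (x0 + lam * y) - Tblow p \<mu> \<gamma>1 \<gamma>2 f g Ts x0) / lam"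

definition A_const :: "real \<Rightarrow> real \<Rightarrow> real" where
  "A_const p \<alpha> = (2 powr (p - 1) * (1 / (p - 1)) * (1 - \<alpha>\<^sup>2)) powr (1 / (p - 1))"

definition V_phi :: "real \<Rightarrow> real \<Rightarrow> real \<Rightarrow> real \<Rightarrow> real" where
  "V_phi p \<alpha> y s = (1 - \<alpha>) / 2 * A_const p \<alpha> * (\<alpha> * y - s) powr (- (1 / (p - 1)))"

definition V_psi :: "real \<Rightarrow> real \<Rightarrow> real \<Rightarrow> real \<Rightarrow> real" where
  "V_psi p \<alpha> y s = (1 + \<alpha>) / 2 * A_const p \<alpha> * (\<alpha> * y - s) powr (- (1 / (p - 1)))"

definition pdy :: "(real \<Rightarrow> real \<Rightarrow> real) \<Rightarrow> real \<Rightarrow> real \<Rightarrow> real" where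
  "pdy f = (\<lambda>y s. deriv (\<lambda>y'. f y' s) y)"
definition pds :: "(real \<Rightarrow> real \<Rightarrow> real) \<Rightarrow> real \<Rightarrow> real \<Rightarrow> real" where
  "pds f = (\<lambda>y s. deriv (\<lambda>s'. f y s') s)"

fun pd :: "bool list \<Rightarrow> (real \<Rightarrow> real \<Rightarrow> real) \<Rightarrow> real \<Rightarrow> real \<Rightarrow> real" where
  "pd [] f = f"
| "pd (b # w) f = (if b then pdy else pds) (pd w f)"

definition C3_on :: "(real \<times> real) set \<Rightarrow> (real \<Rightarrow> real \<Rightarrow> real) \<Rightarrow> bool" where
  "C3_on U f \<longleftrightarrow>
     (\<forall>w. length w < 3 \<longrightarrow> (\<forall>(y, s) \<in> U.
         (\<lambda>y'. pd w f y' s) differentiable (at y) \<and> (\<lambda>s'. pd w f y s') differentiable (at s))) \<and>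
     (\<forall>w. length w \<le> 3 \<longrightarrow> continuous_on U (\<lambda>(y, s). pd w f y s))"

definition conv_C3_loc :: "(real \<times> real) set \<Rightarrow> (nat \<Rightarrow> real \<Rightarrow> real \<Rightarrow> real) \<Rightarrow> (real \<Rightarrow> real \<Rightarrow> real) \<Rightarrow> bool" where
  "conv_C3_loc U F v \<longleftrightarrow> C3_on U v \<and>
     (\<forall>K. compact K \<and> K \<subseteq> U \<longrightarrow>
        (\<exists>V. open V \<and> K \<subseteq> V \<and> V \<subseteq> U \<and> (\<forall>\<^sub>F n in sequentially. C3_on V (F n))) \<and>
        (\<forall>w. length w \<le> 3 \<longrightarrow>
           uniform_limit K (\<lambda>n (y, s). pd w (F n) y s) (\<lambda>(y, s). pd w v y s) sequentially))"

definition C4_closed :: "(real \<Rightarrow> real) \<Rightarrow> real \<Rightarrow> real \<Rightarrow> bool" where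
  "C4_closed f a b \<longleftrightarrow> (\<exists>D :: nat \<Rightarrow> real \<Rightarrow> real.
      (\<forall>x \<in> {a..b}. D 0 x = f x) \<and>
      (\<forall>k < 4. \<forall>x \<in> {a..b}. (D k has_real_derivative D (Suc k) x) (at x within {a..b})) \<and>
      (\<forall>k \<le> 4. continuous_on {a..b} (D k)))"

end

theory Submission
  imports Defs
begin

text \<open>
  The Picard iterates are monotone along all space-time directions of slope at most \<open>1 + \<epsilon>\<close>,
  because the nonlinearity outweighs the variation of the data. Hence the blow-up curve has
  Lipschitz constant \<open>\<kappa> = 1 / (1 + \<epsilon>) < 1\<close>, a local existence argument gives the lower blow-up rate,
  and every blow-up limit is an ancient solution of the undamped system with the same
  monotonicity. For such a solution the slopes \<open>r = - v_y / v_s\<close> of the two components satisfy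
  \<open>D_- r1 = a (r2 - r1)\<close> and \<open>D_+ r2 = b (r1 - r2)\<close> with rates \<open>a, b\<close> comparable to \<open>1 / (T0 - s)\<close>.
  This is a velocity-jump process with a scale invariant jump rate, so the oscillation of \<open>(r1, r2)\<close>
  contracts by a fixed factor from one scale to the next, and boundedness in the infinite
  past forces \<open>r1 = r2 = \<alpha>\<close>. Integrating the resulting ordinary differential equation gives the
  self-similar profile and the straight blow-up line.
\<close>

section \<open>Relaxation along characteristics\<close>

text \<open>Everything rests on \<kappa> being strictly below 1. A displacement with |dx| <= (1 +
  \<epsilon>) dt moves the feet x + t and x - t by at most (2 + \<epsilon>) dt, which explains the
  factor in (A4); the surplus \<epsilon> makes the blow-up curve strictly flatter than the
  characteristics. In the limit |v_y| <= \<kappa> v_s for each component, so each v_s is comparable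
  to the nonlinearity, and inside a backward light cone T0 - s is comparable to the time elapsed.
  Since v_y and v_s solve the same linear transport system, their quotient obeys an equation without
  zeroth-order term: constants solve it and a maximum principle holds. The system does not smooth;
  mixing comes only from jumps between the two families. A rate of order 1 / (- s) gives a jump
  probability between the times - 6 * S and - S that is bounded below uniformly in S, so the gain is
  the same at every scale. T0 is known only to be Lipschitz, so this argument runs in light cones
  below the curve. Any two of them meet in the past, which identifies their constants.\<close>

lemma gain_along_line:
  fixes u u' G G' :: "real \<Rightarrow> real"
  assumes D: "0 \<le> D" and K: "0 \<le> K"
    and u: "\<And>\<sigma>. 0 \<le> \<sigma> \<Longrightarrow> \<sigma> \<le> D \<Longrightarrow> (u has_real_derivative u' \<sigma>) (at \<sigma>)"
    and G: "\<And>\<sigma>. 0 < \<sigma> \<Longrightarrow> \<sigma> < D \<Longrightarrow> (G has_real_derivative G' \<sigma>) (at \<sigma>)"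
    and Gc: "continuous_on {0..D} G"
    and G': "\<And>\<sigma>. 0 < \<sigma> \<Longrightarrow> \<sigma> < D \<Longrightarrow> 0 \<le> G' \<sigma>"
    and ineq: "\<And>\<sigma>. 0 < \<sigma> \<Longrightarrow> \<sigma> < D \<Longrightarrow> G' \<sigma> - K * u \<sigma> \<le> u' \<sigma>"
  shows "exp (- (K * D)) * (u 0 + G D - G 0) \<le> u D"
proof -
  \<comment> \<open>The integrating factor absorbs the loss. It is at least 1 and \<open>G'\<close>
    is nonnegative, so the source may be counted without weight.\<close>
  let ?F = "\<lambda>\<sigma>. exp (K * \<sigma>) * u \<sigma> - G \<sigma>"
  have "?F 0 \<le> ?F D"
  proof (rule DERIV_nonneg_imp_increasing_open[OF D])
    fix \<sigma> assume s: "0 < \<sigma>" "\<sigma> < D"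
    have "(?F has_real_derivative exp (K * \<sigma>) * (K * u \<sigma> + u' \<sigma>) - G' \<sigma>) (at \<sigma>)"
      using s by (auto intro!: derivative_eq_intros u G simp: algebra_simps)
    moreover have "1 * G' \<sigma> \<le> exp (K * \<sigma>) * (K * u \<sigma> + u' \<sigma>)"
      using G'[OF s] ineq[OF s] K s by (intro mult_mono) auto
    ultimately show "\<exists>y. (?F has_real_derivative y) (at \<sigma>) \<and> 0 \<le> y" by auto
  next
    have "continuous_on {0..D} u"
      by (intro continuous_at_imp_continuous_on ballI DERIV_isCont) (auto intro: u)
    then show "continuous_on {0..D} ?F" by (intro continuous_intros Gc)
  qed
  then have "u 0 + G D - G 0 \<le> exp (K * D) * u D" by simp
  then have "exp (- (K * D)) * (u 0 + G D - G 0) \<le> exp (- (K * D)) * (exp (K * D) * u D)"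
    by (intro mult_left_mono) auto
  also have "\<dots> = u D" by (simp add: exp_minus field_simps)
  finally show ?thesis .
qed

text \<open>The region is the backward light cone with apex (0, - d). It contains the past of each
  of its points along both characteristics, and d > 0 keeps rates of order 1 / (- s) bounded. Only
  derivatives along the respective characteristic are asked for: this is what the slopes of a
  \<open>C1_on\<close> profile are shown to have.\<close>

definition relaxes :: "real \<Rightarrow> (real \<Rightarrow> real \<Rightarrow> real) \<Rightarrow> (real \<Rightarrow> real \<Rightarrow> real)
    \<Rightarrow> (real \<Rightarrow> real \<Rightarrow> real) \<Rightarrow> (real \<Rightarrow> real \<Rightarrow> real) \<Rightarrow> bool" where
  "relaxes d a b h1 h2 \<longleftrightarrow> (\<forall>y s. \<bar>y\<bar> \<le> - s - d \<longrightarrow>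
     ((\<lambda>\<sigma>. h1 (y - \<sigma>) (s + \<sigma>)) has_real_derivative a y s * (h2 y s - h1 y s)) (at 0) \<and>
     ((\<lambda>\<sigma>. h2 (y + \<sigma>) (s + \<sigma>)) has_real_derivative b y s * (h1 y s - h2 y s)) (at 0))"

lemma relaxes_affine:
  assumes "relaxes d a b h1 h2"
  shows "relaxes d a b (\<lambda>y s. c * h1 y s + e) (\<lambda>y s. c * h2 y s + e)"
  unfolding relaxes_def
proof (intro allI impI conjI)
  fix y s :: real assume *: "\<bar>y\<bar> \<le> - s - d"
  note D = assms[unfolded relaxes_def, rule_format, OF *]
  show "((\<lambda>\<sigma>. c * h1 (y - \<sigma>) (s + \<sigma>) + e) has_real_derivative
      a y s * (c * h2 y s + e - (c * h1 y s + e))) (at 0)"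
    using D by (auto intro!: derivative_eq_intros simp: algebra_simps)
  show "((\<lambda>\<sigma>. c * h2 (y + \<sigma>) (s + \<sigma>) + e) has_real_derivative
      b y s * (c * h1 y s + e - (c * h2 y s + e))) (at 0)"
    using D by (auto intro!: derivative_eq_intros simp: algebra_simps)
qed

text \<open>Reflection exchanges the two families of characteristics, so facts along lines need a
  proof for the first component only.\<close>

lemma relaxes_reflect:
  assumes "relaxes d a b h1 h2"
  shows "relaxes d (\<lambda>y. b (- y)) (\<lambda>y. a (- y)) (\<lambda>y. h2 (- y)) (\<lambda>y. h1 (- y))"
  unfolding relaxes_def
proof (intro allI impI)
  fix y s :: real assume "\<bar>y\<bar> \<le> - s - d"
  then have "\<bar>- y\<bar> \<le> - s - d" by simp
  from assms[unfolded relaxes_def, rule_format, OF this]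
  show "((\<lambda>\<sigma>. h2 (- (y - \<sigma>)) (s + \<sigma>)) has_real_derivative b (- y) s * (h1 (- y) s - h2 (- y) s)) (at 0) \<and>
    ((\<lambda>\<sigma>. h1 (- (y + \<sigma>)) (s + \<sigma>)) has_real_derivative a (- y) s * (h2 (- y) s - h1 (- y) s)) (at 0)"
    by simp
qed

lemma relaxes_line:
  assumes R: "relaxes d a b h1 h2" and "0 \<le> \<sigma>" "\<sigma> \<le> D" "\<bar>y - D\<bar> \<le> - (s + D) - d"
  shows "((\<lambda>\<sigma>. h1 (y - \<sigma>) (s + \<sigma>)) has_real_derivative
    a (y - \<sigma>) (s + \<sigma>) * (h2 (y - \<sigma>) (s + \<sigma>) - h1 (y - \<sigma>) (s + \<sigma>))) (at \<sigma>)"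
proof -
  have "\<bar>y - \<sigma>\<bar> \<le> - (s + \<sigma>) - d" using assms by linarith
  then have "((\<lambda>\<tau>. h1 (y - \<sigma> - \<tau>) (s + \<sigma> + \<tau>)) has_real_derivative
    a (y - \<sigma>) (s + \<sigma>) * (h2 (y - \<sigma>) (s + \<sigma>) - h1 (y - \<sigma>) (s + \<sigma>))) (at 0)"
    using R unfolding relaxes_def by blast
  then have "((\<lambda>\<tau>. h1 (y - (\<tau> + \<sigma>)) (s + (\<tau> + \<sigma>))) has_real_derivative
    a (y - \<sigma>) (s + \<sigma>) * (h2 (y - \<sigma>) (s + \<sigma>) - h1 (y - \<sigma>) (s + \<sigma>))) (at 0)"
    by (simp add: algebra_simps)
  then show ?thesis
    using DERIV_shift[of "\<lambda>\<sigma>. h1 (y - \<sigma>) (s + \<sigma>)" _ 0 \<sigma>] by simp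
qed

text \<open>The gain \<open>a * h2\<close> is nonnegative and may be dropped; what remains is loss
  at a rate of at most \<open>K\<close>.\<close>

lemma relaxes_decay:
  assumes R: "relaxes d a b h1 h2" and D: "0 \<le> D" "\<bar>y - D\<bar> \<le> - (s + D) - d" and K: "0 \<le> K"
    and nn: "\<And>\<sigma>. 0 \<le> \<sigma> \<Longrightarrow> \<sigma> \<le> D \<Longrightarrow> 0 \<le> h1 (y - \<sigma>) (s + \<sigma>) \<and> 0 \<le> h2 (y - \<sigma>) (s + \<sigma>)"
    and a: "\<And>\<sigma>. 0 \<le> \<sigma> \<Longrightarrow> \<sigma> \<le> D \<Longrightarrow> 0 \<le> a (y - \<sigma>) (s + \<sigma>) \<and> a (y - \<sigma>) (s + \<sigma>) \<le> K"
  shows "exp (- (K * D)) * h1 y s \<le> h1 (y - D) (s + D)"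
proof -
  have "exp (- (K * D)) * (h1 (y - 0) (s + 0) + 0 - 0) \<le> h1 (y - D) (s + D)"
  proof (rule gain_along_line[where u = "\<lambda>\<sigma>. h1 (y - \<sigma>) (s + \<sigma>)" and G = "\<lambda>_. 0" and G' = "\<lambda>_. 0",
        OF D(1) K relaxes_line[OF R]])
    fix \<sigma> assume s: "0 < \<sigma>" "\<sigma> < D"
    let ?a = "a (y - \<sigma>) (s + \<sigma>)" and ?h1 = "h1 (y - \<sigma>) (s + \<sigma>)" and ?h2 = "h2 (y - \<sigma>) (s + \<sigma>)"
    have "?a * ?h1 \<le> K * ?h1" "0 \<le> ?a * ?h2"
      using nn[of \<sigma>] a[of \<sigma>] s by (auto intro: mult_right_mono)
    then show "0 - K * ?h1 \<le> ?a * (?h2 - ?h1)" by (simp add: algebra_simps)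
  qed (use D in auto)
  then show ?thesis by simp
qed

text \<open>No minimum point is needed. If both components exceed m - \<nu> above the slice, then,
  shifted to be nonnegative, they are at least \<nu> on the slice and by decay at least \<theta> *
  \<nu> later. This improves the deficit \<nu> to (1 - \<theta>) * \<nu>; iterating from the crude
  bound \<open>B\<close> sends it to 0.\<close>

lemma relaxes_max_principle:
  assumes R: "relaxes d a b h1 h2"
    and a: "\<And>y s. \<bar>y\<bar> \<le> - s - d \<Longrightarrow> 0 \<le> a y s \<and> a y s \<le> K"
    and b: "\<And>y s. \<bar>y\<bar> \<le> - s - d \<Longrightarrow> 0 \<le> b y s \<and> b y s \<le> K"
    and bnd: "\<And>y s. \<bar>y\<bar> \<le> - s - d \<Longrightarrow> - B \<le> h1 y s \<and> - B \<le> h2 y s"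
    and slice: "\<And>y. \<bar>y\<bar> \<le> S - d \<Longrightarrow> m \<le> h1 y (- S) \<and> m \<le> h2 y (- S)"
    and ys: "\<bar>y\<bar> \<le> - s - d" "- S \<le> s"
  shows "m \<le> h1 y s \<and> m \<le> h2 y s"
proof -
  define E where "E = {(y, s). \<bar>y\<bar> \<le> - s - d \<and> - S \<le> s}"
  define \<theta> where "\<theta> = exp (- (K * (S - d)))"
  have K0: "0 \<le> K" using a[OF ys(1)] by linarith
  have th: "0 < \<theta>" "\<theta> \<le> 1" using K0 ys by (auto simp: \<theta>_def)
  have step: "\<forall>(y, s)\<in>E. m - (1 - \<theta>) * \<nu> \<le> h1 y s \<and> m - (1 - \<theta>) * \<nu> \<le> h2 y s"
    if \<nu>: "0 \<le> \<nu>" and h: "\<forall>(y, s)\<in>E. m - \<nu> \<le> h1 y s \<and> m - \<nu> \<le> h2 y s" for \<nu>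
  proof -
    define g1 g2 where "g1 y s = 1 * h1 y s + (\<nu> - m)" and "g2 y s = 1 * h2 y s + (\<nu> - m)" for y s
    have Rg: "relaxes d a b g1 g2" unfolding g1_def[abs_def] g2_def[abs_def] by (rule relaxes_affine[OF R])
    have nn: "0 \<le> g1 y s \<and> 0 \<le> g2 y s" if "(y, s) \<in> E" for y s
      using h that by (fastforce simp: g1_def g2_def)
    have exp_le: "\<theta> * \<nu> \<le> exp (- (K * (s + S))) * x" if "- S \<le> s" "s \<le> - d" "\<nu> \<le> x" for s x
      unfolding \<theta>_def using that K0 \<nu> by (intro mult_mono) (auto intro!: mult_left_mono)
    have "\<theta> * \<nu> \<le> g1 y s \<and> \<theta> * \<nu> \<le> g2 y s" if ys: "(y, s) \<in> E" for y s
    proof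
      have e: "\<bar>y\<bar> \<le> - s - d" "- S \<le> s" "s \<le> - d" using ys by (auto simp: E_def)
      have "exp (- (K * (s + S))) * g1 (y + (s + S)) (- S) \<le> g1 (y + (s + S) - (s + S)) (- S + (s + S))"
        using e a b K0 nn by (intro relaxes_decay[OF Rg]) (auto simp: E_def)
      moreover have "\<nu> \<le> g1 (y + (s + S)) (- S)"
        using slice[of "y + (s + S)"] e by (auto simp: g1_def)
      ultimately show "\<theta> * \<nu> \<le> g1 y s" using exp_le[OF e(2,3)] by fastforce
      have "exp (- (K * (s + S))) * g2 (- (- y + (s + S))) (- S) \<le> g2 (- (- y + (s + S) - (s + S))) (- S + (s + S))"
        using e a b K0 nn by (intro relaxes_decay[OF relaxes_reflect[OF Rg]]) (auto simp: E_def)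
      moreover have "\<nu> \<le> g2 (- (- y + (s + S))) (- S)"
        using slice[of "y - (s + S)"] e by (auto simp: g2_def)
      ultimately show "\<theta> * \<nu> \<le> g2 y s" using exp_le[OF e(2,3)] by fastforce
    qed
    then show ?thesis by (auto simp: g1_def g2_def algebra_simps)
  qed
  define \<nu>0 where "\<nu>0 = max 0 (m + B)"
  have all: "\<forall>(y, s)\<in>E. m - (1 - \<theta>) ^ n * \<nu>0 \<le> h1 y s \<and> m - (1 - \<theta>) ^ n * \<nu>0 \<le> h2 y s" for n
  proof (induction n)
    case 0
    show ?case using bnd by (fastforce simp: E_def \<nu>0_def)
  next
    case (Suc n)
    from step[OF _ Suc] th show ?case by (simp add: \<nu>0_def mult.assoc)
  qed
  have lim: "(\<lambda>n. m - (1 - \<theta>) ^ n * \<nu>0) \<longlonglongrightarrow> m - 0 * \<nu>0"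
    using th by (intro tendsto_intros LIMSEQ_realpow_zero) auto
  have "(y, s) \<in> E" using ys by (simp add: E_def)
  with all have "m - (1 - \<theta>) ^ n * \<nu>0 \<le> h1 y s" "m - (1 - \<theta>) ^ n * \<nu>0 \<le> h2 y s" for n by blast+
  with lim show ?thesis by (auto intro: LIMSEQ_le_const2)
qed

text \<open>
  If \<open>h1\<close> has positive mean on a sub-interval of the slice at time \<open>-6 * S\<close>, every point of the
  slice at time \<open>-S\<close> sees this mass: \<open>h2\<close> collects it on the characteristics that sweep the
  interval, and \<open>h1\<close> then collects it from \<open>h2\<close>.
\<close>

lemma relaxes_harnack:
  assumes R: "relaxes d a b h1 h2" and S: "d \<le> S" "0 < d" and k: "0 < k1"
    and a: "\<And>y s. \<bar>y\<bar> \<le> - s - d \<Longrightarrow> k1 / (- s) \<le> a y s \<and> a y s \<le> k2 / (- s)"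
    and b: "\<And>y s. \<bar>y\<bar> \<le> - s - d \<Longrightarrow> k1 / (- s) \<le> b y s \<and> b y s \<le> k2 / (- s)"
    and nn: "\<And>y s. \<bar>y\<bar> \<le> - s - d \<Longrightarrow> 0 \<le> h1 y s \<and> 0 \<le> h2 y s"
    and c: "continuous_on {y. \<bar>y\<bar> \<le> 6 * S - d} (\<lambda>y. h1 y (- (6 * S)))"
    and mean: "S * m \<le> integral {- S..S} (\<lambda>y. h1 y (- (6 * S)))" and m: "0 \<le> m"
    and y: "\<bar>y\<bar> \<le> S - d"
  shows "exp (- (11 * k2)) * (k1 / 12) * min 1 (k1 / 6) * m \<le> h1 y (- S) \<and>
         exp (- (11 * k2)) * (k1 / 12) * min 1 (k1 / 6) * m \<le> h2 y (- S)"
proof -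
  have Spos: "0 < S" using S by simp
  \<comment> \<open>\<open>K\<close> and \<open>\<beta>\<close> bound the rates from above and below
    for all times between - 6 * S and - S. A decay over at most 5 * S costs no more than exp (- 5 *
    k2), whatever \<open>S\<close> is.\<close>
  define K where "K = k2 / S"
  define \<beta> where "\<beta> = k1 / (6 * S)"
  have "k1 / d \<le> k2 / d" using a[of 0 "- d"] by simp
  then have k12: "k1 \<le> k2" using S by (simp add: divide_le_cancel)
  have k2: "0 < k2" using k12 k by linarith
  have K0: "0 < K" and \<beta>0: "0 < \<beta>" using k2 k Spos by (auto simp: K_def \<beta>_def)
  have rate: "k1 / (- s) \<ge> \<beta>" "k2 / (- s) \<le> K" "0 \<le> k1 / (- s)" if "- (6 * S) \<le> s" "s \<le> - S" for s
    using that Spos k k2 unfolding \<beta>_def K_def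
    by (auto simp del: divide_minus_right minus_divide_right intro!: divide_left_mono mult_pos_pos divide_nonneg_nonneg)
  have KD: "exp (- (5 * k2)) \<le> exp (- (K * D))" if "D \<le> 5 * S" for D
  proof -
    have "K * D \<le> K * (5 * S)" using that K0 by (intro mult_left_mono) auto
    then show ?thesis using Spos by (simp add: K_def)
  qed
  \<comment> \<open>Two decays of exp (- 5 * k2) each, one along the line of \<open>h1\<close> and
    one along that of \<open>h2\<close>; the factor k1 / 12 is \<beta> * S / 2.\<close>
  define \<delta> where "\<delta> = exp (- (10 * k2)) * (k1 / 12) * m"
  have \<delta>0: "0 \<le> \<delta>" using k m by (simp add: \<delta>_def)
  have h2: "\<delta> \<le> h2 y (- S1)" if S1: "S \<le> S1" "S1 \<le> 2 * S" and y: "\<bar>y\<bar> \<le> S1 - d" for y S1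
  proof -
    define D where "D = 6 * S - S1"
    define \<eta> where "\<eta> = y - D"
    have D: "4 * S \<le> D" "D \<le> 5 * S" "0 \<le> D" using S1 Spos by (auto simp: D_def)
    have cl: "continuous_on {\<eta>..\<eta> + 2 * D} (\<lambda>x. h1 x (- (6 * S)))"
      by (rule continuous_on_subset[OF c]) (use y in \<open>auto simp: \<eta>_def D_def\<close>)
    define G0 where "G0 x = integral {\<eta>..x} (\<lambda>x. h1 x (- (6 * S)))" for x
    have G0: "(G0 has_real_derivative h1 x (- (6 * S))) (at x within {\<eta>..\<eta> + 2 * D})"
      if "x \<in> {\<eta>..\<eta> + 2 * D}" for x
      unfolding G0_def using integral_has_real_derivative[OF cl that] .
    define C where "C = \<beta> * exp (- (5 * k2))"
    have C0: "0 \<le> C" using \<beta>0 by (simp add: C_def)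
    have nnx: "0 \<le> h1 x (- (6 * S))" if "x \<in> {\<eta>..\<eta> + 2 * D}" for x
      using nn[of x "- (6 * S)"] that y by (auto simp: \<eta>_def D_def)
    \<comment> \<open>The \<open>h1\<close>-characteristic through the point at parameter \<sigma>
      of this \<open>h2\<close>-line starts at \<eta> + 2 * \<sigma> on the initial slice; hence the
      2 inside and the division by 2 outside \<open>G0\<close>. As \<sigma> runs through [0, D]
      these feet sweep [y - D, y + D], which contains [- S, S] because D >= 4 * S and |y| < 2 *
      S.\<close>
    have "exp (- (K * D)) * (h2 (\<eta> + 0) (- (6 * S) + 0) + C * G0 (\<eta> + 2 * D) / 2 - C * G0 (\<eta> + 2 * 0) / 2)
        \<le> h2 (\<eta> + D) (- (6 * S) + D)"
    proof (rule gain_along_line[where u = "\<lambda>\<sigma>. h2 (\<eta> + \<sigma>) (- (6 * S) + \<sigma>)" and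
          G = "\<lambda>\<sigma>. C * G0 (\<eta> + 2 * \<sigma>) / 2" and G' = "\<lambda>\<sigma>. C * h1 (\<eta> + 2 * \<sigma>) (- (6 * S))",
          OF D(3) less_imp_le[OF K0]])
      fix \<sigma> assume s: "0 \<le> \<sigma>" "\<sigma> \<le> D"
      show "((\<lambda>\<sigma>. h2 (\<eta> + \<sigma>) (- (6 * S) + \<sigma>)) has_real_derivative
        b (\<eta> + \<sigma>) (- (6 * S) + \<sigma>) * (h1 (\<eta> + \<sigma>) (- (6 * S) + \<sigma>) - h2 (\<eta> + \<sigma>) (- (6 * S) + \<sigma>))) (at \<sigma>)"
      proof -
        have "\<bar>- \<eta> - D\<bar> \<le> - (- (6 * S) + D) - d" using y by (simp add: D_def \<eta>_def)
        from relaxes_line[OF relaxes_reflect[OF R] s this] show ?thesis by (simp add: add.commute)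
      qed
    next
      fix \<sigma> assume s: "0 < \<sigma>" "\<sigma> < D"
      have "(G0 has_real_derivative h1 (\<eta> + 2 * \<sigma>) (- (6 * S))) (at (\<eta> + 2 * \<sigma>))"
        using G0[of "\<eta> + 2 * \<sigma>"] s by (simp add: at_within_Icc_at)
      then show "((\<lambda>\<sigma>. C * G0 (\<eta> + 2 * \<sigma>) / 2) has_real_derivative C * h1 (\<eta> + 2 * \<sigma>) (- (6 * S))) (at \<sigma>)"
        by (auto intro!: derivative_eq_intros DERIV_chain2[where f = G0])
      show nnC: "0 \<le> C * h1 (\<eta> + 2 * \<sigma>) (- (6 * S))"
        using C0 nnx[of "\<eta> + 2 * \<sigma>"] s by auto
      let ?b = "b (\<eta> + \<sigma>) (- (6 * S) + \<sigma>)" and ?h1 = "h1 (\<eta> + \<sigma>) (- (6 * S) + \<sigma>)"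
        and ?h2 = "h2 (\<eta> + \<sigma>) (- (6 * S) + \<sigma>)"
      have in_cone: "\<bar>\<eta> + \<sigma>\<bar> \<le> - (- (6 * S) + \<sigma>) - d"
        using y s by (auto simp: \<eta>_def D_def)
      have bb: "\<beta> \<le> ?b" "?b \<le> K"
        using b[OF in_cone] rate[of "- (6 * S) + \<sigma>"] s D by auto
      have "exp (- (K * \<sigma>)) * h1 (\<eta> + 2 * \<sigma>) (- (6 * S)) \<le> h1 (\<eta> + 2 * \<sigma> - \<sigma>) (- (6 * S) + \<sigma>)"
      proof (rule relaxes_decay[OF R])
        fix \<tau> assume t: "0 \<le> \<tau>" "\<tau> \<le> \<sigma>"
        have ic: "\<bar>\<eta> + 2 * \<sigma> - \<tau>\<bar> \<le> - (- (6 * S) + \<tau>) - d"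
          using y s t by (auto simp: \<eta>_def D_def)
        show "0 \<le> h1 (\<eta> + 2 * \<sigma> - \<tau>) (- (6 * S) + \<tau>) \<and> 0 \<le> h2 (\<eta> + 2 * \<sigma> - \<tau>) (- (6 * S) + \<tau>)"
          by (rule nn[OF ic])
        show "0 \<le> a (\<eta> + 2 * \<sigma> - \<tau>) (- (6 * S) + \<tau>) \<and> a (\<eta> + 2 * \<sigma> - \<tau>) (- (6 * S) + \<tau>) \<le> K"
          using a[OF ic] rate[of "- (6 * S) + \<tau>"] s t D by auto
      qed (use s K0 in_cone in auto)
      moreover have "exp (- (5 * k2)) * h1 (\<eta> + 2 * \<sigma>) (- (6 * S)) \<le> exp (- (K * \<sigma>)) * h1 (\<eta> + 2 * \<sigma>) (- (6 * S))"
        using KD[of \<sigma>] s D nnx[of "\<eta> + 2 * \<sigma>"] by (intro mult_right_mono) auto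
      ultimately have "exp (- (5 * k2)) * h1 (\<eta> + 2 * \<sigma>) (- (6 * S)) \<le> ?h1" by (simp add: add.commute)
      then have "\<beta> * (exp (- (5 * k2)) * h1 (\<eta> + 2 * \<sigma>) (- (6 * S))) \<le> \<beta> * ?h1"
        using \<beta>0 by (intro mult_left_mono) auto
      also have "\<dots> \<le> ?b * ?h1" using bb nn[OF in_cone] by (intro mult_right_mono) auto
      finally have "C * h1 (\<eta> + 2 * \<sigma>) (- (6 * S)) \<le> ?b * ?h1" by (simp add: C_def mult.assoc)
      moreover have "?b * ?h2 \<le> K * ?h2" using bb nn[OF in_cone] by (intro mult_right_mono) auto
      ultimately show "C * h1 (\<eta> + 2 * \<sigma>) (- (6 * S)) - K * ?h2 \<le> ?b * (?h1 - ?h2)"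
        by (simp add: algebra_simps)
    next
      have "continuous_on {\<eta>..\<eta> + 2 * D} G0"
        using G0 by (intro DERIV_continuous_on) auto
      then have "continuous_on {0..D} (\<lambda>\<sigma>. G0 (\<eta> + 2 * \<sigma>))"
        by (rule continuous_on_compose2) (auto intro!: continuous_intros)
      then show "continuous_on {0..D} (\<lambda>\<sigma>. C * G0 (\<eta> + 2 * \<sigma>) / 2)"
        by (intro continuous_intros) auto
    qed
    moreover have "\<bar>\<eta>\<bar> \<le> - (- (6 * S)) - d" using y D unfolding \<eta>_def D_def by linarith
    then have "0 \<le> h2 \<eta> (- (6 * S))" using nn by blast
    moreover have "G0 \<eta> = 0" by (simp add: G0_def)
    moreover have "S * m \<le> G0 (\<eta> + 2 * D)"
    proof -
      have "integral {- S..S} (\<lambda>y. h1 y (- (6 * S))) \<le> G0 (\<eta> + 2 * D)"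
        unfolding G0_def
      proof (rule integral_subset_le)
        show sub: "{- S..S} \<subseteq> {\<eta>..\<eta> + 2 * D}" using y S1 D S by (auto simp: \<eta>_def)
        show "(\<lambda>y. h1 y (- (6 * S))) integrable_on {\<eta>..\<eta> + 2 * D}"
          using cl by (rule integrable_continuous_real)
        show "(\<lambda>y. h1 y (- (6 * S))) integrable_on {- S..S}"
          by (rule integrable_continuous_real, rule continuous_on_subset[OF cl sub])
      qed (use nnx in blast)
      then show ?thesis using mean by linarith
    qed
    then have "C * (S * m) / 2 \<le> C * G0 (\<eta> + 2 * D) / 2" using C0 by (intro divide_right_mono mult_left_mono) auto
    moreover have "\<delta> = exp (- (5 * k2)) * (C * (S * m) / 2)"
      using Spos by (simp add: \<delta>_def C_def \<beta>_def field_simps flip: exp_add)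
    moreover have "exp (- (5 * k2)) * (C * (S * m) / 2) \<le> exp (- (K * D)) * (h2 \<eta> (- (6 * S)) + C * G0 (\<eta> + 2 * D) / 2)"
    proof (rule mult_mono[OF KD[OF D(2)]])
      show "0 \<le> C * (S * m) / 2" using C0 Spos m by simp
      show "C * (S * m) / 2 \<le> h2 \<eta> (- (6 * S)) + C * G0 (\<eta> + 2 * D) / 2" using calculation by linarith
    qed simp
    ultimately show ?thesis by (simp add: \<eta>_def D_def)
  qed
  \<comment> \<open>The bound on \<open>h2\<close> was proved for all slices between - 2 * S and - S
    because \<open>h1\<close> now gathers it along its characteristic during that whole
    period.\<close>
  have h1: "exp (- k2) * (\<beta> * \<delta> * S) \<le> h1 y (- S)"
  proof -
    have "exp (- (K * S)) * (h1 (y + S - 0) (- (2 * S) + 0) + \<beta> * \<delta> * S - \<beta> * \<delta> * 0)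
        \<le> h1 (y + S - S) (- (2 * S) + S)"
    proof (rule gain_along_line[where u = "\<lambda>\<sigma>. h1 (y + S - \<sigma>) (- (2 * S) + \<sigma>)" and
          G = "\<lambda>\<sigma>. \<beta> * \<delta> * \<sigma>" and G' = "\<lambda>\<sigma>. \<beta> * \<delta>", OF less_imp_le[OF Spos] less_imp_le[OF K0]
          relaxes_line[OF R]])
      fix \<sigma> assume s: "0 < \<sigma>" "\<sigma> < S"
      let ?a = "a (y + S - \<sigma>) (- (2 * S) + \<sigma>)" and ?h1 = "h1 (y + S - \<sigma>) (- (2 * S) + \<sigma>)"
        and ?h2 = "h2 (y + S - \<sigma>) (- (2 * S) + \<sigma>)"
      have ic: "\<bar>y + S - \<sigma>\<bar> \<le> - (- (2 * S) + \<sigma>) - d" using s y by auto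
      have aa: "\<beta> \<le> ?a" "?a \<le> K" using a[OF ic] rate[of "- (2 * S) + \<sigma>"] s by auto
      have "\<delta> \<le> ?h2" using h2[of "2 * S - \<sigma>" "y + S - \<sigma>"] s ic by simp
      then have "\<beta> * \<delta> \<le> ?a * ?h2" using \<beta>0 \<delta>0 aa by (intro mult_mono) auto
      moreover have "?a * ?h1 \<le> K * ?h1" using aa nn[OF ic] by (intro mult_right_mono) auto
      ultimately show "\<beta> * \<delta> - K * ?h1 \<le> ?a * (?h2 - ?h1)" by (simp add: algebra_simps)
    qed (use \<beta>0 \<delta>0 y in \<open>auto intro!: derivative_eq_intros continuous_intros\<close>)
    moreover have "\<bar>y + S\<bar> \<le> - (- (2 * S)) - d" using y S by linarith
    then have "0 \<le> h1 (y + S) (- (2 * S))" using nn by blast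
    moreover have "K * S = k2" using Spos by (simp add: K_def)
    ultimately have le: "exp (- k2) * (h1 (y + S) (- (2 * S)) + \<beta> * \<delta> * S) \<le> h1 y (- S)"
      and nn': "0 \<le> h1 (y + S) (- (2 * S))" by simp_all
    show ?thesis by (rule order_trans[OF mult_left_mono le]) (use nn' in auto)
  qed
  have e11: "exp (- (11 * k2)) = exp (- k2) * exp (- (10 * k2))" by (simp flip: exp_add)
  have "exp (- (11 * k2)) * (k1 / 12) * min 1 (k1 / 6) * m = exp (- k2) * \<delta> * min 1 (k1 / 6)"
    by (simp add: \<delta>_def e11)
  moreover have "exp (- k2) * \<delta> * min 1 (k1 / 6) \<le> exp (- k2) * \<delta> * (k1 / 6)"
    using \<delta>0 by (intro mult_left_mono) auto
  moreover have "exp (- k2) * \<delta> * (k1 / 6) = exp (- k2) * (\<beta> * \<delta> * S)"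
    using Spos by (simp add: \<beta>_def)
  moreover have "exp (- k2) * \<delta> * min 1 (k1 / 6) \<le> 1 * \<delta> * 1"
    using \<delta>0 k2 k by (intro mult_mono) auto
  ultimately show ?thesis using h1 h2[of S y] y Spos by linarith
qed

text \<open>Let m and M be the infimum and supremum of both components over the whole cone. On
  [- S, S] the integrals of r1 - m and M - r1 add up to 2 * S * (M - m), so one of them is large
  enough for \<open>relaxes_harnack\<close>. If it is the first for arbitrarily large S, the infimum
  can be raised by a fixed multiple of M - m everywhere; otherwise it is the second for all large S
  and the supremum can be lowered. The multiple depends on k1 and k2 only, so both contradict m <
  M.\<close>

lemma relaxes_liouville:
  assumes R: "relaxes d a b r1 r2" and d: "0 < d" and k: "0 < k1"
    and a: "\<And>y s. \<bar>y\<bar> \<le> - s - d \<Longrightarrow> k1 / (- s) \<le> a y s \<and> a y s \<le> k2 / (- s)"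
    and b: "\<And>y s. \<bar>y\<bar> \<le> - s - d \<Longrightarrow> k1 / (- s) \<le> b y s \<and> b y s \<le> k2 / (- s)"
    and bnd: "\<And>y s. \<bar>y\<bar> \<le> - s - d \<Longrightarrow> \<bar>r1 y s\<bar> \<le> B \<and> \<bar>r2 y s\<bar> \<le> B"
    and c: "\<And>s. continuous_on {y. \<bar>y\<bar> \<le> - s - d} (\<lambda>y. r1 y s)"
  shows "\<exists>c. \<forall>y s. \<bar>y\<bar> \<le> - s - d \<longrightarrow> r1 y s = c \<and> r2 y s = c"
proof -
  define X where "X = (\<lambda>(y, s). r1 y s) ` {(y, s). \<bar>y\<bar> \<le> - s - d} \<union> (\<lambda>(y, s). r2 y s) ` {(y, s). \<bar>y\<bar> \<le> - s - d}"
  have inX: "r1 y s \<in> X" "r2 y s \<in> X" if "\<bar>y\<bar> \<le> - s - d" for y s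
    using that by (auto simp: X_def intro!: image_eqI[of _ _ "(y, s)"])
  have Xne: "X \<noteq> {}" using inX[of 0 "- d"] by auto
  have XB: "\<bar>x\<bar> \<le> B" if "x \<in> X" for x using that bnd by (auto simp: X_def)
  have bdd: "bdd_above X" "bdd_below X"
    using XB by (auto intro!: bdd_aboveI[of _ B] bdd_belowI[of _ "- B"] simp: abs_le_iff) (smt (verit) XB)+
  define M m where "M = Sup X" and "m = Inf X"
  have Mm: "m \<le> x" "x \<le> M" if "x \<in> X" for x
    using that bdd by (auto simp: M_def m_def intro: cInf_lower cSup_upper)
  show ?thesis
  proof (cases "m = M")
    case True
    then show ?thesis using Mm inX by (metis order_antisym)
  next
    case False
    then have mM: "m < M" using Mm Xne by fastforce
    define \<delta> where "\<delta> = exp (- (11 * k2)) * (k1 / 12) * min 1 (k1 / 6)"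
    have \<delta>: "0 < \<delta> * (M - m)" using k mM by (simp add: \<delta>_def)
    have "k1 / d \<le> k2 / d" using a[of 0 "- d"] by simp
    then have k2: "0 < k2" using d k by (simp add: divide_le_cancel)
    have rates: "0 \<le> k1 / (- s)" "k2 / (- s) \<le> k2 / d" if "\<bar>y\<bar> \<le> - s - d" for y s
    proof -
      have "d \<le> - s" using that by linarith
      then show "0 \<le> k1 / (- s)" "k2 / (- s) \<le> k2 / d" using d k k2
        by (auto simp del: divide_minus_right minus_divide_right intro!: divide_left_mono mult_pos_pos divide_nonneg_nonneg)
    qed
    \<comment> \<open>The affine form covers both r - m and M - r. \<open>relaxes_harnack\<close>
      gives the gain on the slice at - S, and the maximum principle carries it to all later
      times.\<close>
    have key: "\<delta> * (M - m) \<le> h1 y s \<and> \<delta> * (M - m) \<le> h2 y s"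
      if h: "h1 = (\<lambda>y s. c * r1 y s + e)" "h2 = (\<lambda>y s. c * r2 y s + e)"
        and nn: "\<And>y s. \<bar>y\<bar> \<le> - s - d \<Longrightarrow> 0 \<le> h1 y s \<and> 0 \<le> h2 y s"
        and S: "d \<le> S" and mean: "S * (M - m) \<le> integral {- S..S} (\<lambda>y. h1 y (- (6 * S)))"
        and ys: "\<bar>y\<bar> \<le> - s - d" "- S \<le> s" for h1 h2 c e S y s
    proof (rule relaxes_max_principle[where K = "k2 / d" and B = 0 and d = d and a = a and b = b and
          S = S and ?h1.0 = h1 and ?h2.0 = h2 and y = y and s = s])
      show R': "relaxes d a b h1 h2" unfolding h by (rule relaxes_affine[OF R])
      fix y assume "\<bar>y\<bar> \<le> S - d"
      then show "\<delta> * (M - m) \<le> h1 y (- S) \<and> \<delta> * (M - m) \<le> h2 y (- S)"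
        unfolding \<delta>_def
      proof (intro relaxes_harnack[OF R' S d k a b nn])
        show "continuous_on {y. \<bar>y\<bar> \<le> 6 * S - d} (\<lambda>y. h1 y (- (6 * S)))"
          unfolding h using c[of "- (6 * S)"] by (intro continuous_intros) auto
      qed (use mean mM in auto)
    next
      fix y s assume ys: "\<bar>y\<bar> \<le> - s - d"
      show "0 \<le> a y s \<and> a y s \<le> k2 / d" "0 \<le> b y s \<and> b y s \<le> k2 / d"
        using a[OF ys] b[OF ys] rates[OF ys] by linarith+
      show "- 0 \<le> h1 y s \<and> - 0 \<le> h2 y s" using nn[OF ys] by simp
    qed (use ys in auto)
    define up where "up S \<longleftrightarrow> S * (M - m) \<le> integral {- S..S} (\<lambda>y. 1 * r1 y (- (6 * S)) + (- m))" for S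
    define dn where "dn S \<longleftrightarrow> S * (M - m) \<le> integral {- S..S} (\<lambda>y. (- 1) * r1 y (- (6 * S)) + M)" for S
    have up_or_dn: "up S \<or> dn S" if S: "d \<le> S" for S
    proof -
      have c': "continuous_on {- S..S} (\<lambda>y. r1 y (- (6 * S)))"
        by (rule continuous_on_subset[OF c[of "- (6 * S)"]]) (use S d in auto)
      have "integral {- S..S} (\<lambda>y. 1 * r1 y (- (6 * S)) + (- m)) + integral {- S..S} (\<lambda>y. (- 1) * r1 y (- (6 * S)) + M)
        = integral {- S..S} (\<lambda>y. (1 * r1 y (- (6 * S)) + (- m)) + ((- 1) * r1 y (- (6 * S)) + M))"
        by (rule Henstock_Kurzweil_Integration.integral_add[symmetric])
          (intro integrable_continuous_real continuous_intros c')+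
      also have "\<dots> = integral {- S..S} (\<lambda>y. M - m)" by (simp add: algebra_simps)
      also have "\<dots> = 2 * (S * (M - m))" using S d by (simp add: algebra_simps)
      finally show ?thesis unfolding up_def dn_def by linarith
    qed
    have False
    proof (cases "\<forall>S0. \<exists>S\<ge>S0. d \<le> S \<and> up S")
      case True
      have "m + \<delta> * (M - m) \<le> r1 y s \<and> m + \<delta> * (M - m) \<le> r2 y s" if ys: "\<bar>y\<bar> \<le> - s - d" for y s
      proof -
        obtain S where S: "S \<ge> - s" "d \<le> S" "up S" using True by blast
        have "\<delta> * (M - m) \<le> 1 * r1 y s + (- m) \<and> \<delta> * (M - m) \<le> 1 * r2 y s + (- m)"
          using S ys Mm inX unfolding up_def by (intro key[OF refl refl, where S = S]) (auto simp: algebra_simps)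
        then show ?thesis by linarith
      qed
      then have "m + \<delta> * (M - m) \<le> x" if "x \<in> X" for x using that by (auto simp: X_def)
      then have "m + \<delta> * (M - m) \<le> m" unfolding m_def using Xne by (intro cInf_greatest) auto
      then show False using \<delta> by simp
    next
      case False
      then obtain S0 where S0: "\<And>S. S0 \<le> S \<Longrightarrow> d \<le> S \<Longrightarrow> dn S" using up_or_dn by blast
      have "r1 y s \<le> M - \<delta> * (M - m) \<and> r2 y s \<le> M - \<delta> * (M - m)" if ys: "\<bar>y\<bar> \<le> - s - d" for y s
      proof -
        define S where "S = max S0 (max d (- s))"
        have "dn S" "d \<le> S" "- s \<le> S" using S0[of S] by (auto simp: S_def)
        then have "\<delta> * (M - m) \<le> (- 1) * r1 y s + M \<and> \<delta> * (M - m) \<le> (- 1) * r2 y s + M"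
          using ys Mm inX unfolding dn_def by (intro key[OF refl refl, where S = S]) (auto simp: algebra_simps)
        then show ?thesis by linarith
      qed
      then have "x \<le> M - \<delta> * (M - m)" if "x \<in> X" for x using that by (auto simp: X_def)
      then have "M \<le> M - \<delta> * (M - m)" unfolding M_def using Xne by (intro cSup_least) auto
      then show False using \<delta> by simp
    qed
    then show ?thesis ..
  qed
qed

section \<open>Transport equations in integral form\<close>

text \<open>The partial derivatives are parameters, so that sums and compositions can name theirs
  explicitly.\<close>

definition C1_on :: "(real \<times> real) set \<Rightarrow> (real \<Rightarrow> real \<Rightarrow> real) \<Rightarrow> (real \<Rightarrow> real \<Rightarrow> real)
    \<Rightarrow> (real \<Rightarrow> real \<Rightarrow> real) \<Rightarrow> bool" where
  "C1_on U u uy us \<longleftrightarrow> (\<forall>(y, s)\<in>U. ((\<lambda>y. u y s) has_real_derivative uy y s) (at y) \<and>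
       ((\<lambda>s. u y s) has_real_derivative us y s) (at s)) \<and>
     continuous_on U (\<lambda>(y, s). uy y s) \<and> continuous_on U (\<lambda>(y, s). us y s)"

lemma C1_on_has_derivative:
  assumes C: "C1_on U u uy us" and U: "open U" "(y, s) \<in> U"
  shows "((\<lambda>(y, s). u y s) has_derivative (\<lambda>(a, b). uy y s * a + us y s * b)) (at (y, s))"
proof -
  obtain e where e: "0 < e" "ball y e \<times> ball s e \<subseteq> U"
  proof -
    obtain A B where AB: "open A" "open B" "y \<in> A" "s \<in> B" "A \<times> B \<subseteq> U"
      using open_prod_elim[OF U] by (metis mem_Sigma_iff)
    obtain e1 e2 where "0 < e1" "ball y e1 \<subseteq> A" "0 < e2" "ball s e2 \<subseteq> B"
      using AB by (meson openE)
    then show thesis using AB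
      by (intro that[of "min e1 e2"]) (auto simp: subset_iff)
  qed
  have sub: "(y', s') \<in> U" if "y' \<in> ball y e" "s' \<in> ball s e" for y' s' using e that by blast
  have "((\<lambda>(y, s). u y s) has_derivative (\<lambda>(a, b). (\<lambda>a. uy y s * a) a + blinfun_scaleR_left (us y s) b))
     (at (y, s) within ball y e \<times> ball s e)"
  proof (rule has_derivative_partialsI[where fy = "\<lambda>y s. blinfun_scaleR_left (us y s)"])
    show "((\<lambda>x. u x s) has_derivative (\<lambda>a. uy y s * a)) (at y within ball y e)"
      using C U by (fastforce simp: C1_on_def has_field_derivative_def intro: has_derivative_at_withinI)
    show "(u y' has_derivative blinfun_apply (blinfun_scaleR_left (us y' s'))) (at s' within ball s e)"
      if "y' \<in> ball y e" "s' \<in> ball s e" for y' s'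
    proof -
      have "(u y' has_real_derivative us y' s') (at s')" using C sub[OF that] by (auto simp: C1_on_def)
      moreover have "blinfun_apply (blinfun_scaleR_left (us y' s')) = (*) (us y' s')"
        by (auto simp: mult.commute)
      ultimately show ?thesis by (auto simp: has_field_derivative_def intro: has_derivative_at_withinI)
    qed
    have "isCont (\<lambda>(y, s). us y s) (y, s)"
      using C U by (auto simp: C1_on_def continuous_on_eq_continuous_at)
    then have "isCont (\<lambda>z. blinfun_scaleR_left ((\<lambda>(y, s). us y s) z)) (y, s)"
      by (rule bounded_linear.continuous[OF bounded_linear_blinfun_scaleR_left])
    then show "continuous (at (y, s) within ball y e \<times> ball s e) (\<lambda>(x, y). blinfun_scaleR_left (us x y))"
      by (auto simp: case_prod_unfold intro: continuous_at_imp_continuous_at_within)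
  qed (use e in auto)
  moreover have "at (y, s) within ball y e \<times> ball s e = at (y, s)"
    using e by (intro at_within_open) (auto intro: open_Times)
  ultimately show ?thesis by (simp add: mult.commute)
qed

lemma C1_on_line:
  assumes C: "C1_on U u uy us" and U: "open U" "(y + c * \<sigma>, s + e * \<sigma>) \<in> U"
  shows "((\<lambda>\<sigma>. u (y + c * \<sigma>) (s + e * \<sigma>)) has_real_derivative
    c * uy (y + c * \<sigma>) (s + e * \<sigma>) + e * us (y + c * \<sigma>) (s + e * \<sigma>)) (at \<sigma>)"
proof -
  have l: "((\<lambda>\<sigma>. (y + c * \<sigma>, s + e * \<sigma>)) has_derivative (\<lambda>h. (c * h, e * h))) (at \<sigma>)"
    by (auto intro!: derivative_eq_intros)
  have "((\<lambda>(y, s). u y s) \<circ> (\<lambda>\<sigma>. (y + c * \<sigma>, s + e * \<sigma>)) has_derivative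
     (\<lambda>(a, b). uy (y + c * \<sigma>) (s + e * \<sigma>) * a + us (y + c * \<sigma>) (s + e * \<sigma>) * b) \<circ> (\<lambda>h. (c * h, e * h))) (at \<sigma>)"
    by (rule diff_chain_at[OF l]) (rule C1_on_has_derivative[OF C U])
  then have "((\<lambda>\<sigma>. u (y + c * \<sigma>) (s + e * \<sigma>)) has_derivative
     (\<lambda>h. (c * uy (y + c * \<sigma>) (s + e * \<sigma>) + e * us (y + c * \<sigma>) (s + e * \<sigma>)) * h)) (at \<sigma>)"
    by (simp add: o_def algebra_simps)
  then show ?thesis by (simp add: has_field_derivative_def)
qed

lemma C1_on_continuous:
  assumes "C1_on U u uy us" "open U"
  shows "continuous_on U (\<lambda>(y, s). u y s)"
  using assms C1_on_has_derivative
  by (intro continuous_at_imp_continuous_on ballI) (metis has_derivative_continuous surj_pair)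

text \<open>The integral equation only runs forward; starting it at - \<delta> makes 0 an interior
  point and yields a two-sided derivative.\<close>

lemma has_real_derivative_integral_eq:
  fixes u k :: "real \<Rightarrow> real"
  assumes \<delta>: "0 < \<delta>" and k: "continuous_on {- \<delta>..\<delta>} k"
    and eq: "\<And>h. 0 \<le> h \<Longrightarrow> h \<le> 2 * \<delta> \<Longrightarrow> u (h - \<delta>) = u (- \<delta>) + integral {0..h} (\<lambda>\<sigma>. k (\<sigma> - \<delta>))"
  shows "(u has_real_derivative k 0) (at 0)"
proof -
  have "continuous_on {0..2 * \<delta>} (\<lambda>\<sigma>. k (\<sigma> - \<delta>))"
    by (rule continuous_on_compose2[OF k]) (auto intro!: continuous_intros)
  from integral_has_real_derivative[OF this, of \<delta>] \<delta>
  have "((\<lambda>h. integral {0..h} (\<lambda>\<sigma>. k (\<sigma> - \<delta>))) has_real_derivative k 0) (at \<delta>)"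
    by (simp add: at_within_Icc_at)
  then have "((\<lambda>h. u (- \<delta>) + integral {0..h} (\<lambda>\<sigma>. k (\<sigma> - \<delta>))) has_real_derivative k 0) (at \<delta>)"
    by (auto intro!: derivative_eq_intros)
  then have "((\<lambda>h. u (h - \<delta>)) has_real_derivative k 0) (at \<delta>)"
  proof (rule has_field_derivative_transform_within_open[where S = "{0<..<2 * \<delta>}"])
    fix h assume "h \<in> {0<..<2 * \<delta>}"
    then show "u (- \<delta>) + integral {0..h} (\<lambda>\<sigma>. k (\<sigma> - \<delta>)) = u (h - \<delta>)" using eq[of h] by simp
  qed (use \<delta> in auto)
  then show ?thesis using DERIV_shift[of "\<lambda>h. u (h - \<delta>)" "k 0" 0 \<delta>] by simp
qed

text \<open>
  Differentiating the transport equation inside its integral form avoids mixed second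
  derivatives, so that no regularity beyond \<open>C\<^sup>1\<close> enters.
\<close>

lemma transport_derivatives:
  fixes u G :: "real \<Rightarrow> real \<Rightarrow> real"
  assumes U: "open U" and u: "C1_on U u uy us" and G: "C1_on U G Gy Gs"
    and past: "\<And>y s h. 0 \<le> h \<Longrightarrow> (y + e * h, s + h) \<in> U \<Longrightarrow> (y, s) \<in> U"
    and eq: "\<And>y s h. 0 \<le> h \<Longrightarrow> (y + e * h, s + h) \<in> U \<Longrightarrow>
      u (y + e * h) (s + h) = u y s + integral {0..h} (\<lambda>\<sigma>. G (y + e * \<sigma>) (s + \<sigma>))"
    and ys: "(y, s) \<in> U"
  shows "e * uy y s + us y s = G y s"
    and "((\<lambda>\<sigma>. uy (y + e * \<sigma>) (s + \<sigma>)) has_real_derivative Gy y s) (at 0)"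
    and "((\<lambda>\<sigma>. us (y + e * \<sigma>) (s + \<sigma>)) has_real_derivative Gs y s) (at 0)"
proof -
  note Gcont = C1_on_continuous[OF G U]
  have past': "(y + e * \<sigma>, s + \<sigma>) \<in> U" if "\<sigma> \<le> h" "(y + e * h, s + h) \<in> U" for y s \<sigma> h
    using past[of "h - \<sigma>" "y + e * \<sigma>" "s + \<sigma>"] that by (simp add: algebra_simps)
  have line_cont: "continuous_on {..h} (\<lambda>\<sigma>. k (y + e * \<sigma>) (s + \<sigma>))"
    if "continuous_on U (\<lambda>(y, s). k y s)" "(y + e * h, s + h) \<in> U" for k :: "real \<Rightarrow> real \<Rightarrow> real" and y s h
  proof -
    have "continuous_on {..h} (\<lambda>\<sigma>. (\<lambda>(y, s). k y s) (y + e * \<sigma>, s + \<sigma>))"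
      by (rule continuous_on_compose2[OF that(1)]) (auto intro!: continuous_intros past'[OF _ that(2)])
    then show ?thesis by simp
  qed
  have "isCont (\<lambda>\<sigma>. (y + e * \<sigma>, s + \<sigma>)) 0" by (intro continuous_intros)
  then have "\<forall>\<^sub>F \<sigma> in nhds 0. (y + e * \<sigma>, s + \<sigma>) \<in> U"
    using U ys by (auto intro!: topological_tendstoD simp: continuous_within tendsto_nhds_iff)
  then obtain \<delta>0 where \<delta>0: "\<delta>0 > 0" "\<And>\<sigma>. \<bar>\<sigma>\<bar> < \<delta>0 \<Longrightarrow> (y + e * \<sigma>, s + \<sigma>) \<in> U"
    by (auto simp: eventually_nhds_metric dist_real_def)
  define \<delta> where "\<delta> = \<delta>0 / 2"
  have \<delta>: "\<delta> > 0" "(y + e * \<delta>, s + \<delta>) \<in> U" using \<delta>0(1) \<delta>0(2)[of \<delta>] by (auto simp: \<delta>_def)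
  \<comment> \<open>Stated for arbitrary \<open>w\<close> and \<open>k\<close>: it serves for u with
    density G and, once their integral equations are available, for uy with Gy and us with
    Gs.\<close>
  have D: "((\<lambda>\<sigma>. w (y + e * \<sigma>) (s + \<sigma>)) has_real_derivative k y s) (at 0)"
    if k: "continuous_on U (\<lambda>(y, s). k y s)" and eq: "\<And>y s h. 0 \<le> h \<Longrightarrow> (y + e * h, s + h) \<in> U \<Longrightarrow>
      w (y + e * h) (s + h) = w y s + integral {0..h} (\<lambda>\<sigma>. k (y + e * \<sigma>) (s + \<sigma>))"
    for w k :: "real \<Rightarrow> real \<Rightarrow> real"
  proof -
    have "((\<lambda>\<sigma>. w (y + e * \<sigma>) (s + \<sigma>)) has_real_derivative k (y + e * 0) (s + 0)) (at 0)"
    proof (rule has_real_derivative_integral_eq[OF \<delta>(1)])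
      show "continuous_on {- \<delta>..\<delta>} (\<lambda>\<sigma>. k (y + e * \<sigma>) (s + \<sigma>))"
        by (rule continuous_on_subset[OF line_cont[OF k \<delta>(2)]]) auto
      fix h assume h: "0 \<le> h" "h \<le> 2 * \<delta>"
      have "(y + e * (h - \<delta>), s + (h - \<delta>)) \<in> U" by (rule past'[OF _ \<delta>(2)]) (use h in auto)
      then show "w (y + e * (h - \<delta>)) (s + (h - \<delta>)) = w (y + e * - \<delta>) (s + - \<delta>) +
          integral {0..h} (\<lambda>\<sigma>. k (y + e * (\<sigma> - \<delta>)) (s + (\<sigma> - \<delta>)))"
        using eq[OF h(1), of "y - e * \<delta>" "s - \<delta>"] by (simp add: algebra_simps)
    qed
    then show ?thesis by simp
  qed
  have "((\<lambda>\<sigma>. u (y + e * \<sigma>) (s + 1 * \<sigma>)) has_real_derivative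
      e * uy (y + e * 0) (s + 1 * 0) + 1 * us (y + e * 0) (s + 1 * 0)) (at 0)"
    using ys by (intro C1_on_line[OF u U]) auto
  then show "e * uy y s + us y s = G y s" using D[OF Gcont eq] by (auto dest: DERIV_unique)
  \<comment> \<open>Displace the base point by \<theta> * (c, l) and differentiate the integral
    equation at \<theta> = 0. The result has the same form, with the directional derivatives of u
    and G in place of u and G.\<close>
  have dir: "c * uy (y + e * h) (s + h) + l * us (y + e * h) (s + h) = c * uy y s + l * us y s +
      integral {0..h} (\<lambda>\<sigma>. c * Gy (y + e * \<sigma>) (s + \<sigma>) + l * Gs (y + e * \<sigma>) (s + \<sigma>))"
    if h: "0 \<le> h" and yh: "(y + e * h, s + h) \<in> U" for c l y s h
  proof -
    have "isCont (\<lambda>\<theta>. (y + c * \<theta> + e * h, s + l * \<theta> + h)) 0" by (intro continuous_intros)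
    then have "\<forall>\<^sub>F \<theta> in nhds 0. (y + c * \<theta> + e * h, s + l * \<theta> + h) \<in> U"
      using U yh by (auto intro!: topological_tendstoD simp: continuous_within tendsto_nhds_iff)
    then obtain \<delta> where \<delta>: "\<delta> > 0" "\<And>\<theta>. \<bar>\<theta>\<bar> < \<delta> \<Longrightarrow> (y + c * \<theta> + e * h, s + l * \<theta> + h) \<in> U"
      by (auto simp: eventually_nhds_metric dist_real_def)
    \<comment> \<open>The displaced segments end in \<open>U\<close> for \<theta> in this interval,
      and by \<open>past'\<close> they then lie in \<open>U\<close> entirely.\<close>
    define I where "I = {- \<delta><..<\<delta>}"
    have I: "open I" "0 \<in> I" "convex I" using \<delta> by (auto simp: I_def)
    have inU: "(y + c * \<theta> + e * \<sigma>, s + l * \<theta> + \<sigma>) \<in> U" if "\<theta> \<in> I" "\<sigma> \<le> h" for \<theta> \<sigma>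
      by (rule past'[OF that(2)]) (use that \<delta> in \<open>auto simp: I_def\<close>)
    have "((\<lambda>\<theta>. integral (cbox 0 h) (\<lambda>\<sigma>. G (y + c * \<theta> + e * \<sigma>) (s + l * \<theta> + \<sigma>))) has_real_derivative
      integral (cbox 0 h) (\<lambda>\<sigma>. c * Gy (y + c * 0 + e * \<sigma>) (s + l * 0 + \<sigma>) + l * Gs (y + c * 0 + e * \<sigma>) (s + l * 0 + \<sigma>)))
      (at 0 within I)"
    proof (rule leibniz_rule_field_derivative)
      fix \<theta> \<sigma> assume t: "\<theta> \<in> I" "\<sigma> \<in> cbox 0 h"
      have sw: "y + e * \<sigma> + c * \<theta> = y + c * \<theta> + e * \<sigma>" "s + \<sigma> + l * \<theta> = s + l * \<theta> + \<sigma>" for \<theta> by simp_all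
      have "((\<lambda>\<theta>. G (y + e * \<sigma> + c * \<theta>) (s + \<sigma> + l * \<theta>)) has_real_derivative
        c * Gy (y + e * \<sigma> + c * \<theta>) (s + \<sigma> + l * \<theta>) + l * Gs (y + e * \<sigma> + c * \<theta>) (s + \<sigma> + l * \<theta>)) (at \<theta>)"
        by (rule C1_on_line[OF G U]) (use inU[of \<theta> \<sigma>] t in \<open>unfold sw, auto\<close>)
      then show "((\<lambda>\<theta>. G (y + c * \<theta> + e * \<sigma>) (s + l * \<theta> + \<sigma>)) has_real_derivative
        c * Gy (y + c * \<theta> + e * \<sigma>) (s + l * \<theta> + \<sigma>) + l * Gs (y + c * \<theta> + e * \<sigma>) (s + l * \<theta> + \<sigma>)) (at \<theta> within I)"
        unfolding sw by (rule has_field_derivative_at_within)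
    next
      fix \<theta> assume t: "\<theta> \<in> I"
      have "continuous_on {..h} (\<lambda>\<sigma>. G (y + c * \<theta> + e * \<sigma>) (s + l * \<theta> + \<sigma>))"
        using inU[OF t] by (intro line_cont[OF Gcont]) auto
      then show "(\<lambda>\<sigma>. G (y + c * \<theta> + e * \<sigma>) (s + l * \<theta> + \<sigma>)) integrable_on cbox 0 h"
        unfolding cbox_interval by (intro integrable_continuous_real) (rule continuous_on_subset, auto)
    next
      have cc: "continuous_on (I \<times> cbox 0 h) (\<lambda>z. k (y + c * fst z + e * snd z) (s + l * fst z + snd z))"
        if "continuous_on U (\<lambda>(y, s). k y s)" for k :: "real \<Rightarrow> real \<Rightarrow> real"
      proof -
        have "continuous_on (I \<times> cbox 0 h) (\<lambda>z. (\<lambda>(y, s). k y s) (y + c * fst z + e * snd z, s + l * fst z + snd z))"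
          by (rule continuous_on_compose2[OF that]) (auto intro!: continuous_intros inU)
        then show ?thesis by simp
      qed
      show "continuous_on (I \<times> cbox 0 h) (\<lambda>(\<theta>, \<sigma>). c * Gy (y + c * \<theta> + e * \<sigma>) (s + l * \<theta> + \<sigma>)
          + l * Gs (y + c * \<theta> + e * \<sigma>) (s + l * \<theta> + \<sigma>))"
        unfolding case_prod_unfold using G by (intro continuous_intros cc) (auto simp: C1_on_def)
    qed (use I in auto)
    then have i: "((\<lambda>\<theta>. integral {0..h} (\<lambda>\<sigma>. G (y + c * \<theta> + e * \<sigma>) (s + l * \<theta> + \<sigma>))) has_real_derivative
      integral {0..h} (\<lambda>\<sigma>. c * Gy (y + e * \<sigma>) (s + \<sigma>) + l * Gs (y + e * \<sigma>) (s + \<sigma>))) (at 0)"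
      using at_within_open[OF I(2,1)] by simp
    have "((\<lambda>\<theta>. u (y + c * \<theta>) (s + l * \<theta>)) has_real_derivative
        c * uy (y + c * 0) (s + l * 0) + l * us (y + c * 0) (s + l * 0)) (at 0)"
      using inU[OF I(2), of 0] h by (intro C1_on_line[OF u U]) auto
    from DERIV_add[OF this i]
    have "((\<lambda>\<theta>. u (y + c * \<theta> + e * h) (s + l * \<theta> + h)) has_real_derivative c * uy y s + l * us y s +
      integral {0..h} (\<lambda>\<sigma>. c * Gy (y + e * \<sigma>) (s + \<sigma>) + l * Gs (y + e * \<sigma>) (s + \<sigma>))) (at 0)"
      using eq[OF h] inU by (subst (asm) DERIV_cong_ev[OF refl _ refl])
       (auto intro!: eventually_nhds_in_open[THEN eventually_mono, OF I(1,2)])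
    moreover have sw: "y + e * h + c * \<theta> = y + c * \<theta> + e * h" "s + h + l * \<theta> = s + l * \<theta> + h" for \<theta> by simp_all
    have "((\<lambda>\<theta>. u (y + e * h + c * \<theta>) (s + h + l * \<theta>)) has_real_derivative
        c * uy (y + e * h + c * 0) (s + h + l * 0) + l * us (y + e * h + c * 0) (s + h + l * 0)) (at 0)"
      by (rule C1_on_line[OF u U]) (use yh in auto)
    then have "((\<lambda>\<theta>. u (y + c * \<theta> + e * h) (s + l * \<theta> + h)) has_real_derivative
        c * uy (y + e * h) (s + h) + l * us (y + e * h) (s + h)) (at 0)"
      unfolding sw by simp
    ultimately show ?thesis by (rule DERIV_unique[rotated])
  qed
  have "continuous_on U (\<lambda>(y, s). Gy y s)" "continuous_on U (\<lambda>(y, s). Gs y s)"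
    using G by (auto simp: C1_on_def)
  then show "((\<lambda>\<sigma>. uy (y + e * \<sigma>) (s + \<sigma>)) has_real_derivative Gy y s) (at 0)"
    "((\<lambda>\<sigma>. us (y + e * \<sigma>) (s + \<sigma>)) has_real_derivative Gs y s) (at 0)"
    using dir[of _ _ _ 1 0] dir[of _ _ _ 0 1] by (auto intro!: D)
qed

section \<open>Rigidity of ancient profiles\<close>

lemma has_real_derivative_powr_comp:
  fixes f :: "real \<Rightarrow> real"
  assumes "(f has_real_derivative D) (at x)" "0 < f x"
  shows "((\<lambda>x. f x powr r) has_real_derivative r * f x powr (r - 1) * D) (at x)"
  using DERIV_chain2[OF has_real_derivative_powr[OF assms(2)] assms(1)] .

text \<open>What survives a blow-up limit: the equations in integral form, monotonicity across cones
  wider than light cones, and in \<open>low\<close> the lower rate v >= (C * (T - s)) powr (- 1 / (p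
  - 1)), written so that it can be read as a bound on the distance to the curve.\<close>

locale ancient_profile =
  fixes p \<kappa> C :: real and T :: "real \<Rightarrow> real" and v1 v2 v1y v1s v2y v2s :: "real \<Rightarrow> real \<Rightarrow> real"
  assumes p: "1 < p" and \<kappa>: "0 < \<kappa>" "\<kappa> < 1"
    and lip: "\<bar>T y - T y'\<bar> \<le> \<kappa> * \<bar>y - y'\<bar>"
    and reg1: "C1_on {(y, s). s < T y} v1 v1y v1s"
    and reg2: "C1_on {(y, s). s < T y} v2 v2y v2s"
    and nonneg: "s < T y \<Longrightarrow> 0 \<le> v1 y s \<and> 0 \<le> v2 y s"
    and eq1: "0 \<le> h \<Longrightarrow> s + h < T (y - h) \<Longrightarrow> v1 (y - h) (s + h) =
      v1 y s + integral {0..h} (\<lambda>\<sigma>. 2 powr (- p) * (v1 (y - \<sigma>) (s + \<sigma>) + v2 (y - \<sigma>) (s + \<sigma>)) powr p)"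
    and eq2: "0 \<le> h \<Longrightarrow> s + h < T (y + h) \<Longrightarrow> v2 (y + h) (s + h) =
      v2 y s + integral {0..h} (\<lambda>\<sigma>. 2 powr (- p) * (v1 (y + \<sigma>) (s + \<sigma>) + v2 (y + \<sigma>) (s + \<sigma>)) powr p)"
    and mono: "s < T y \<Longrightarrow> s' < T y' \<Longrightarrow> \<kappa> * \<bar>y' - y\<bar> \<le> s' - s \<Longrightarrow> v1 y s \<le> v1 y' s' \<and> v2 y s \<le> v2 y' s'"
    and low: "s < T y \<Longrightarrow> 0 < v1 y s + v2 y s \<and> (v1 y s + v2 y s) powr (1 - p) \<le> C * (T y - s)"
begin

section \<open>Derivative bounds and the blow-up rate of an ancient profile\<close>

definition "\<Omega> = {(y, s). s < T y}"
definition "v y s = v1 y s + v2 y s"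
definition "G y s = 2 powr (- p) * v y s powr p"
definition "G' y s = 2 powr (- p) * (p * v y s powr (p - 1))"

lemma in_\<Omega>[simp]: "(y, s) \<in> \<Omega> \<longleftrightarrow> s < T y"
  by (simp add: \<Omega>_def)

lemma open_\<Omega>: "open \<Omega>"
proof -
  have T: "continuous_on UNIV T"
    using lip \<kappa> by (intro lipschitz_on_continuous_on[of \<kappa>] lipschitz_onI) (auto simp: dist_real_def)
  have "continuous_on UNIV (\<lambda>z :: real \<times> real. T (fst z))"
    by (rule continuous_on_compose2[OF T]) (auto intro: continuous_intros)
  then have "open {z :: real \<times> real. snd z < T (fst z)}"
    by (intro open_Collect_less continuous_intros)
  then show ?thesis by (simp add: \<Omega>_def case_prod_unfold)
qed

lemma vpos: "s < T y \<Longrightarrow> 0 < v y s"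
  using low by (simp add: v_def)

lemma Gpos: "s < T y \<Longrightarrow> 0 < G y s" "s < T y \<Longrightarrow> 0 < G' y s"
  using vpos[of s y] p by (simp_all add: G_def G'_def)

lemma reg_v: "C1_on \<Omega> v (\<lambda>y s. v1y y s + v2y y s) (\<lambda>y s. v1s y s + v2s y s)"
  using reg1 reg2 unfolding C1_on_def \<Omega>_def v_def[abs_def] case_prod_unfold
  by (auto intro!: derivative_eq_intros continuous_intros)

lemma reg_G: "C1_on \<Omega> G (\<lambda>y s. G' y s * (v1y y s + v2y y s)) (\<lambda>y s. G' y s * (v1s y s + v2s y s))"
proof -
  note c = C1_on_continuous[OF reg_v open_\<Omega>]
  have c': "continuous_on \<Omega> (\<lambda>(y, s). G' y s)"
    unfolding G'_def case_prod_unfold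
    using c vpos by (auto intro!: continuous_intros simp: case_prod_unfold \<Omega>_def) fastforce+
  have D: "((\<lambda>x. 2 powr (- p) * f x powr p) has_real_derivative 2 powr (- p) * (p * f z powr (p - 1)) * D) (at z)"
    if "(f has_real_derivative D) (at z)" "0 < f z" for f z D
    using DERIV_cmult[OF has_real_derivative_powr_comp[OF that, of p], of "2 powr (- p)"] by (simp add: mult.assoc)
  show ?thesis
    unfolding C1_on_def
  proof (intro conjI ballI)
    fix z assume z: "z \<in> \<Omega>"
    obtain y s where ys: "z = (y, s)" by (cases z)
    have "((\<lambda>y. v y s) has_real_derivative v1y y s + v2y y s) (at y)"
      "((\<lambda>s. v y s) has_real_derivative v1s y s + v2s y s) (at s)" "0 < v y s"
      using bspec[OF conjunct1[OF reg_v[unfolded C1_on_def]] z] z vpos[of s y] ys by auto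
    then show "case z of (y, s) \<Rightarrow>
        ((\<lambda>y. G y s) has_real_derivative G' y s * (v1y y s + v2y y s)) (at y) \<and>
        (G y has_real_derivative G' y s * (v1s y s + v2s y s)) (at s)"
      unfolding ys G_def[abs_def] G'_def by (auto intro!: D)
  next
    show "continuous_on \<Omega> (\<lambda>(y, s). G' y s * (v1y y s + v2y y s))"
      "continuous_on \<Omega> (\<lambda>(y, s). G' y s * (v1s y s + v2s y s))"
      using c' reg_v by (auto intro!: continuous_on_mult simp: C1_on_def case_prod_unfold)
  qed
qed

text \<open>Characteristics have slope 1 and the curve has slope at most \<kappa> < 1, so a
  characteristic that ends below the curve stays below it in its past.\<close>

lemma past1: "0 \<le> h \<Longrightarrow> s + h < T (y + e * h) \<Longrightarrow> \<bar>e\<bar> = 1 \<Longrightarrow> s < T y"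
proof -
  assume h: "0 \<le> h" "s + h < T (y + e * h)" "\<bar>e\<bar> = 1"
  have "T (y + e * h) \<le> T y + \<kappa> * h" using lip[of "y + e * h" y] h by (simp add: abs_mult)
  moreover have "\<kappa> * h \<le> 1 * h" using h \<kappa> by (intro mult_right_mono) auto
  ultimately show ?thesis using h by linarith
qed

lemma transport1:
  assumes "s < T y"
  shows "v1s y s - v1y y s = G y s"
    and "((\<lambda>\<sigma>. v1y (y - \<sigma>) (s + \<sigma>)) has_real_derivative G' y s * (v1y y s + v2y y s)) (at 0)"
    and "((\<lambda>\<sigma>. v1s (y - \<sigma>) (s + \<sigma>)) has_real_derivative G' y s * (v1s y s + v2s y s)) (at 0)"
proof -
  note t = transport_derivatives[OF open_\<Omega> reg1[folded \<Omega>_def] reg_G, where e = "- 1"]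
  have P: "(y, s) \<in> \<Omega>" if "0 \<le> h" "(y + - 1 * h, s + h) \<in> \<Omega>" for y s h
    using past1[of h s y "- 1"] that by simp
  have E: "v1 (y + - 1 * h) (s + h) = v1 y s + integral {0..h} (\<lambda>\<sigma>. G (y + - 1 * \<sigma>) (s + \<sigma>))"
    if "0 \<le> h" "(y + - 1 * h, s + h) \<in> \<Omega>" for y s h
    using eq1[of h s y] that by (simp add: G_def v_def)
  have "- 1 * v1y y s + v1s y s = G y s"
    by (rule t(1)) (erule (1) P, erule (1) E, simp add: assms)
  then show "v1s y s - v1y y s = G y s" by simp
  have "((\<lambda>\<sigma>. v1y (y + - 1 * \<sigma>) (s + \<sigma>)) has_real_derivative G' y s * (v1y y s + v2y y s)) (at 0)"
    by (rule t(2)) (erule (1) P, erule (1) E, simp add: assms)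
  then show "((\<lambda>\<sigma>. v1y (y - \<sigma>) (s + \<sigma>)) has_real_derivative G' y s * (v1y y s + v2y y s)) (at 0)"
    by simp
  have "((\<lambda>\<sigma>. v1s (y + - 1 * \<sigma>) (s + \<sigma>)) has_real_derivative G' y s * (v1s y s + v2s y s)) (at 0)"
    by (rule t(3)) (erule (1) P, erule (1) E, simp add: assms)
  then show "((\<lambda>\<sigma>. v1s (y - \<sigma>) (s + \<sigma>)) has_real_derivative G' y s * (v1s y s + v2s y s)) (at 0)"
    by simp
qed

lemma transport2:
  assumes "s < T y"
  shows "v2s y s + v2y y s = G y s"
    and "((\<lambda>\<sigma>. v2y (y + \<sigma>) (s + \<sigma>)) has_real_derivative G' y s * (v1y y s + v2y y s)) (at 0)"
    and "((\<lambda>\<sigma>. v2s (y + \<sigma>) (s + \<sigma>)) has_real_derivative G' y s * (v1s y s + v2s y s)) (at 0)"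
proof -
  note t = transport_derivatives[OF open_\<Omega> reg2[folded \<Omega>_def] reg_G, where e = "1"]
  have P: "(y, s) \<in> \<Omega>" if "0 \<le> h" "(y + 1 * h, s + h) \<in> \<Omega>" for y s h
    using past1[of h s y "1"] that by simp
  have E: "v2 (y + 1 * h) (s + h) = v2 y s + integral {0..h} (\<lambda>\<sigma>. G (y + 1 * \<sigma>) (s + \<sigma>))"
    if "0 \<le> h" "(y + 1 * h, s + h) \<in> \<Omega>" for y s h
    using eq2[of h s y] that by (simp add: G_def v_def)
  have "1 * v2y y s + v2s y s = G y s"
    by (rule t(1)) (erule (1) P, erule (1) E, simp add: assms)
  then show "v2s y s + v2y y s = G y s" by simp
  have "((\<lambda>\<sigma>. v2y (y + 1 * \<sigma>) (s + \<sigma>)) has_real_derivative G' y s * (v1y y s + v2y y s)) (at 0)"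
    by (rule t(2)) (erule (1) P, erule (1) E, simp add: assms)
  then show "((\<lambda>\<sigma>. v2y (y + \<sigma>) (s + \<sigma>)) has_real_derivative G' y s * (v1y y s + v2y y s)) (at 0)"
    by simp
  have "((\<lambda>\<sigma>. v2s (y + 1 * \<sigma>) (s + \<sigma>)) has_real_derivative G' y s * (v1s y s + v2s y s)) (at 0)"
    by (rule t(3)) (erule (1) P, erule (1) E, simp add: assms)
  then show "((\<lambda>\<sigma>. v2s (y + \<sigma>) (s + \<sigma>)) has_real_derivative G' y s * (v1s y s + v2s y s)) (at 0)"
    by simp
qed

text \<open>The directions (1, \<kappa>) and (- 1, \<kappa>) lie on the boundary of the cone in
  which \<open>mono\<close> holds; a negative derivative along one of them would make the function
  drop there.\<close>

lemma cone_derivative: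
  assumes s: "s < T y"
  shows "\<bar>v1y y s\<bar> \<le> \<kappa> * v1s y s" "\<bar>v2y y s\<bar> \<le> \<kappa> * v2s y s"
proof -
  have key: "0 \<le> c * uy y s + \<kappa> * us y s"
    if u: "C1_on \<Omega> u uy us" and c: "\<bar>c\<bar> = 1"
      and m: "\<And>y' s'. s' < T y' \<Longrightarrow> \<kappa> * \<bar>y' - y\<bar> \<le> s' - s \<Longrightarrow> u y s \<le> u y' s'"
    for u uy us :: "real \<Rightarrow> real \<Rightarrow> real" and c
  proof (rule ccontr)
    assume neg: "\<not> ?thesis"
    have "((\<lambda>\<sigma>. u (y + c * \<sigma>) (s + \<kappa> * \<sigma>)) has_real_derivative
      c * uy (y + c * 0) (s + \<kappa> * 0) + \<kappa> * us (y + c * 0) (s + \<kappa> * 0)) (at 0)"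
      using s by (intro C1_on_line[OF u open_\<Omega>]) auto
    from DERIV_neg_dec_right[OF this] neg
    obtain d where d: "d > 0" "\<forall>\<sigma>>0. \<sigma> < d \<longrightarrow> u (y + c * \<sigma>) (s + \<kappa> * \<sigma>) < u y s" by auto
    \<comment> \<open>A step of size \<sigma> raises s by at most \<sigma> and lowers T by at most
      \<sigma>, so a quarter of the gap keeps the segment below the curve.\<close>
    define \<sigma> where "\<sigma> = min (d / 2) ((T y - s) / 4)"
    have \<sigma>: "0 < \<sigma>" "\<sigma> < d" "\<sigma> \<le> (T y - s) / 4" using d(1) s by (auto simp: \<sigma>_def min_def)
    have aux: "s + k < t" if "k \<le> \<sigma>" "T y - k \<le> t" for k t using that \<sigma> s by (simp add: field_simps)
    have "s + \<kappa> * \<sigma> < T (y + c * \<sigma>)"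
    proof (rule aux)
      show "\<kappa> * \<sigma> \<le> \<sigma>" using \<sigma> \<kappa> by simp
      show "T y - \<kappa> * \<sigma> \<le> T (y + c * \<sigma>)" using lip[of "y + c * \<sigma>" y] c \<sigma> by (simp add: abs_mult)
    qed
    then have "u y s \<le> u (y + c * \<sigma>) (s + \<kappa> * \<sigma>)" using c \<sigma> by (intro m) (auto simp: abs_mult)
    then show False using d(2) \<sigma>(1,2) by (meson not_less)
  qed
  have "0 \<le> 1 * v1y y s + \<kappa> * v1s y s" "0 \<le> - 1 * v1y y s + \<kappa> * v1s y s"
    by (rule key[OF reg1[folded \<Omega>_def]]; use mono s in auto)+
  then show "\<bar>v1y y s\<bar> \<le> \<kappa> * v1s y s" by linarith
  have "0 \<le> 1 * v2y y s + \<kappa> * v2s y s" "0 \<le> - 1 * v2y y s + \<kappa> * v2s y s"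
    by (rule key[OF reg2[folded \<Omega>_def]]; use mono s in auto)+
  then show "\<bar>v2y y s\<bar> \<le> \<kappa> * v2s y s" by linarith
qed

text \<open>In v1s - v1y = G and v2s + v2y = G the spatial derivative is at most \<kappa> times the
  time derivative.\<close>

lemma time_derivative_bounds:
  assumes s: "s < T y"
  shows "G y s / (1 + \<kappa>) \<le> v1s y s" "v1s y s \<le> G y s / (1 - \<kappa>)"
    "G y s / (1 + \<kappa>) \<le> v2s y s" "v2s y s \<le> G y s / (1 - \<kappa>)"
  using cone_derivative[OF s] transport1(1)[OF s] transport2(1)[OF s] \<kappa>
  by (auto simp: field_simps)

lemma time_derivative_pos:
  assumes s: "s < T y"
  shows "0 < v1s y s" "0 < v2s y s"
proof -
  have "0 < G y s / (1 + \<kappa>)" using Gpos[OF s] \<kappa> by simp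
  then show "0 < v1s y s" "0 < v2s y s" using time_derivative_bounds[OF s] by linarith+
qed

lemma power_time_derivative:
  assumes s: "s < T y"
  shows "((\<lambda>s. v y s powr (1 - p)) has_real_derivative - (p - 1) * (v1s y s + v2s y s) * v y s powr (- p)) (at s)"
proof -
  have "((\<lambda>s. v y s) has_real_derivative v1s y s + v2s y s) (at s)"
    using reg_v s by (auto simp: C1_on_def)
  from has_real_derivative_powr_comp[OF this vpos[OF s], of "1 - p"] show ?thesis
    by (simp add: algebra_simps)
qed

text \<open>An upper bound for v, as 1 - p is negative. The lower bounds on v1s and v2s make v powr
  (1 - p) fall at a definite rate; it stays nonnegative up to T y, so it must have started high
  enough.\<close>

lemma upper:
  assumes s: "s < T y"
  shows "(p - 1) * 2 powr (1 - p) / (1 + \<kappa>) * (T y - s) \<le> v y s powr (1 - p)"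
proof -
  define c where "c = (p - 1) * 2 powr (1 - p) / (1 + \<kappa>)"
  have c: "0 < c" using p \<kappa> by (simp add: c_def)
  have le: "c * (s' - s) \<le> v y s powr (1 - p)" if s': "s < s'" "s' < T y" for s'
  proof -
    have "v y s' powr (1 - p) + c * s' \<le> v y s powr (1 - p) + c * s"
    proof (rule DERIV_nonpos_imp_nonincreasing[of s s'])
      fix x assume x: "s \<le> x" "x \<le> s'"
      then have xT: "x < T y" using s' by simp
      have "((\<lambda>s. v y s powr (1 - p) + c * s) has_real_derivative
          - (p - 1) * (v1s y x + v2s y x) * v y x powr (- p) + c) (at x)"
        by (rule DERIV_add[OF power_time_derivative[OF xT]]) (auto intro!: derivative_eq_intros)
      moreover have "2 * G y x / (1 + \<kappa>) \<le> v1s y x + v2s y x"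
        using time_derivative_bounds[OF xT] by (simp add: field_simps)
      then have "(p - 1) * (2 * G y x / (1 + \<kappa>)) * v y x powr (- p) \<le> (p - 1) * (v1s y x + v2s y x) * v y x powr (- p)"
        using p by (intro mult_right_mono mult_left_mono) auto
      moreover have "(p - 1) * (2 * G y x / (1 + \<kappa>)) * v y x powr (- p) = c"
      proof -
        have "v y x powr p * v y x powr (- p) = 1" using vpos[OF xT] by (simp add: powr_minus)
        then have "(p - 1) * (2 * G y x / (1 + \<kappa>)) * v y x powr (- p) = (p - 1) * (2 * 2 powr (- p)) / (1 + \<kappa>)"
          by (simp add: G_def mult.assoc)
        then show ?thesis by (simp add: c_def powr_diff powr_minus_divide)
      qed
      ultimately show "\<exists>D. ((\<lambda>s. v y s powr (1 - p) + c * s) has_real_derivative D) (at x) \<and> D \<le> 0"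
        by (intro exI conjI) (assumption, linarith)
    qed (use s' in auto)
    then have "c * s' - c * s \<le> v y s powr (1 - p)" using powr_ge_zero[of "v y s'" "1 - p"] by linarith
    then show ?thesis by (simp add: algebra_simps)
  qed
  have "((\<lambda>s'. c * (s' - s)) \<longlongrightarrow> c * (T y - s)) (at_left (T y))" by (intro tendsto_intros)
  then show ?thesis unfolding c_def[symmetric]
    by (rule tendsto_upperbound) (use eventually_at_left_real[OF s] le in \<open>auto elim!: eventually_mono\<close>)
qed

section \<open>Slopes ds/dy of the level curves and their relaxation rates\<close>

definition "r1 y s = - v1y y s / v1s y s"
definition "r2 y s = - v2y y s / v2s y s"

lemma ratio_bound:
  assumes "s < T y" shows "\<bar>r1 y s\<bar> \<le> \<kappa>" "\<bar>r2 y s\<bar> \<le> \<kappa>"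
  using cone_derivative[OF assms] time_derivative_pos[OF assms]
  by (simp_all add: r1_def r2_def pos_divide_le_eq)

definition "rate1 y s = G' y s * (v2s y s / v1s y s)"
definition "rate2 y s = G' y s * (v1s y s / v2s y s)"

text \<open>The quotient rule for - a / A when a and A have derivatives k * (a + b) and k * (A + B):
  the terms k * a * A cancel, leaving a multiple of the difference of the two slopes.\<close>

lemma relax_algebra:
  fixes k a b A B :: real
  assumes "0 < A" "0 < B"
  shows "(- (k * (a + b)) * A - - a * (k * (A + B))) / (A * A) = k * (B / A) * (- b / B - - a / A)"
proof -
  have "- b / B - - a / A = (a * B - b * A) / (A * B)" using assms by (simp add: diff_frac_eq)
  moreover have "- (k * (a + b)) * A - - a * (k * (A + B)) = k * (a * B - b * A)" by (simp add: algebra_simps)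
  ultimately show ?thesis using assms by simp
qed

lemma ratio_relax1:
  assumes s: "s < T y"
  shows "((\<lambda>\<sigma>. r1 (y - \<sigma>) (s + \<sigma>)) has_real_derivative rate1 y s * (r2 y s - r1 y s)) (at 0)"
proof -
  have "v1s (y - 0) (s + 0) \<noteq> 0" using time_derivative_pos[OF s] by simp
  note D = DERIV_divide[OF DERIV_minus[OF transport1(2)[OF s]] transport1(3)[OF s] this]
  show ?thesis
    unfolding r1_def r2_def rate1_def
    by (rule DERIV_cong[OF D]) (simp only: relax_algebra[OF time_derivative_pos[OF s]] diff_zero add_0_right)
qed

lemma ratio_relax2:
  assumes s: "s < T y"
  shows "((\<lambda>\<sigma>. r2 (y + \<sigma>) (s + \<sigma>)) has_real_derivative rate2 y s * (r1 y s - r2 y s)) (at 0)"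
proof -
  have "v2s (y + 0) (s + 0) \<noteq> 0" using time_derivative_pos[OF s] by simp
  note D = DERIV_divide[OF DERIV_minus[OF transport2(2)[OF s]] transport2(3)[OF s] this]
  show ?thesis
    unfolding r1_def r2_def rate2_def
    by (rule DERIV_cong[OF D])
      (simp only: relax_algebra[OF time_derivative_pos(2,1)[OF s], of _ _ "v1y y s"] add.commute[of "v1y y s"]
        add.commute[of "v1s y s"] add_0_right)
qed

lemma C_pos: "0 < C"
proof -
  have "0 < v 0 (T 0 - 1) powr (1 - p)" using vpos[of "T 0 - 1" 0] by simp
  moreover have "v 0 (T 0 - 1) powr (1 - p) \<le> C * (T 0 - (T 0 - 1))"
    using low[of "T 0 - 1" 0] unfolding v_def by linarith
  ultimately have "0 < C * (T 0 - (T 0 - 1))" by linarith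
  then show ?thesis by simp
qed

text \<open>G' is a multiple of v powr (p - 1), which \<open>low\<close> and \<open>upper\<close>
  confine between multiples of 1 / (T y - s). The remaining factor, a quotient of time derivatives,
  lies between 1 / \<rho> and \<rho> because both are comparable to the same G.\<close>

lemma rate_bounds:
  fixes k1 k2
  defines "k1 \<equiv> 2 powr (- p) * p * ((1 - \<kappa>) / (1 + \<kappa>)) / C"
    and "k2 \<equiv> 2 powr (- p) * p * ((1 + \<kappa>) / (1 - \<kappa>)) / ((p - 1) * 2 powr (1 - p) / (1 + \<kappa>))"
  assumes s: "s < T y"
  shows "k1 / (T y - s) \<le> rate1 y s \<and> rate1 y s \<le> k2 / (T y - s)"
    "k1 / (T y - s) \<le> rate2 y s \<and> rate2 y s \<le> k2 / (T y - s)"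
proof -
  define \<rho> where "\<rho> = (1 + \<kappa>) / (1 - \<kappa>)"
  define c where "c = (p - 1) * 2 powr (1 - p) / (1 + \<kappa>)"
  have c: "0 < c" using p \<kappa> by (simp add: c_def)
  have ts: "0 < T y - s" using s by simp
  have q: "v y s powr (p - 1) = 1 / v y s powr (1 - p)"
    using vpos[OF s] by (simp add: powr_diff)
  have vp: "0 < v y s powr (1 - p)" using vpos[OF s] by simp
  have q1: "1 / (C * (T y - s)) \<le> v y s powr (p - 1)"
    unfolding q using low[OF s] vp C_pos ts by (intro divide_left_mono mult_pos_pos) (auto simp: v_def)
  have q2: "v y s powr (p - 1) \<le> 1 / (c * (T y - s))"
    unfolding q using upper[OF s] vp c ts by (intro divide_left_mono) (auto simp: c_def[symmetric])
  note tp = time_derivative_pos[OF s] and tb = time_derivative_bounds[OF s] and g = Gpos[OF s]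
  have ratio: "1 / \<rho> \<le> a / b" "a / b \<le> \<rho>"
    if "G y s / (1 + \<kappa>) \<le> a" "a \<le> G y s / (1 - \<kappa>)" "G y s / (1 + \<kappa>) \<le> b" "b \<le> G y s / (1 - \<kappa>)" "0 < a" "0 < b" for a b
  proof -
    have "(G y s / (1 + \<kappa>)) / (G y s / (1 - \<kappa>)) \<le> a / b" using that g \<kappa> by (intro frac_le) auto
    then show "1 / \<rho> \<le> a / b" using g by (simp add: \<rho>_def)
    have "a / b \<le> (G y s / (1 - \<kappa>)) / (G y s / (1 + \<kappa>))" using that g \<kappa> by (intro frac_le) auto
    then show "a / b \<le> \<rho>" using g by (simp add: \<rho>_def)
  qed
  have \<rho>: "0 < \<rho>" using \<kappa> by (simp add: \<rho>_def)
  have main: "k1 / (T y - s) \<le> G' y s * x \<and> G' y s * x \<le> k2 / (T y - s)"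
    if x: "1 / \<rho> \<le> x" "x \<le> \<rho>" for x
  proof
    have x0: "0 < x" using x \<rho> by (meson divide_pos_pos less_le_trans zero_less_one)
    have "2 powr (- p) * (p * (1 / (C * (T y - s)))) * (1 / \<rho>) \<le> G' y s * x"
      unfolding G'_def using q1 x p \<rho> x0 ts C_pos by (intro mult_mono mult_left_mono) auto
    moreover have "2 powr (- p) * (p * (1 / (C * (T y - s)))) * (1 / \<rho>) = k1 / (T y - s)"
      by (simp add: k1_def \<rho>_def)
    ultimately show "k1 / (T y - s) \<le> G' y s * x" by simp
    have "G' y s * x \<le> 2 powr (- p) * (p * (1 / (c * (T y - s)))) * \<rho>"
      unfolding G'_def using q2 x p \<rho> x0 ts c by (intro mult_mono mult_left_mono) auto
    moreover have "2 powr (- p) * (p * (1 / (c * (T y - s)))) * \<rho> = k2 / (T y - s)"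
      by (simp add: k2_def \<rho>_def c_def mult_ac)
    ultimately show "G' y s * x \<le> k2 / (T y - s)" by simp
  qed
  show "k1 / (T y - s) \<le> rate1 y s \<and> rate1 y s \<le> k2 / (T y - s)"
    unfolding rate1_def using ratio tp tb by (intro main) auto
  show "k1 / (T y - s) \<le> rate2 y s \<and> rate2 y s \<le> k2 / (T y - s)"
    unfolding rate2_def using ratio tp tb by (intro main) auto
qed

lemma ratio_continuous: "continuous_on \<Omega> (\<lambda>(y, s). r1 y s)"
proof -
  have "continuous_on \<Omega> (\<lambda>z. - (\<lambda>(y, s). v1y y s) z / (\<lambda>(y, s). v1s y s) z)"
    using reg1[folded \<Omega>_def] time_derivative_pos(1)
    by (intro continuous_on_divide continuous_on_minus) (auto simp: C1_on_def, force)
  then show ?thesis by (simp add: r1_def case_prod_unfold)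
qed

text \<open>Centred at (y0, T y0), the backward cone of (y0, s0) becomes |y| <= - s - d with d = T
  y0 - s0. There |y| <= - s, so the Lipschitz bound puts the distance to the curve between (1 -
  \<kappa>) * (- s) and (1 + \<kappa>) * (- s), and the rates are of order 1 / (- s).\<close>

lemma ratio_const_on_past:
  assumes Q: "s0 < T y0"
  shows "\<exists>c. \<forall>y s. \<bar>y - y0\<bar> \<le> s0 - s \<longrightarrow> r1 y s = c \<and> r2 y s = c"
proof -
  define d where "d = T y0 - s0"
  define k1 where "k1 = 2 powr (- p) * p * ((1 - \<kappa>) / (1 + \<kappa>)) / C"
  define k2 where "k2 = 2 powr (- p) * p * ((1 + \<kappa>) / (1 - \<kappa>)) / ((p - 1) * 2 powr (1 - p) / (1 + \<kappa>))"
  have k: "0 < k1" "0 < k2" using p \<kappa> C_pos by (auto simp: k1_def k2_def)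
  have d: "0 < d" using Q by (simp add: d_def)
  have dist: "(1 - \<kappa>) * (- s) \<le> T (y0 + y) - (T y0 + s)" "T (y0 + y) - (T y0 + s) \<le> (1 + \<kappa>) * (- s)"
      "0 < (1 - \<kappa>) * (- s)" if "\<bar>y\<bar> \<le> - s - d" for y s
  proof -
    have "\<kappa> * \<bar>y\<bar> \<le> \<kappa> * (- s)" using that d \<kappa> by (intro mult_left_mono) auto
    then show "(1 - \<kappa>) * (- s) \<le> T (y0 + y) - (T y0 + s)" "T (y0 + y) - (T y0 + s) \<le> (1 + \<kappa>) * (- s)"
      using lip[of "y0 + y" y0] by (auto simp: algebra_simps)
    show "0 < (1 - \<kappa>) * (- s)" using that d \<kappa> by (intro mult_pos_pos) auto
  qed
  have inT: "T y0 + s < T (y0 + y)" if "\<bar>y\<bar> \<le> - s - d" for y s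
    using dist[OF that] by linarith
  have scale: "k1 / (1 + \<kappa>) / (- s) \<le> x \<and> x \<le> k2 / (1 - \<kappa>) / (- s)"
    if ys: "\<bar>y\<bar> \<le> - s - d" and x: "k1 / (T (y0 + y) - (T y0 + s)) \<le> x \<and> x \<le> k2 / (T (y0 + y) - (T y0 + s))" for x y s
  proof
    note D = dist[OF ys]
    have pos: "0 < T (y0 + y) - (T y0 + s)" "0 < (1 + \<kappa>) * (- s)" using D by linarith+
    have "k1 / ((1 + \<kappa>) * (- s)) \<le> k1 / (T (y0 + y) - (T y0 + s))"
      by (rule divide_left_mono[OF D(2) less_imp_le[OF k(1)] mult_pos_pos[OF pos(2,1)]])
    then show "k1 / (1 + \<kappa>) / (- s) \<le> x" using x unfolding divide_divide_eq_left by linarith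
    have "k2 / (T (y0 + y) - (T y0 + s)) \<le> k2 / ((1 - \<kappa>) * (- s))"
      by (rule divide_left_mono[OF D(1) less_imp_le[OF k(2)] mult_pos_pos[OF pos(1) D(3)]])
    then show "x \<le> k2 / (1 - \<kappa>) / (- s)" using x unfolding divide_divide_eq_left by linarith
  qed
  have "\<exists>c. \<forall>y s. \<bar>y\<bar> \<le> - s - d \<longrightarrow> r1 (y0 + y) (T y0 + s) = c \<and> r2 (y0 + y) (T y0 + s) = c"
  proof (rule relaxes_liouville)
    show "relaxes d (\<lambda>y s. rate1 (y0 + y) (T y0 + s)) (\<lambda>y s. rate2 (y0 + y) (T y0 + s))
        (\<lambda>y s. r1 (y0 + y) (T y0 + s)) (\<lambda>y s. r2 (y0 + y) (T y0 + s))"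
      unfolding relaxes_def using ratio_relax1[OF inT] ratio_relax2[OF inT]
      by (simp add: add.assoc add_diff_eq)
    show "continuous_on {y. \<bar>y\<bar> \<le> - s - d} (\<lambda>y. r1 (y0 + y) (T y0 + s))" for s
    proof -
      have "continuous_on {y. \<bar>y\<bar> \<le> - s - d} (\<lambda>y. (\<lambda>(y, s). r1 y s) (y0 + y, T y0 + s))"
        by (rule continuous_on_compose2[OF ratio_continuous]) (auto intro!: continuous_intros inT)
      then show ?thesis by simp
    qed
    show "\<bar>r1 (y0 + y) (T y0 + s)\<bar> \<le> \<kappa> \<and> \<bar>r2 (y0 + y) (T y0 + s)\<bar> \<le> \<kappa>" if "\<bar>y\<bar> \<le> - s - d" for y s
      using ratio_bound[OF inT[OF that]] by simp
    show "k1 / (1 + \<kappa>) / (- s) \<le> rate1 (y0 + y) (T y0 + s) \<and> rate1 (y0 + y) (T y0 + s) \<le> k2 / (1 - \<kappa>) / (- s)"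
      if "\<bar>y\<bar> \<le> - s - d" for y s
      using scale[OF that] rate_bounds(1)[OF inT[OF that]] unfolding k1_def k2_def by blast
    show "k1 / (1 + \<kappa>) / (- s) \<le> rate2 (y0 + y) (T y0 + s) \<and> rate2 (y0 + y) (T y0 + s) \<le> k2 / (1 - \<kappa>) / (- s)"
      if "\<bar>y\<bar> \<le> - s - d" for y s
      using scale[OF that] rate_bounds(2)[OF inT[OF that]] unfolding k1_def k2_def by blast
    show "0 < d" by (rule d)
    show "0 < k1 / (1 + \<kappa>)" using k \<kappa> by simp
  qed
  then obtain c where c: "\<And>y s. \<bar>y\<bar> \<le> - s - d \<Longrightarrow> r1 (y0 + y) (T y0 + s) = c \<and> r2 (y0 + y) (T y0 + s) = c"
    by blast
  have "r1 y s = c \<and> r2 y s = c" if "\<bar>y - y0\<bar> \<le> s0 - s" for y s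
    using c[of "y - y0" "s - T y0"] that by (simp add: d_def)
  then show ?thesis by blast
qed

text \<open>Each cone has its own constant. The cones of (y, s) and of (0, T 0 - 1) share the point
  (0, s') far enough in the past, so the constants agree.\<close>

lemma ratio_const:
  obtains \<alpha> where "\<bar>\<alpha>\<bar> \<le> \<kappa>" "\<And>y s. s < T y \<Longrightarrow> r1 y s = \<alpha> \<and> r2 y s = \<alpha>"
proof -
  define \<alpha> where "\<alpha> = r1 0 (T 0 - 1)"
  have "r1 y s = \<alpha> \<and> r2 y s = \<alpha>" if s: "s < T y" for y s
  proof -
    obtain c where c: "\<And>y' s'. \<bar>y' - y\<bar> \<le> s - s' \<Longrightarrow> r1 y' s' = c \<and> r2 y' s' = c"
      using ratio_const_on_past[OF s] by blast
    obtain c' where c': "\<And>y' s'. \<bar>y' - 0\<bar> \<le> T 0 - 1 - s' \<Longrightarrow> r1 y' s' = c' \<and> r2 y' s' = c'"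
      using ratio_const_on_past[of "T 0 - 1" 0] by auto
    define s' where "s' = min s (T 0 - 1) - \<bar>y\<bar>"
    have "r1 0 s' = c" "r1 0 s' = c'" using c[of 0 s'] c'[of 0 s'] by (auto simp: s'_def)
    moreover have "\<alpha> = c'" using c'[of 0 "T 0 - 1"] by (simp add: \<alpha>_def)
    ultimately show ?thesis using c[of y s] by simp
  qed
  moreover have "\<bar>\<alpha>\<bar> \<le> \<kappa>" unfolding \<alpha>_def by (rule ratio_bound) simp
  ultimately show thesis using that by blast
qed

section \<open>Explicit integration of a profile with constant slopes\<close>

lemma classification:
  assumes T0: "T 0 = 0"
  shows "\<exists>\<alpha>. - 1 < \<alpha> \<and> \<alpha> < 1 \<and> (\<forall>y. T y = \<alpha> * y) \<and>
    (\<forall>y s. s < T y \<longrightarrow> v1 y s = V_phi p \<alpha> y s \<and> v2 y s = V_psi p \<alpha> y s)"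
proof -
  obtain \<alpha> where \<alpha>: "\<bar>\<alpha>\<bar> \<le> \<kappa>" and r: "\<And>y s. s < T y \<Longrightarrow> r1 y s = \<alpha> \<and> r2 y s = \<alpha>"
    using ratio_const by blast
  have \<alpha>1: "- 1 < \<alpha>" "\<alpha> < 1" using \<alpha> \<kappa> by auto
  then have al: "0 < 1 - \<alpha>" "0 < 1 + \<alpha>" "0 < 1 - \<alpha>\<^sup>2" by (auto simp: abs_square_less_1)
  have y: "v1y y s = - \<alpha> * v1s y s" "v2y y s = - \<alpha> * v2s y s" if "s < T y" for y s
    using r[OF that] time_derivative_pos[OF that] by (auto simp: r1_def r2_def field_simps)
  have s1: "(1 + \<alpha>) * v1s y s = G y s" and s2: "(1 - \<alpha>) * v2s y s = G y s" if "s < T y" for y s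
    using transport1(1)[OF that] transport2(1)[OF that] y[OF that] by (auto simp: algebra_simps)
  \<comment> \<open>With both slopes equal to \<alpha>, v1s = G / (1 + \<alpha>) and v2s = G / (1 -
    \<alpha>) add up to 2 * G / (1 - \<alpha>^2); \<open>c\<close> is the resulting rate of decrease
    of v powr (1 - p).\<close>
  define c where "c = (p - 1) * 2 powr (1 - p) / (1 - \<alpha>\<^sup>2)"
  have c: "0 < c" using p al by (simp add: c_def)
  have Ds: "((\<lambda>s. v y s powr (1 - p)) has_real_derivative - c) (at s)" if s: "s < T y" for y s
  proof -
    have "v1s y s + v2s y s = 2 * G y s / (1 - \<alpha>\<^sup>2)"
    proof -
      have "(1 - \<alpha>\<^sup>2) * (v1s y s + v2s y s) = (1 - \<alpha>) * ((1 + \<alpha>) * v1s y s) + (1 + \<alpha>) * ((1 - \<alpha>) * v2s y s)"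
        by (simp add: power2_eq_square algebra_simps)
      also have "\<dots> = 2 * G y s" unfolding s1[OF s] s2[OF s] by (simp add: algebra_simps)
      finally show ?thesis using al by (simp add: nonzero_eq_divide_eq mult.commute)
    qed
    then have "- (p - 1) * (v1s y s + v2s y s) * v y s powr (- p) = - c"
    proof -
      assume sum: "v1s y s + v2s y s = 2 * G y s / (1 - \<alpha>\<^sup>2)"
      have "v y s powr p * v y s powr (- p) = 1" using vpos[OF s] by (simp add: powr_minus)
      then have "- (p - 1) * (v1s y s + v2s y s) * v y s powr (- p) = - (p - 1) * (2 * 2 powr (- p)) / (1 - \<alpha>\<^sup>2)"
        unfolding sum by (simp add: G_def mult.assoc)
      moreover have "2 * 2 powr (- p) = (2 :: real) powr (1 - p)" by (simp add: powr_diff powr_minus_divide)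
      ultimately show ?thesis unfolding c_def by (simp only: minus_mult_left minus_divide_left)
    qed
    then show ?thesis using power_time_derivative[OF s] by simp
  qed
  \<comment> \<open>v powr (1 - p) is affine in s; \<open>low\<close> supplies the boundary value 0
    at the blow-up time.\<close>
  have prof: "v y s powr (1 - p) = c * (T y - s)" if s: "s < T y" for y s
  proof -
    have const: "v y s' powr (1 - p) + c * s' = v y s powr (1 - p) + c * s" if s': "s < s'" "s' < T y" for s'
    proof (rule DERIV_isconst2[of s s' _ s'])
      have D: "((\<lambda>s. v y s powr (1 - p) + c * s) has_real_derivative 0) (at x)" if "x \<le> s'" for x
        using DERIV_add[OF Ds[of x y] DERIV_cmult[OF DERIV_ident, of c]] that s' by simp
      then show "continuous_on {s..s'} (\<lambda>s. v y s powr (1 - p) + c * s)"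
        by (intro continuous_at_imp_continuous_on ballI DERIV_isCont) auto
      show "((\<lambda>s. v y s powr (1 - p) + c * s) has_real_derivative 0) (at x)" if "s < x" "x < s'" for x
        using D that by simp
    qed (use s' in auto)
    have "((\<lambda>s'. v y s' powr (1 - p)) \<longlongrightarrow> 0) (at_left (T y))"
    proof (rule tendsto_sandwich)
      show "\<forall>\<^sub>F s' in at_left (T y). 0 \<le> v y s' powr (1 - p)" by simp
      show "\<forall>\<^sub>F s' in at_left (T y). v y s' powr (1 - p) \<le> C * (T y - s')"
        using eventually_at_left_real[OF s] by eventually_elim (use low in \<open>auto simp: v_def\<close>)
      have "((\<lambda>s'. C * (T y - s')) \<longlongrightarrow> C * (T y - T y)) (at_left (T y))" by (intro tendsto_intros)
      then show "((\<lambda>s'. C * (T y - s')) \<longlongrightarrow> 0) (at_left (T y))" by simp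
    qed simp
    then have "((\<lambda>s'. v y s' powr (1 - p) + c * s') \<longlongrightarrow> 0 + c * T y) (at_left (T y))"
      by (intro tendsto_intros)
    moreover have "((\<lambda>s'. v y s' powr (1 - p) + c * s') \<longlongrightarrow> v y s powr (1 - p) + c * s) (at_left (T y))"
      by (rule tendsto_eventually) (use eventually_at_left_real[OF s] const in \<open>auto elim!: eventually_mono\<close>)
    ultimately have "0 + c * T y = v y s powr (1 - p) + c * s"
      by (intro tendsto_unique[of "at_left (T y)"]) auto
    then show ?thesis by (simp add: algebra_simps)
  qed
  \<comment> \<open>At a fixed height s the profile can be solved for T near y. So T, until now only
    Lipschitz, inherits differentiability from v, and v_y = - \<alpha> * v_s gives the
    slope.\<close>
  have DT: "(T has_real_derivative \<alpha>) (at y)" for y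
  proof -
    define s where "s = T y - 1"
    have s: "s < T y" by (simp add: s_def)
    have "((\<lambda>y. v y s) has_real_derivative v1y y s + v2y y s) (at y)"
      using reg_v s by (auto simp: C1_on_def)
    from has_real_derivative_powr_comp[OF this vpos[OF s], of "1 - p"]
    have "((\<lambda>y. v y s powr (1 - p)) has_real_derivative
        - \<alpha> * (- (p - 1) * (v1s y s + v2s y s) * v y s powr (- p))) (at y)"
      using y[OF s] by (simp add: algebra_simps)
    moreover have "- (p - 1) * (v1s y s + v2s y s) * v y s powr (- p) = - c"
      using Ds[OF s] power_time_derivative[OF s] by (rule DERIV_unique[symmetric])
    ultimately have "((\<lambda>y. v y s powr (1 - p)) has_real_derivative \<alpha> * c) (at y)" by (simp add: mult.assoc)
    from DERIV_add[OF DERIV_const[of s] DERIV_cdivide[OF this, of c]]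
    have "((\<lambda>y. s + v y s powr (1 - p) / c) has_real_derivative \<alpha>) (at y)"
      using c by simp
    then show ?thesis
    proof (rule has_field_derivative_transform_within_open[where S = "ball y 1"])
      fix x assume "x \<in> ball y 1"
      then have "\<kappa> * \<bar>x - y\<bar> < 1" using \<kappa> mult_left_le_one_le[of "\<bar>x - y\<bar>" \<kappa>] by (simp add: dist_real_def abs_minus_commute)
      then have "s < T x" using lip[of x y] by (simp add: s_def)
      then show "s + v x s powr (1 - p) / c = T x" using prof c by simp
    qed auto
  qed
  have T: "T y = \<alpha> * y" for y
  proof -
    have "((\<lambda>y. T y - \<alpha> * y) has_real_derivative 0) (at x)" for x
      using DT[of x] by (auto intro!: derivative_eq_intros)
    then have "T y - \<alpha> * y = T 0 - \<alpha> * 0" by (rule DERIV_isconst_all[rule_format])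
    then show ?thesis using T0 by simp
  qed
  have vA: "v y s = A_const p \<alpha> * (\<alpha> * y - s) powr (- (1 / (p - 1)))" if s: "s < T y" for y s
  proof -
    have pos: "0 < \<alpha> * y - s" using s T by simp
    have "(1 - p) * - (1 / (p - 1)) = 1" using p by (simp add: field_simps)
    then have "v y s = (v y s powr (1 - p)) powr (- (1 / (p - 1)))"
      using vpos[OF s] by (simp only: powr_powr powr_one)
    also have "\<dots> = (c * (\<alpha> * y - s)) powr (- (1 / (p - 1)))" using prof[OF s] T by simp
    also have "\<dots> = c powr (- (1 / (p - 1))) * (\<alpha> * y - s) powr (- (1 / (p - 1)))"
      using c pos by (simp add: powr_mult)
    also have "c powr (- (1 / (p - 1))) = (1 / c) powr (1 / (p - 1))"
      using c by (simp add: powr_minus_divide powr_divide)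
    also have "1 / c = 2 powr (p - 1) * (1 / (p - 1)) * (1 - \<alpha>\<^sup>2)"
      by (simp add: c_def powr_diff field_simps)
    finally show ?thesis by (simp add: A_const_def)
  qed
  \<comment> \<open>Both sides grow at rate G, so their difference does not depend on s; it tends to
    0 as s tends to - infinity, where v vanishes by \<open>vA\<close>. This fixes how v splits into
    its two components.\<close>
  have bal: "(1 + \<alpha>) * v1 y s = (1 - \<alpha>) * v2 y s" if s: "s < T y" for y s
  proof -
    define d where "d s = (1 + \<alpha>) * v1 y s - (1 - \<alpha>) * v2 y s" for s
    have D: "(d has_real_derivative 0) (at x)" if x: "x < T y" for x
    proof -
      have "((\<lambda>s. v1 y s) has_real_derivative v1s y x) (at x)" "((\<lambda>s. v2 y s) has_real_derivative v2s y x) (at x)"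
        using reg1 reg2 x by (auto simp: C1_on_def)
      then have "(d has_real_derivative (1 + \<alpha>) * v1s y x - (1 - \<alpha>) * v2s y x) (at x)"
        unfolding d_def by (auto intro!: derivative_eq_intros)
      then show ?thesis using s1[OF x] s2[OF x] by simp
    qed
    have const: "d s' = d s" if "s' < s" for s'
      by (rule DERIV_isconst2[of s' s, symmetric])
        (use that s D in \<open>auto intro!: continuous_at_imp_continuous_on DERIV_isCont[OF D]\<close>)
    have bound: "\<bar>d s'\<bar> \<le> 2 * v y s'" if s': "s' < s" for s'
    proof -
      have n: "0 \<le> v1 y s'" "0 \<le> v2 y s'" using nonneg[of s' y] s s' by auto
      have "(1 + \<alpha>) * v1 y s' \<le> 2 * v1 y s'" "(1 - \<alpha>) * v2 y s' \<le> 2 * v2 y s'"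
        "0 \<le> (1 + \<alpha>) * v1 y s'" "0 \<le> (1 - \<alpha>) * v2 y s'"
        using n \<alpha>1 by (auto intro!: mult_right_mono)
      moreover have "\<bar>a - b\<bar> \<le> 2 * (c + e)" if "a \<le> 2 * c" "b \<le> 2 * e" "0 \<le> a" "0 \<le> b" "0 \<le> c" "0 \<le> e" for a b c e :: real
        using that by (simp add: abs_le_iff)
      ultimately show ?thesis using n unfolding d_def v_def by blast
    qed
    have "((\<lambda>s'. 2 * (A_const p \<alpha> * (\<alpha> * y - s') powr (- (1 / (p - 1))))) \<longlongrightarrow> 2 * (A_const p \<alpha> * 0)) at_bot"
    proof (intro tendsto_intros tendsto_neg_powr)
      show "filterlim (\<lambda>s'. \<alpha> * y - s') at_top at_bot"
        using filterlim_tendsto_add_at_top[OF tendsto_const filterlim_uminus_at_top_at_bot, of "\<alpha> * y"] by simp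
    qed (use p in auto)
    then have "((\<lambda>s'. 2 * v y s') \<longlongrightarrow> 0) at_bot"
    proof -
      assume *: "((\<lambda>s'. 2 * (A_const p \<alpha> * (\<alpha> * y - s') powr (- (1 / (p - 1))))) \<longlongrightarrow> 2 * (A_const p \<alpha> * 0)) at_bot"
      have "\<forall>\<^sub>F s' in at_bot. s' < T y" by (rule eventually_gt_at_bot)
      then have "\<forall>\<^sub>F s' in at_bot. 2 * (A_const p \<alpha> * (\<alpha> * y - s') powr (- (1 / (p - 1)))) = 2 * v y s'"
        by eventually_elim (simp add: vA)
      from Lim_transform_eventually[OF * this] show ?thesis by simp
    qed
    then have "\<bar>d s\<bar> \<le> 0"
    proof (rule tendsto_lowerbound)
      have "\<forall>\<^sub>F s' in at_bot. s' < s" by (rule eventually_gt_at_bot)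
      then show "\<forall>\<^sub>F s' in at_bot. \<bar>d s\<bar> \<le> 2 * v y s'"
        by eventually_elim (use bound const in force)
    qed simp
    then show ?thesis by (simp add: d_def)
  qed
  have "v1 y s = V_phi p \<alpha> y s \<and> v2 y s = V_psi p \<alpha> y s" if s: "s < T y" for y s
  proof -
    have "v1 y s = (1 - \<alpha>) / 2 * v y s" "v2 y s = (1 + \<alpha>) / 2 * v y s"
      using bal[OF s] by (auto simp: v_def field_simps)
    then show ?thesis using vA[OF s] by (simp add: V_phi_def V_psi_def)
  qed
  then show ?thesis using \<alpha>1 T by blast
qed

end

section \<open>Picard iterates\<close>

lemma has_integral_affine_real:
  fixes f :: "real \<Rightarrow> real"
  assumes "m > 0"
  shows "((\<lambda>x. f (m * x + c)) has_integral I / m) {a..b} \<longleftrightarrow> (f has_integral I) {m * a + c..m * b + c}"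
  using has_integral_affinity_iff[OF assms, of f c I "m * a + c" "m * b + c"] assms
  by (simp add: field_simps)

lemma integral_affine_real:
  fixes f :: "real \<Rightarrow> real"
  assumes m: "m > 0"
  shows "integral {a..b} (\<lambda>x. f (m * x + c)) = integral {m * a + c..m * b + c} f / m"
proof (cases "f integrable_on {m * a + c..m * b + c}")
  case True
  then show ?thesis using has_integral_affine_real[OF m] by (meson integrable_integral integral_unique)
next
  case False
  have "\<not> (\<lambda>x. f (m * x + c)) integrable_on {a..b}"
  proof
    assume "(\<lambda>x. f (m * x + c)) integrable_on {a..b}"
    then obtain J where "((\<lambda>x. f (m * x + c)) has_integral J) {a..b}" by (auto simp: integrable_on_def)
    then have "((\<lambda>x. f (m * x + c)) has_integral (m * J) / m) {a..b}" using m by simp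
    then have "(f has_integral m * J) {m * a + c..m * b + c}" by (simp only: has_integral_affine_real[OF m])
    then show False using False by (auto simp: integrable_on_def)
  qed
  then show ?thesis using False by (simp add: not_integrable_integral)
qed

text \<open>\<open>L\<close> stands for R* + T*, \<open>M\<close> is a common Lipschitz constant of
  the data, and \<open>slope\<close> is (A4) with surplus \<open>\<epsilon>\<close>.
  \<open>big\<close> is the lower bound on \<gamma>1 + \<gamma>2 after raising to the power p -
  1.\<close>

locale picard =
  fixes p \<mu> \<gamma>1 \<gamma>2 L M \<epsilon> :: real and f g :: "real \<Rightarrow> real"
  assumes p: "1 < p" and \<mu>: "0 < \<mu>" and \<gamma>: "0 < \<gamma>1" "0 < \<gamma>2"
    and big: "\<mu> * p * 2 powr p < (\<gamma>1 + \<gamma>2) powr (p - 1)"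
    and data_ge: "\<bar>x\<bar> < L \<Longrightarrow> \<gamma>1 \<le> f x \<and> \<gamma>2 \<le> g x"
    and M: "0 \<le> M" and \<epsilon>: "0 < \<epsilon>"
    and data_lip: "\<bar>x\<bar> < L \<Longrightarrow> \<bar>y\<bar> < L \<Longrightarrow> \<bar>f x - f y\<bar> \<le> M * \<bar>x - y\<bar> \<and> \<bar>g x - g y\<bar> \<le> M * \<bar>x - y\<bar>"
    and slope: "(2 + \<epsilon>) * M \<le> 2 powr (- p) * (\<gamma>1 + \<gamma>2) powr p - \<mu> / 2 * (\<gamma>1 + \<gamma>2)"
begin

section \<open>Order properties of the iterates on their domain of dependence\<close>

definition "\<phi> n = fst (iter p \<mu> \<gamma>1 \<gamma>2 f g n)"
definition "\<psi> n = snd (iter p \<mu> \<gamma>1 \<gamma>2 f g n)"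
definition "w n x t = \<phi> n x t + \<psi> n x t"
definition "N z s = 2 powr (- p) * \<bar>z\<bar> powr p - \<mu> / (1 + s) * (z / 2)"
text \<open>The sign \<open>e\<close> selects the family of characteristics: 1 for \<phi>, whose
  foot is x + t, and - 1 for \<psi>, whose foot is x - t.\<close>

definition "I n e x t = integral {0..t} (\<lambda>s. N (w n (x + e * (t - s)) s) s)"
definition "Dom = {(x, t). 0 \<le> t \<and> \<bar>x\<bar> + t < L}"

lemma in_Dom[simp]: "(x, t) \<in> Dom \<longleftrightarrow> 0 \<le> t \<and> \<bar>x\<bar> + t < L"
  by (simp add: Dom_def)

lemma iter_0[simp]: "\<phi> 0 x t = \<gamma>1" "\<psi> 0 x t = \<gamma>2"
  by (simp_all add: \<phi>_def \<psi>_def)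

lemma iter_Suc: "\<phi> (Suc n) x t = f (x + t) + I n 1 x t" "\<psi> (Suc n) x t = g (x - t) + I n (- 1) x t"
  by (simp_all add: \<phi>_def \<psi>_def I_def N_def w_def Let_def algebra_simps)

text \<open>In z: for z >= \<gamma>1 + \<gamma>2 the condition \<open>big\<close> makes the
  derivative of the power term at least \<mu> * p, more than the damping can take away. In s: the
  damping coefficient decreases.\<close>

lemma N_mono:
  assumes "\<gamma>1 + \<gamma>2 \<le> z" "z \<le> z'" "0 \<le> s" "s \<le> s'"
  shows "N z s \<le> N z' s'"
proof -
  have "2 powr (- p) * z powr p - \<mu> / (1 + s) * (z / 2) \<le> 2 powr (- p) * z' powr p - \<mu> / (1 + s) * (z' / 2)"
  proof (rule DERIV_nonneg_imp_nondecreasing[OF assms(2)])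
    fix x assume x: "z \<le> x" "x \<le> z'"
    then have x0: "0 < x" "\<gamma>1 + \<gamma>2 \<le> x" using assms \<gamma> by auto
    have "((\<lambda>z. 2 powr (- p) * z powr p - \<mu> / (1 + s) * (z / 2)) has_real_derivative
        2 powr (- p) * (p * x powr (p - 1)) - \<mu> / (1 + s) * (1 / 2)) (at x)"
      using x0 by (intro DERIV_diff DERIV_cmult has_real_derivative_powr DERIV_cdivide DERIV_ident)
    moreover have "\<mu> / (1 + s) * (1 / 2) \<le> 2 powr (- p) * (p * x powr (p - 1))"
    proof -
      have "\<mu> / (1 + s) \<le> \<mu> / 1" using \<mu> assms by (intro divide_left_mono) auto
      then have "\<mu> / (1 + s) * (1 / 2) \<le> \<mu> * 1" using \<mu> assms by (intro mult_mono) auto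
      then have "\<mu> / (1 + s) * (1 / 2) \<le> \<mu>" by simp
      also have "\<dots> \<le> \<mu> * p" using \<mu> p by simp
      also have "\<dots> = 2 powr (- p) * (1 * (\<mu> * p * 2 powr p))" by (simp add: powr_minus)
      also have "\<dots> \<le> 2 powr (- p) * (p * x powr (p - 1))"
      proof (intro mult_left_mono mult_mono)
        have "(\<gamma>1 + \<gamma>2) powr (p - 1) \<le> x powr (p - 1)" using x0 \<gamma> p by (intro powr_mono2) auto
        then show "\<mu> * p * 2 powr p \<le> x powr (p - 1)" using big by linarith
      qed (use p \<mu> in auto)
      finally show ?thesis .
    qed
    ultimately show "\<exists>y. ((\<lambda>z. 2 powr (- p) * z powr p - \<mu> / (1 + s) * (z / 2)) has_real_derivative y) (at x) \<and> 0 \<le> y"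
      by (intro exI conjI) (assumption, simp)
  qed
  moreover have "\<mu> / (1 + s') * (z' / 2) \<le> \<mu> / (1 + s) * (z' / 2)"
    using assms \<mu> \<gamma> by (intro mult_right_mono divide_left_mono) auto
  ultimately show ?thesis using assms \<gamma> by (simp add: N_def)
qed

lemma N_ge: "\<gamma>1 + \<gamma>2 \<le> z \<Longrightarrow> 0 \<le> s \<Longrightarrow> (2 + \<epsilon>) * M \<le> N z s"
  using N_mono[of "\<gamma>1 + \<gamma>2" z 0 s] slope \<gamma> by (simp add: N_def)

lemma N_nonneg: "\<gamma>1 + \<gamma>2 \<le> z \<Longrightarrow> 0 \<le> s \<Longrightarrow> 0 \<le> N z s"
  using N_ge[of z s] M \<epsilon> by (smt (verit) mult_nonneg_nonneg)

lemma N_le: "0 \<le> z \<Longrightarrow> 0 \<le> s \<Longrightarrow> N z s \<le> 2 powr (- p) * z powr p"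
  using \<mu> by (simp add: N_def)

lemma continuous_on_N:
  assumes "continuous_on S u" "continuous_on S v" "\<And>x. x \<in> S \<Longrightarrow> 0 \<le> v x"
  shows "continuous_on S (\<lambda>x. N (u x) (v x))"
  unfolding N_def using assms p
  by (intro continuous_intros continuous_on_powr') (auto simp: add_nonneg_eq_0_iff)

lemma char_in_Dom:
  assumes "(x, t) \<in> Dom" "\<bar>e\<bar> = 1" "0 \<le> s" "s \<le> t"
  shows "(x + e * (t - s), s) \<in> Dom"
proof -
  have "\<bar>e * (t - s)\<bar> = t - s" using assms by (simp add: abs_mult)
  then show ?thesis using assms abs_triangle_ineq[of x "e * (t - s)"] by auto
qed

lemma char_continuous:
  assumes "continuous_on Dom (\<lambda>(x, t). k x t)" "(x, t) \<in> Dom" "\<bar>e\<bar> = 1"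
  shows "continuous_on {0..t} (\<lambda>s. k (x + e * (t - s)) s)"
proof -
  have "continuous_on {0..t} (\<lambda>s. (\<lambda>(x, t). k x t) (x + e * (t - s), s))"
    by (rule continuous_on_compose2[OF assms(1)])
      (use char_in_Dom[OF assms(2,3)] in \<open>auto intro!: continuous_intros simp del: in_Dom\<close>)
  then show ?thesis by simp
qed

text \<open>The substitution s = t * \<theta> moves the dependence on t from the range of
  integration into the integrand, where continuity in parameters applies.\<close>

lemma char_integral_continuous:
  fixes k :: "real \<Rightarrow> real \<Rightarrow> real"
  assumes k: "continuous_on Dom (\<lambda>(x, t). k x t)" and e: "\<bar>e\<bar> = 1"
  shows "continuous_on Dom (\<lambda>(x, t). integral {0..t} (\<lambda>s. k (x + e * (t - s)) s))"
proof -
  have eq: "integral {0..t} (\<lambda>s. k (x + e * (t - s)) s) =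
      integral (cbox 0 1) (\<lambda>\<theta>. t * k (x + e * (t - t * \<theta>)) (t * \<theta>))" if "(x, t) \<in> Dom" for x t
  proof (cases "t = 0")
    case False
    then have "t > 0" using that by simp
    from integral_affine_real[OF this, of 0 1 "\<lambda>s. k (x + e * (t - s)) s" 0] \<open>t > 0\<close>
    show ?thesis by (simp add: integral_mult_right)
  qed simp
  have "continuous_on Dom (\<lambda>z. integral (cbox 0 1) (\<lambda>\<theta>. snd z * k (fst z + e * (snd z - snd z * \<theta>)) (snd z * \<theta>)))"
  proof (rule integral_continuous_on_param)
    have "continuous_on (Dom \<times> cbox 0 1) (\<lambda>z. snd (fst z) * (\<lambda>(x, t). k x t)
        (fst (fst z) + e * (snd (fst z) - snd (fst z) * snd z), snd (fst z) * snd z))"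
    proof (intro continuous_on_mult continuous_on_compose2[OF k])
      show "(\<lambda>z. (fst (fst z) + e * (snd (fst z) - snd (fst z) * snd z), snd (fst z) * snd z)) ` (Dom \<times> cbox 0 1) \<subseteq> Dom"
      proof
        fix y assume "y \<in> (\<lambda>z. (fst (fst z) + e * (snd (fst z) - snd (fst z) * snd z), snd (fst z) * snd z)) ` (Dom \<times> cbox 0 1)"
        then obtain x t \<theta> where z: "(x, t) \<in> Dom" "0 \<le> \<theta>" "\<theta> \<le> 1" "y = (x + e * (t - t * \<theta>), t * \<theta>)"
          by auto
        have "t * \<theta> \<le> t" "0 \<le> t * \<theta>" using z by (auto simp: mult_left_le)
        then show "y \<in> Dom" unfolding z(4) by (intro char_in_Dom[OF z(1) e])
      qed
    qed (intro continuous_intros)+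
    then show "continuous_on (Dom \<times> cbox 0 1) (\<lambda>(x, \<theta>). snd x * k (fst x + e * (snd x - snd x * \<theta>)) (snd x * \<theta>))"
      by (simp add: case_prod_unfold)
  qed
  then show ?thesis
    by (rule continuous_on_eq) (use eq in \<open>auto simp del: in_Dom\<close>)
qed

lemma iter_continuous: "continuous_on Dom (\<lambda>(x, t). \<phi> n x t) \<and> continuous_on Dom (\<lambda>(x, t). \<psi> n x t)"
proof (induction n)
  case 0
  show ?case by simp
next
  case (Suc n)
  have data: "continuous_on {- L<..<L} f" "continuous_on {- L<..<L} g"
    using data_lip M
    by (intro lipschitz_on_continuous_on[of M] lipschitz_onI; simp add: dist_real_def abs_less_iff)+
  have fg: "continuous_on Dom (\<lambda>z. f (fst z + snd z))" "continuous_on Dom (\<lambda>z. g (fst z - snd z))"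
    by (rule continuous_on_compose2[OF data(1)] continuous_on_compose2[OF data(2)],
        auto intro!: continuous_intros simp: Dom_def)+
  have "continuous_on Dom (\<lambda>z. N (w n (fst z) (snd z)) (snd z))"
    using Suc by (intro continuous_on_N continuous_intros) (auto simp: w_def case_prod_unfold Dom_def intro!: continuous_intros)
  then have "continuous_on Dom (\<lambda>(x, t). N (w n x t) t)" by (simp add: case_prod_unfold)
  from char_integral_continuous[OF this] have "continuous_on Dom (\<lambda>(x, t). I n e x t)" if "\<bar>e\<bar> = 1" for e
    unfolding I_def using that by blast
  from this[of 1] this[of "- 1"] fg show ?case
    unfolding iter_Suc case_prod_unfold by (auto intro!: continuous_intros)
qed

lemma N_char_continuous:
  assumes "(x, t) \<in> Dom" "\<bar>e\<bar> = 1"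
  shows "continuous_on {0..t} (\<lambda>s. N (w n (x + e * (t - s)) s) s)"
proof -
  have "continuous_on Dom (\<lambda>z. N (w n (fst z) (snd z)) (snd z))"
    using iter_continuous[of n]
    by (intro continuous_on_N continuous_intros) (auto simp: w_def case_prod_unfold Dom_def intro!: continuous_intros)
  then show ?thesis by (intro char_continuous[OF _ assms]) (simp add: case_prod_unfold)
qed

lemma N_char_integrable:
  assumes "(x, t) \<in> Dom" "\<bar>e\<bar> = 1" "0 \<le> a" "b \<le> t"
  shows "(\<lambda>s. N (w n (x + e * (t - s)) s) s) integrable_on {a..b}"
  by (rule integrable_continuous_real, rule continuous_on_subset[OF N_char_continuous[OF assms(1,2)]])
    (use assms in auto)

lemma iter_ge: "(x, t) \<in> Dom \<Longrightarrow> \<gamma>1 \<le> \<phi> n x t \<and> \<gamma>2 \<le> \<psi> n x t"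
proof (induction n arbitrary: x t)
  case 0
  then show ?case by simp
next
  case (Suc n)
  have "0 \<le> I n e x t" if e: "\<bar>e\<bar> = 1" for e
    unfolding I_def
  proof (rule integral_nonneg[OF N_char_integrable[OF Suc.prems e]])
    fix s assume "s \<in> {0..t}"
    then have "(x + e * (t - s), s) \<in> Dom" using char_in_Dom[OF Suc.prems e] by simp
    from Suc.IH[OF this] show "0 \<le> N (w n (x + e * (t - s)) s) s"
      using \<open>s \<in> {0..t}\<close> by (intro N_nonneg) (auto simp: w_def)
  qed auto
  from this[of 1] this[of "- 1"] data_ge[of "x + t"] data_ge[of "x - t"] Suc.prems
  show ?case unfolding iter_Suc by fastforce
qed

lemma w_ge: "(x, t) \<in> Dom \<Longrightarrow> \<gamma>1 + \<gamma>2 \<le> w n x t"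
  using iter_ge[of x t n] by (simp add: w_def)

lemma I_mono:
  assumes xt: "(x, t) \<in> Dom" and e: "\<bar>e\<bar> = 1"
    and le: "\<And>x t. (x, t) \<in> Dom \<Longrightarrow> w n x t \<le> w m x t"
  shows "I n e x t \<le> I m e x t"
  unfolding I_def
proof (intro integral_le N_char_integrable[OF xt e])
  fix s assume s: "s \<in> {0..t}"
  then have "(x + e * (t - s), s) \<in> Dom" using char_in_Dom[OF xt e] by simp
  then show "N (w n (x + e * (t - s)) s) s \<le> N (w m (x + e * (t - s)) s) s"
    using w_ge le s by (intro N_mono) auto
qed auto

lemma iter_mono_Suc: "(x, t) \<in> Dom \<Longrightarrow> \<phi> n x t \<le> \<phi> (Suc n) x t \<and> \<psi> n x t \<le> \<psi> (Suc n) x t"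
proof (induction n arbitrary: x t)
  case 0
  then show ?case using iter_ge[of x t "Suc 0"] by simp
next
  case (Suc n)
  have "w n x t \<le> w (Suc n) x t" if "(x, t) \<in> Dom" for x t
    using Suc.IH[OF that] by (simp add: w_def)
  from I_mono[OF Suc.prems _ this] show ?case
    unfolding iter_Suc(1)[of "Suc n"] iter_Suc(2)[of "Suc n"] iter_Suc(1)[of n] iter_Suc(2)[of n] by simp
qed

lemma iter_incseq:
  assumes "(x, t) \<in> Dom"
  shows "incseq (\<lambda>n. \<phi> n x t)" "incseq (\<lambda>n. \<psi> n x t)"
  using iter_mono_Suc[OF assms] by (auto intro!: incseq_SucI)

lemma I_split:
  assumes xt: "(x, t) \<in> Dom" and e: "\<bar>e\<bar> = 1" and s: "0 \<le> s" "s \<le> t"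
  shows "I n e x t = I n e (x + e * (t - s)) s + integral {s..t} (\<lambda>\<sigma>. N (w n (x + e * (t - \<sigma>)) \<sigma>) \<sigma>)"
proof -
  have "I n e (x + e * (t - s)) s = integral {0..s} (\<lambda>\<sigma>. N (w n (x + e * (t - \<sigma>)) \<sigma>) \<sigma>)"
    by (simp add: I_def algebra_simps)
  then show ?thesis
    using Henstock_Kurzweil_Integration.integral_combine[OF s N_char_integrable[OF xt e order_refl order_refl]] by (simp add: I_def)
qed

lemma iter_char:
  assumes xt: "(x, t) \<in> Dom" and s: "0 \<le> s" "s \<le> t"
  shows "\<phi> (Suc n) x t = \<phi> (Suc n) (x + 1 * (t - s)) s + integral {s..t} (\<lambda>\<sigma>. N (w n (x + 1 * (t - \<sigma>)) \<sigma>) \<sigma>)"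
    and "\<psi> (Suc n) x t = \<psi> (Suc n) (x + - 1 * (t - s)) s + integral {s..t} (\<lambda>\<sigma>. N (w n (x + - 1 * (t - \<sigma>)) \<sigma>) \<sigma>)"
  using I_split[OF xt _ s, of 1 n] I_split[OF xt _ s, of "- 1" n] unfolding iter_Suc by simp_all

text \<open>
  Translating the iteration by \<open>(x' - x, t' - t)\<close> costs at most the variation of the data, which
  the nonlinearity recovers during the first \<open>t' - t\<close> units of time because of \<open>slope\<close>.
\<close>

lemma iter_cone_mono:
  "(x, t) \<in> Dom \<Longrightarrow> (x', t') \<in> Dom \<Longrightarrow> \<bar>x' - x\<bar> \<le> (1 + \<epsilon>) * (t' - t) \<Longrightarrow> t \<le> t' \<Longrightarrow>
    \<phi> n x t \<le> \<phi> n x' t' \<and> \<psi> n x t \<le> \<psi> n x' t'"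
proof (induction n arbitrary: x t x' t')
  case 0
  then show ?case by simp
next
  case (Suc n)
  define h where "h = t' - t"
  have h: "0 \<le> h" "t' = t + h" "h \<le> t'" using Suc.prems by (auto simp: h_def)
  \<comment> \<open>Cut the integral for (x', t') at time h. Before h the integrand is at least (2 +
    \<epsilon>) * M; after h it runs parallel to the characteristic of (x, t) at the constant
    displacement (x' - x, h), so the induction hypothesis applies pointwise.\<close>
  have I: "I n e x t + h * ((2 + \<epsilon>) * M) \<le> I n e x' t'" if e: "\<bar>e\<bar> = 1" for e
  proof -
    have xh: "(x' + e * (t' - h), h) \<in> Dom" using char_in_Dom[OF Suc.prems(2) e h(1,3)] .
    have "integral {0..h} (\<lambda>s. (2 + \<epsilon>) * M) \<le> I n e (x' + e * (t' - h)) h"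
      unfolding I_def
    proof (intro integral_le N_char_integrable[OF xh e])
      fix s assume s: "s \<in> {0..h}"
      then have "(x' + e * (t' - h) + e * (h - s), s) \<in> Dom" using char_in_Dom[OF xh e] by simp
      then show "(2 + \<epsilon>) * M \<le> N (w n (x' + e * (t' - h) + e * (h - s)) s) s"
        using w_ge s by (intro N_ge) auto
    qed auto
    then have "h * ((2 + \<epsilon>) * M) \<le> I n e (x' + e * (t' - h)) h" using h by (simp add: mult_ac)
    moreover have "I n e x t \<le> integral {h..t'} (\<lambda>\<sigma>. N (w n (x' + e * (t' - \<sigma>)) \<sigma>) \<sigma>)"
    proof -
      have "integral {h..t'} (\<lambda>\<sigma>. N (w n (x' + e * (t' - \<sigma>)) \<sigma>) \<sigma>) =
          integral {0..t} (\<lambda>\<sigma>. N (w n (x' + e * (t' - (1 * \<sigma> + h))) (1 * \<sigma> + h)) (1 * \<sigma> + h))"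
        using integral_affine_real[of 1 0 t "\<lambda>\<sigma>. N (w n (x' + e * (t' - \<sigma>)) \<sigma>) \<sigma>" h] h by simp
      moreover have "I n e x t \<le> \<dots>"
        unfolding I_def
      proof (intro integral_le N_char_integrable[OF Suc.prems(1) e])
        have "(\<lambda>\<sigma>. N (w n (x' + e * (t' - \<sigma>)) \<sigma>) \<sigma>) integrable_on {1 * 0 + h..1 * t + h}"
          using N_char_integrable[OF Suc.prems(2) e h(1) order_refl] h by (simp add: add.commute)
        then show "(\<lambda>\<sigma>. N (w n (x' + e * (t' - (1 * \<sigma> + h))) (1 * \<sigma> + h)) (1 * \<sigma> + h)) integrable_on {0..t}"
          using has_integral_affine_real[of 1 "\<lambda>\<sigma>. N (w n (x' + e * (t' - \<sigma>)) \<sigma>) \<sigma>" h _ 0 t]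
          by (auto simp: integrable_on_def)
        fix \<sigma> assume \<sigma>: "\<sigma> \<in> {0..t}"
        have 1: "(x + e * (t - \<sigma>), \<sigma>) \<in> Dom" using char_in_Dom[OF Suc.prems(1) e] \<sigma> by simp
        have 2: "(x' + e * (t' - (\<sigma> + h)), \<sigma> + h) \<in> Dom" using char_in_Dom[OF Suc.prems(2) e, of "\<sigma> + h"] \<sigma> h by simp
        have eq: "x' + e * (t' - (\<sigma> + h)) - (x + e * (t - \<sigma>)) = x' - x" using h by (simp add: algebra_simps)
        have "\<bar>x' + e * (t' - (\<sigma> + h)) - (x + e * (t - \<sigma>))\<bar> \<le> (1 + \<epsilon>) * (\<sigma> + h - \<sigma>)"
          unfolding eq using Suc.prems(3) by (simp add: h_def)
        from Suc.IH[OF 1 2 this] have "w n (x + e * (t - \<sigma>)) \<sigma> \<le> w n (x' + e * (t' - (\<sigma> + h))) (\<sigma> + h)"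
          using h by (simp add: w_def)
        then show "N (w n (x + e * (t - \<sigma>)) \<sigma>) \<sigma> \<le>
            N (w n (x' + e * (t' - (1 * \<sigma> + h))) (1 * \<sigma> + h)) (1 * \<sigma> + h)"
          using N_mono[OF w_ge[OF 1]] \<sigma> h by simp
      qed auto
      ultimately show ?thesis by simp
    qed
    ultimately show ?thesis using I_split[OF Suc.prems(2) e h(1,3), of n] by linarith
  qed
  have d: "\<bar>x + t\<bar> < L" "\<bar>x - t\<bar> < L" "\<bar>x' + t'\<bar> < L" "\<bar>x' - t'\<bar> < L" using Suc.prems by auto
  \<comment> \<open>The feet of the characteristics move by at most |x' - x| + h <= (2 + \<epsilon>)
    * h, so the change in the data is at most the gain before time h.\<close>
  have le: "\<bar>a - b\<bar> * M \<le> h * ((2 + \<epsilon>) * M)" if "\<bar>a - b\<bar> \<le> \<bar>x' - x\<bar> + h" for a b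
  proof -
    have "\<bar>a - b\<bar> \<le> h * (2 + \<epsilon>)" using that Suc.prems(3) by (simp add: h_def algebra_simps)
    from mult_right_mono[OF this M] show ?thesis by (simp add: mult.assoc)
  qed
  have "\<bar>(x + t) - (x' + t')\<bar> \<le> \<bar>x' - x\<bar> + h" "\<bar>(x - t) - (x' - t')\<bar> \<le> \<bar>x' - x\<bar> + h"
    using h by linarith+
  note this[THEN le]
  then have "\<bar>f (x + t) - f (x' + t')\<bar> \<le> h * ((2 + \<epsilon>) * M)" "\<bar>g (x - t) - g (x' - t')\<bar> \<le> h * ((2 + \<epsilon>) * M)"
    using data_lip[OF d(1,3)] data_lip[OF d(2,4)] unfolding mult.commute[of M] by linarith+
  then show ?case unfolding iter_Suc using I[of 1] I[of "- 1"] by auto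
qed

end

section \<open>The limit of the iterates and its integral equation\<close>

lemma SUP_ereal_tendsto:
  fixes X :: "nat \<Rightarrow> real"
  assumes X: "incseq X" and fin: "(SUP n. ereal (X n)) < \<infinity>"
  shows "X \<longlonglongrightarrow> real_of_ereal (SUP n. ereal (X n))"
proof -
  have "ereal (X 0) \<le> (SUP n. ereal (X n))" by (rule SUP_upper) simp
  with fin obtain r where r: "(SUP n. ereal (X n)) = ereal r"
    by (cases "SUP n. ereal (X n)") auto
  have "(\<lambda>n. ereal (X n)) \<longlonglongrightarrow> (SUP n. ereal (X n))"
    by (rule LIMSEQ_SUP) (use X in \<open>auto simp: incseq_def\<close>)
  then show ?thesis by (simp add: r)
qed

context picard begin

text \<open>On \<open>Dom\<close> neither supremum is - infinity, so a finite sum makes both finite.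
  Without \<open>fin\<close>, a value of \<Phi> or \<Psi> may be the default 0 of
  \<open>real_of_ereal\<close>.\<close>

definition "fin x t \<longleftrightarrow> phi_lim p \<mu> \<gamma>1 \<gamma>2 f g x t + psi_lim p \<mu> \<gamma>1 \<gamma>2 f g x t < \<infinity>"
definition "\<Phi> x t = real_of_ereal (phi_lim p \<mu> \<gamma>1 \<gamma>2 f g x t)"
definition "\<Psi> x t = real_of_ereal (psi_lim p \<mu> \<gamma>1 \<gamma>2 f g x t)"
definition "W x t = \<Phi> x t + \<Psi> x t"

lemma lim_eq_SUP:
  "phi_lim p \<mu> \<gamma>1 \<gamma>2 f g x t = (SUP n. ereal (\<phi> n x t))"
  "psi_lim p \<mu> \<gamma>1 \<gamma>2 f g x t = (SUP n. ereal (\<psi> n x t))"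
  by (simp_all add: phi_lim_def psi_lim_def \<phi>_def \<psi>_def)

lemma fin_tendsto:
  assumes D: "(x, t) \<in> Dom" and fin: "fin x t"
  shows "(\<lambda>n. \<phi> n x t) \<longlonglongrightarrow> \<Phi> x t" "(\<lambda>n. \<psi> n x t) \<longlonglongrightarrow> \<Psi> x t"
proof -
  have "ereal (\<phi> 0 x t) \<le> (SUP n. ereal (\<phi> n x t))" "ereal (\<psi> 0 x t) \<le> (SUP n. ereal (\<psi> n x t))"
    by (rule SUP_upper, simp)+
  then have "(SUP n. ereal (\<phi> n x t)) < \<infinity>" "(SUP n. ereal (\<psi> n x t)) < \<infinity>"
    using fin unfolding fin_def lim_eq_SUP by auto
  then show "(\<lambda>n. \<phi> n x t) \<longlonglongrightarrow> \<Phi> x t" "(\<lambda>n. \<psi> n x t) \<longlonglongrightarrow> \<Psi> x t"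
    unfolding \<Phi>_def \<Psi>_def lim_eq_SUP using iter_incseq[OF D] by (auto intro: SUP_ereal_tendsto)
qed

lemma fin_le:
  assumes "(x, t) \<in> Dom" "fin x t"
  shows "\<phi> n x t \<le> \<Phi> x t" "\<psi> n x t \<le> \<Psi> x t"
  using fin_tendsto[OF assms] iter_incseq[OF assms(1)] by (auto intro: incseq_le)

lemma finI:
  assumes "\<And>n. \<phi> n x t \<le> A" "\<And>n. \<psi> n x t \<le> B"
  shows "fin x t"
proof -
  have "(SUP n. ereal (\<phi> n x t)) \<le> ereal A" "(SUP n. ereal (\<psi> n x t)) \<le> ereal B"
    using assms by (auto intro: SUP_least)
  then have "(SUP n. ereal (\<phi> n x t)) + (SUP n. ereal (\<psi> n x t)) \<le> ereal A + ereal B" by (rule add_mono)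
  also have "\<dots> < \<infinity>" by simp
  finally show ?thesis by (simp add: fin_def lim_eq_SUP)
qed

lemma \<Phi>_ge:
  assumes "(x, t) \<in> Dom" "fin x t"
  shows "\<gamma>1 \<le> \<Phi> x t" "\<gamma>2 \<le> \<Psi> x t" "\<gamma>1 + \<gamma>2 \<le> W x t"
  using fin_le[OF assms, of 0] by (auto simp: W_def)

lemma fin_cone:
  assumes D: "(x, t) \<in> Dom" "(x', t') \<in> Dom" and c: "\<bar>x' - x\<bar> \<le> (1 + \<epsilon>) * (t' - t)" "t \<le> t'" and fin: "fin x' t'"
  shows "fin x t" "\<Phi> x t \<le> \<Phi> x' t'" "\<Psi> x t \<le> \<Psi> x' t'"
proof -
  note le = iter_cone_mono[OF D c] and lim = fin_le[OF D(2) fin]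
  have b: "\<phi> n x t \<le> \<Phi> x' t'" "\<psi> n x t \<le> \<Psi> x' t'" for n using le[of n] lim[of n] by linarith+
  then show f: "fin x t" by (rule finI)
  show "\<Phi> x t \<le> \<Phi> x' t'" "\<Psi> x t \<le> \<Psi> x' t'"
    using fin_tendsto[OF D(1) f] b by (auto intro: LIMSEQ_le_const2)
qed

text \<open>Backward characteristics have slope 1 < 1 + \<epsilon> and lie in the cone of
  monotonicity, so finiteness at the upper end gives finiteness, and a bound, along the whole
  line.\<close>

lemma fin_char:
  assumes D: "(x, t) \<in> Dom" and e: "\<bar>e\<bar> = 1" and fin: "fin x t" and s: "0 \<le> s" "s \<le> t"
  shows "(x + e * (t - s), s) \<in> Dom" "fin (x + e * (t - s)) s" "W (x + e * (t - s)) s \<le> W x t"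
proof -
  show D': "(x + e * (t - s), s) \<in> Dom" by (rule char_in_Dom[OF D e s])
  have c: "\<bar>x - (x + e * (t - s))\<bar> \<le> (1 + \<epsilon>) * (t - s)"
  proof -
    have "\<bar>x - (x + e * (t - s))\<bar> = 1 * (t - s)" using e s by (simp add: abs_mult)
    also have "\<dots> \<le> (1 + \<epsilon>) * (t - s)" using s \<epsilon> by (intro mult_right_mono) auto
    finally show ?thesis .
  qed
  note f = fin_cone[OF D' D c s(2) fin]
  show "fin (x + e * (t - s)) s" by (rule f(1))
  show "W (x + e * (t - s)) s \<le> W x t" using f(2,3) by (simp add: W_def)
qed

lemma N_tendsto:
  assumes "X \<longlonglongrightarrow> z" "0 \<le> s"
  shows "(\<lambda>n. N (X n) s) \<longlonglongrightarrow> N z s"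
proof -
  have "continuous_on UNIV (\<lambda>z. N z s)" using assms by (intro continuous_on_N continuous_intros) auto
  then show ?thesis using assms(1)
    by (auto simp: continuous_on_eq_continuous_at isCont_def intro: isCont_tendsto_compose)
qed

lemma char_limit:
  assumes D: "(x, t) \<in> Dom" and e: "\<bar>e\<bar> = 1" and fin: "fin x t" and s: "0 \<le> s" "s \<le> t"
  shows "(\<lambda>\<sigma>. N (W (x + e * (t - \<sigma>)) \<sigma>) \<sigma>) integrable_on {s..t}"
    and "(\<lambda>n. integral {s..t} (\<lambda>\<sigma>. N (w n (x + e * (t - \<sigma>)) \<sigma>) \<sigma>)) \<longlonglongrightarrow>
      integral {s..t} (\<lambda>\<sigma>. N (W (x + e * (t - \<sigma>)) \<sigma>) \<sigma>)"
proof -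
  \<comment> \<open>A constant majorant: W is largest at the upper end of the characteristic, and N
    grows in both arguments.\<close>
  have le: "norm (N (w n (x + e * (t - \<sigma>)) \<sigma>) \<sigma>) \<le> N (W x t) t" if "\<sigma> \<in> {s..t}" for n \<sigma>
  proof -
    have \<sigma>: "0 \<le> \<sigma>" "\<sigma> \<le> t" using that s by auto
    note c = fin_char[OF D e fin \<sigma>]
    have "w n (x + e * (t - \<sigma>)) \<sigma> \<le> W x t"
      using fin_le[OF c(1,2), of n] c(3) by (simp add: w_def W_def)
    then have "N (w n (x + e * (t - \<sigma>)) \<sigma>) \<sigma> \<le> N (W x t) t"
      using w_ge[OF c(1)] \<sigma> by (intro N_mono)
    moreover have "0 \<le> N (w n (x + e * (t - \<sigma>)) \<sigma>) \<sigma>" using w_ge[OF c(1)] \<sigma> by (intro N_nonneg)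
    ultimately show ?thesis by simp
  qed
  have conv: "(\<lambda>n. N (w n (x + e * (t - \<sigma>)) \<sigma>) \<sigma>) \<longlonglongrightarrow> N (W (x + e * (t - \<sigma>)) \<sigma>) \<sigma>" if "\<sigma> \<in> {s..t}" for \<sigma>
  proof -
    have \<sigma>: "0 \<le> \<sigma>" "\<sigma> \<le> t" using that s by auto
    note c = fin_char[OF D e fin \<sigma>]
    show ?thesis unfolding w_def W_def
      by (intro N_tendsto tendsto_intros fin_tendsto[OF c(1,2)]) (rule \<sigma>)
  qed
  have int: "(\<lambda>\<sigma>. N (w n (x + e * (t - \<sigma>)) \<sigma>) \<sigma>) integrable_on {s..t}" for n
    using N_char_integrable[OF D e s(1) order_refl] .
  show "(\<lambda>\<sigma>. N (W (x + e * (t - \<sigma>)) \<sigma>) \<sigma>) integrable_on {s..t}"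
    by (rule dominated_convergence(1)[OF int _ le conv]) auto
  show "(\<lambda>n. integral {s..t} (\<lambda>\<sigma>. N (w n (x + e * (t - \<sigma>)) \<sigma>) \<sigma>)) \<longlonglongrightarrow>
      integral {s..t} (\<lambda>\<sigma>. N (W (x + e * (t - \<sigma>)) \<sigma>) \<sigma>)"
    by (rule dominated_convergence(2)[OF int _ le conv]) auto
qed

lemma char_eq:
  assumes D: "(x, t) \<in> Dom" and fin: "fin x t" and s: "0 \<le> s" "s \<le> t"
  shows "\<Phi> x t = \<Phi> (x + 1 * (t - s)) s + integral {s..t} (\<lambda>\<sigma>. N (W (x + 1 * (t - \<sigma>)) \<sigma>) \<sigma>)"
    and "\<Psi> x t = \<Psi> (x + - 1 * (t - s)) s + integral {s..t} (\<lambda>\<sigma>. N (W (x + - 1 * (t - \<sigma>)) \<sigma>) \<sigma>)"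
proof -
  have e: "\<bar>1 :: real\<bar> = 1" "\<bar>- 1 :: real\<bar> = 1" by auto
  have "(\<lambda>n. \<phi> (Suc n) (x + 1 * (t - s)) s + integral {s..t} (\<lambda>\<sigma>. N (w n (x + 1 * (t - \<sigma>)) \<sigma>) \<sigma>)) \<longlonglongrightarrow>
      \<Phi> (x + 1 * (t - s)) s + integral {s..t} (\<lambda>\<sigma>. N (W (x + 1 * (t - \<sigma>)) \<sigma>) \<sigma>)"
    by (intro tendsto_add char_limit(2)[OF D e(1) fin s] LIMSEQ_Suc[OF fin_tendsto(1)] fin_char[OF D e(1) fin s])
  then have "(\<lambda>n. \<phi> (Suc n) x t) \<longlonglongrightarrow> \<Phi> (x + 1 * (t - s)) s + integral {s..t} (\<lambda>\<sigma>. N (W (x + 1 * (t - \<sigma>)) \<sigma>) \<sigma>)"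
    unfolding iter_char(1)[OF D s, symmetric] .
  then show "\<Phi> x t = \<Phi> (x + 1 * (t - s)) s + integral {s..t} (\<lambda>\<sigma>. N (W (x + 1 * (t - \<sigma>)) \<sigma>) \<sigma>)"
    using LIMSEQ_Suc[OF fin_tendsto(1)[OF D fin]] LIMSEQ_unique by blast
  have "(\<lambda>n. \<psi> (Suc n) (x + - 1 * (t - s)) s + integral {s..t} (\<lambda>\<sigma>. N (w n (x + - 1 * (t - \<sigma>)) \<sigma>) \<sigma>)) \<longlonglongrightarrow>
      \<Psi> (x + - 1 * (t - s)) s + integral {s..t} (\<lambda>\<sigma>. N (W (x + - 1 * (t - \<sigma>)) \<sigma>) \<sigma>)"
    by (intro tendsto_add char_limit(2)[OF D e(2) fin s] LIMSEQ_Suc[OF fin_tendsto(2)] fin_char[OF D e(2) fin s])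
  then have "(\<lambda>n. \<psi> (Suc n) x t) \<longlonglongrightarrow> \<Psi> (x + - 1 * (t - s)) s + integral {s..t} (\<lambda>\<sigma>. N (W (x + - 1 * (t - \<sigma>)) \<sigma>) \<sigma>)"
    unfolding iter_char(2)[OF D s, symmetric] .
  then show "\<Psi> x t = \<Psi> (x + - 1 * (t - s)) s + integral {s..t} (\<lambda>\<sigma>. N (W (x + - 1 * (t - \<sigma>)) \<sigma>) \<sigma>)"
    using LIMSEQ_Suc[OF fin_tendsto(2)[OF D fin]] LIMSEQ_unique by blast
qed

text \<open>Local existence by a bound that reproduces itself. If the components stay below P + m /
  2 and Q + m / 2, then w <= 2 * m and N <= 2 powr (- p) * (2 * m) powr p = m powr p; over a time of
  at most \<delta> this adds no more than m / 2 to the values on the initial slice.\<close>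

lemma iter_bound:
  assumes D: "(x, t + \<delta>) \<in> Dom" and t: "0 \<le> t" "0 \<le> \<delta>"
    and base: "\<And>n y. \<bar>y - x\<bar> \<le> \<delta> \<Longrightarrow> \<phi> n y t \<le> P \<and> \<psi> n y t \<le> Q"
    and m: "P + Q \<le> m" "\<delta> * m powr p \<le> m / 2"
    and ys: "t \<le> s" "\<bar>y - x\<bar> \<le> t + \<delta> - s"
  shows "\<phi> n y s \<le> P + m / 2 \<and> \<psi> n y s \<le> Q + m / 2"
  using ys
proof (induction n arbitrary: y s)
  case 0
  have "\<gamma>1 \<le> P" "\<gamma>2 \<le> Q" using base[of x 0] t by auto
  then show ?case using m \<gamma> by simp
next
  case (Suc n)
  have m0: "0 \<le> m" using base[of x 0] t m \<gamma> by auto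
  have yD: "(y, s) \<in> Dom" using Suc.prems D t by auto
  have int: "integral {t..s} (\<lambda>\<sigma>. N (w n (y + e * (s - \<sigma>)) \<sigma>) \<sigma>) \<le> m / 2" if e: "\<bar>e\<bar> = 1" for e
  proof -
    have "integral {t..s} (\<lambda>\<sigma>. N (w n (y + e * (s - \<sigma>)) \<sigma>) \<sigma>) \<le> integral {t..s} (\<lambda>\<sigma>. m powr p)"
    proof (intro integral_le N_char_integrable[OF yD e t(1) order_refl])
      fix \<sigma> assume \<sigma>: "\<sigma> \<in> {t..s}"
      have yD': "(y + e * (s - \<sigma>), \<sigma>) \<in> Dom" by (rule char_in_Dom[OF yD e]) (use \<sigma> t in auto)
      have "\<bar>e * (s - \<sigma>)\<bar> = s - \<sigma>" using e \<sigma> by (simp add: abs_mult)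
      then have "\<bar>y + e * (s - \<sigma>) - x\<bar> \<le> t + \<delta> - \<sigma>" using Suc.prems(2) by linarith
      from Suc.IH[OF _ this] \<sigma> have "w n (y + e * (s - \<sigma>)) \<sigma> \<le> 2 * m" using m by (simp add: w_def)
      moreover have w0: "0 \<le> w n (y + e * (s - \<sigma>)) \<sigma>" using w_ge[OF yD', of n] \<gamma> by linarith
      ultimately have "w n (y + e * (s - \<sigma>)) \<sigma> powr p \<le> (2 * m) powr p" using p by (intro powr_mono2) auto
      then have "2 powr (- p) * w n (y + e * (s - \<sigma>)) \<sigma> powr p \<le> 2 powr (- p) * (2 * m) powr p" by simp
      also have "\<dots> = m powr p" using m0 by (simp add: powr_mult powr_minus)
      finally show "N (w n (y + e * (s - \<sigma>)) \<sigma>) \<sigma> \<le> m powr p" using N_le[OF w0, of \<sigma>] t \<sigma> by auto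
    qed auto
    also have "\<dots> = (s - t) * m powr p" using Suc.prems by simp
    also have "\<dots> \<le> \<delta> * m powr p" using Suc.prems(2) by (intro mult_right_mono) auto
    finally show ?thesis using m by linarith
  qed
  have "\<phi> (Suc n) (y + 1 * (s - t)) t \<le> P" "\<psi> (Suc n) (y + - 1 * (s - t)) t \<le> Q"
    using base[of "y + 1 * (s - t)" "Suc n"] base[of "y + - 1 * (s - t)" "Suc n"] Suc.prems by auto
  then show ?case using iter_char[OF yD t(1) Suc.prems(1), of n] int[of 1] int[of "- 1"] by simp
qed

text \<open>
  On the slice at time \<open>t - \<kappa> * \<delta>\<close> with \<open>\<kappa> = 1 / (1 + \<epsilon>)\<close> the solution is dominated by its value
  at \<open>(x, t)\<close>, and from there it survives for a time \<open>\<delta>\<close>.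
\<close>

lemma fin_extend:
  fixes \<delta> x t
  defines "\<kappa> \<equiv> 1 / (1 + \<epsilon>)"
  assumes D: "(x, t) \<in> Dom" "(x, t + (1 - \<kappa>) * \<delta>) \<in> Dom" and fin: "fin x t"
    and \<delta>: "0 \<le> \<delta>" "\<kappa> * \<delta> \<le> t" "\<delta> * W x t powr p \<le> W x t / 2"
  shows "fin x (t + (1 - \<kappa>) * \<delta>)"
proof -
  define t0 where "t0 = t - \<kappa> * \<delta>"
  have \<kappa>: "0 < \<kappa>" "\<kappa> < 1" using \<epsilon> by (auto simp: \<kappa>_def)
  have eq: "t + (1 - \<kappa>) * \<delta> = t0 + \<delta>" by (simp add: t0_def algebra_simps)
  have t0: "0 \<le> t0" "t0 \<le> t" using \<delta> \<kappa> by (auto simp: t0_def)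
  \<comment> \<open>The depth \<kappa> * \<delta> is chosen so that the cone of opening 1 +
    \<epsilon> below (x, t) covers exactly |y - x| <= \<delta> on this slice. Restarting there for a
    time \<delta> gains (1 - \<kappa>) * \<delta> beyond t.\<close>
  have base: "\<phi> n y t0 \<le> \<Phi> x t \<and> \<psi> n y t0 \<le> \<Psi> x t" if y: "\<bar>y - x\<bar> \<le> \<delta>" for n y
  proof -
    have yD: "(y, t0) \<in> Dom" using D(2) y t0 \<delta> unfolding eq by auto
    have "\<bar>x - y\<bar> \<le> \<delta>" using y by (simp add: abs_minus_commute)
    also have "\<delta> = (1 + \<epsilon>) * (t - t0)" using \<epsilon> by (simp add: t0_def \<kappa>_def)
    finally show ?thesis using iter_cone_mono[OF yD D(1) _ t0(2), of n] fin_le[OF D(1) fin, of n] by linarith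
  qed
  have "\<phi> n x (t0 + \<delta>) \<le> \<Phi> x t + W x t / 2 \<and> \<psi> n x (t0 + \<delta>) \<le> \<Psi> x t + W x t / 2" for n
    by (rule iter_bound[where \<delta> = \<delta> and t = t0 and x = x]) (use D(2) t0 \<delta> base in \<open>auto simp: eq W_def\<close>)
  then show ?thesis unfolding eq by (intro finI) auto
qed

lemma fin_initial:
  assumes x: "\<bar>x\<bar> < L" and \<eta>: "0 < \<eta>"
  obtains t where "0 < t" "t < \<eta>" "(x, t) \<in> Dom" "fin x t"
proof -
  \<comment> \<open>The sum of the bounds f x + M * L and g x + M * L, which hold at time 0 for all
    iterates near x.\<close>
  define m where "m = f x + g x + 2 * (M * L)"
  have m0: "0 < m" using data_ge[OF x] \<gamma> M x by (auto simp: m_def intro!: add_pos_nonneg mult_nonneg_nonneg)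
  define \<delta> where "\<delta> = min (\<eta> / 2) (min ((L - \<bar>x\<bar>) / 2) (m / 2 / m powr p))"
  have \<delta>_le: "\<delta> \<le> \<eta> / 2" "\<delta> \<le> (L - \<bar>x\<bar>) / 2" "\<delta> \<le> m / 2 / m powr p"
    unfolding \<delta>_def by linarith+
  have "0 < \<delta>" using x \<eta> m0 by (simp add: \<delta>_def)
  then have \<delta>: "0 < \<delta>" "\<delta> < \<eta>" "\<bar>x\<bar> + \<delta> < L" "\<delta> \<le> m / 2 / m powr p"
    using \<delta>_le x \<eta> by (simp_all add: field_simps)
  have "\<delta> * m powr p \<le> m / 2" using \<delta>(4) m0 by (simp add: pos_le_divide_eq)
  have base: "\<phi> n y 0 \<le> f x + M * L \<and> \<psi> n y 0 \<le> g x + M * L" if y: "\<bar>y - x\<bar> \<le> \<delta>" for n y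
  proof -
    have yL: "\<bar>y\<bar> < L" "\<bar>y - x\<bar> \<le> L" using y \<delta> by auto
    have "M * \<bar>y - x\<bar> \<le> M * L" using yL M by (intro mult_left_mono) auto
    then have "f y \<le> f x + M * L" "g y \<le> g x + M * L" using data_lip[OF yL(1) x] by auto
    then show ?thesis using data_ge[OF yL(1)] by (cases n) (auto simp: iter_Suc I_def)
  qed
  have "\<phi> n x (0 + \<delta>) \<le> f x + M * L + m / 2 \<and> \<psi> n x (0 + \<delta>) \<le> g x + M * L + m / 2" for n
    by (rule iter_bound[where \<delta> = \<delta> and t = 0 and x = x])
      (use \<delta> base \<open>\<delta> * m powr p \<le> m / 2\<close> in \<open>auto simp: m_def\<close>)
  then have "fin x \<delta>" by (intro finI) auto
  then show thesis using that[of \<delta>] \<delta> by auto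
qed

text \<open>Picard iterates of the ordinary differential equation z' = 2 * N z t with z 0 =
  \<gamma>1 + \<gamma>2, the sum of the components for constant data. They lie below
  \<open>w\<close>, so finiteness of the solution keeps this equation from blowing up.\<close>

primrec zit :: "nat \<Rightarrow> real \<Rightarrow> real" where
  "zit 0 t = \<gamma>1 + \<gamma>2"
| "zit (Suc n) t = \<gamma>1 + \<gamma>2 + 2 * integral {0..t} (\<lambda>s. N (zit n s) s)"

lemma zit_continuous: "continuous_on {0..b} (zit n)"
proof (induction n)
  case 0
  then show ?case by (simp cong: continuous_on_cong)
next
  case (Suc n)
  have "continuous_on {0..b} (\<lambda>s. N (zit n s) s)" using Suc by (intro continuous_on_N continuous_intros) auto
  then show ?case
    by (auto intro!: continuous_intros indefinite_integral_continuous_1 integrable_continuous_real cong: continuous_on_cong)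
qed

lemma zit_integrable: "(\<lambda>s. N (zit n s) s) integrable_on {0..t}"
  by (intro integrable_continuous_real continuous_on_N continuous_intros zit_continuous) auto

lemma zit_ge: "0 \<le> t \<Longrightarrow> \<gamma>1 + \<gamma>2 \<le> zit n t"
proof (induction n arbitrary: t)
  case (Suc n)
  have "0 \<le> integral {0..t} (\<lambda>s. N (zit n s) s)"
    by (rule integral_nonneg[OF zit_integrable]) (use Suc.IH in \<open>auto intro: N_nonneg\<close>)
  then show ?case by simp
qed simp

lemma zit_mono: "0 \<le> t \<Longrightarrow> zit n t \<le> zit (Suc n) t"
proof (induction n arbitrary: t)
  case 0
  then show ?case using zit_ge[of t "Suc 0"] by (simp del: zit.simps(2))
next
  case (Suc n)
  have "integral {0..t} (\<lambda>s. N (zit n s) s) \<le> integral {0..t} (\<lambda>s. N (zit (Suc n) s) s)"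
    by (intro integral_le zit_integrable N_mono zit_ge Suc.IH) auto
  then show ?case by (subst (1 2) zit.simps(2)) simp
qed

lemma zit_le_w: "(x, t) \<in> Dom \<Longrightarrow> zit n t \<le> w n x t"
proof (induction n arbitrary: x t)
  case 0
  then show ?case by (simp add: w_def)
next
  case (Suc n)
  have "integral {0..t} (\<lambda>s. N (zit n s) s) \<le> I n e x t" if e: "\<bar>e\<bar> = 1" for e
    unfolding I_def
    by (intro integral_le zit_integrable N_char_integrable[OF Suc.prems e] N_mono zit_ge Suc.IH char_in_Dom[OF Suc.prems e])
      auto
  from this[of 1] this[of "- 1"] have "2 * integral {0..t} (\<lambda>s. N (zit n s) s) \<le> I n 1 x t + I n (- 1) x t" by simp
  moreover have "\<gamma>1 \<le> f (x + t)" "\<gamma>2 \<le> g (x - t)" using data_ge[of "x + t"] data_ge[of "x - t"] Suc.prems by auto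
  ultimately show ?case by (simp add: w_def iter_Suc)
qed

text \<open>The inequality t < T_1 with the logarithm removed. Bounded by W x t, the increasing
  \<open>zit\<close> converge to a solution z on {0..t}; z powr (1 - p) then obeys a linear
  differential inequality of Bernoulli type, which can be integrated explicitly.\<close>

lemma blowup_time_bound:
  assumes D: "(x, t) \<in> Dom" and fin: "fin x t"
  shows "(2 powr (1 - p) / \<mu> - (\<gamma>1 + \<gamma>2) powr (1 - p)) * exp ((p - 1) * \<mu> * t) < 2 powr (1 - p) / \<mu>"
proof -
  have t0: "0 \<le> t" using D by simp
  have zB: "zit n s \<le> W x t" if s: "s \<in> {0..t}" for n s
  proof -
    have D': "(x, s) \<in> Dom" using D s by auto
    have c: "\<bar>x - x\<bar> \<le> (1 + \<epsilon>) * (t - s)" "s \<le> t" using s \<epsilon> by auto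
    note f = fin_cone[OF D' D c fin]
    have "zit n s \<le> w n x s" by (rule zit_le_w[OF D'])
    also have "\<dots> \<le> W x t" using fin_le[OF D' f(1), of n] f(2,3) by (simp add: w_def W_def)
    finally show ?thesis .
  qed
  define z where "z s = lim (\<lambda>n. zit n s)" for s
  have z: "(\<lambda>n. zit n s) \<longlonglongrightarrow> z s" if s: "s \<in> {0..t}" for s
  proof -
    have "incseq (\<lambda>n. zit n s)" using zit_mono s by (intro incseq_SucI) auto
    then have "convergent (\<lambda>n. zit n s)" using zB[OF s] by (meson incseq_convergent convergentI)
    then show ?thesis by (simp add: z_def convergent_LIMSEQ_iff)
  qed
  have z_ge: "\<gamma>1 + \<gamma>2 \<le> z s" if s: "s \<in> {0..t}" for s
    using z[OF s] zit_ge s by (auto intro: LIMSEQ_le_const)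
  have le: "norm (N (zit n s) s) \<le> N (W x t) t" if "s \<in> {0..t}" for n s
    using that zB[OF that, of n] zit_ge[of s n] N_nonneg[of "zit n s" s] N_mono[of "zit n s" "W x t" s t] by auto
  have conv: "(\<lambda>n. N (zit n s) s) \<longlonglongrightarrow> N (z s) s" if "s \<in> {0..t}" for s
    using z[OF that] that by (intro N_tendsto) auto
  have zi: "(\<lambda>s. N (z s) s) integrable_on {0..t}"
    by (rule dominated_convergence(1)[OF zit_integrable _ le conv]) auto
  have zeq: "z s = \<gamma>1 + \<gamma>2 + 2 * integral {0..s} (\<lambda>s. N (z s) s)" if s: "s \<in> {0..t}" for s
  proof -
    have "(\<lambda>n. integral {0..s} (\<lambda>s. N (zit n s) s)) \<longlonglongrightarrow> integral {0..s} (\<lambda>s. N (z s) s)"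
      by (rule dominated_convergence(2)[OF zit_integrable, where h = "\<lambda>_. N (W x t) t"]) (use le conv s in auto)
    then have "(\<lambda>n. zit (Suc n) s) \<longlonglongrightarrow> \<gamma>1 + \<gamma>2 + 2 * integral {0..s} (\<lambda>s. N (z s) s)"
      by (auto intro!: tendsto_intros)
    then show ?thesis using LIMSEQ_Suc[OF z[OF s]] LIMSEQ_unique by blast
  qed
  have "continuous_on {0..t} (\<lambda>s. \<gamma>1 + \<gamma>2 + 2 * integral {0..s} (\<lambda>s. N (z s) s))"
    by (intro continuous_intros indefinite_integral_continuous_1 zi)
  then have zc: "continuous_on {0..t} z" by (rule continuous_on_eq) (use zeq in simp)
  have Nc: "continuous_on {0..t} (\<lambda>s. N (z s) s)" using zc by (intro continuous_on_N continuous_intros) auto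
  have zD: "(z has_real_derivative 2 * N (z s) s) (at s)" if s: "0 < s" "s < t" for s
  proof -
    have "((\<lambda>s. integral {0..s} (\<lambda>s. N (z s) s)) has_real_derivative N (z s) s) (at s)"
      using integral_has_real_derivative[OF Nc, of s] s by (simp add: at_within_Icc_at)
    then have "((\<lambda>s. \<gamma>1 + \<gamma>2 + 2 * integral {0..s} (\<lambda>s. N (z s) s)) has_real_derivative 2 * N (z s) s) (at s)"
      by (auto intro!: derivative_eq_intros)
    then show ?thesis
      by (rule has_field_derivative_transform_within_open[where S = "{0<..<t}"]) (use s zeq in auto)
  qed
  \<comment> \<open>The stationary value of u = z powr (1 - p) in u' = (p - 1) * \<mu> * (u - k),
    where the damping is frozen at its value for s = 0. The true coefficient \<mu> / (1 + s) is
    smaller, so u' is no larger and Y decreases.\<close>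
  define k where "k = 2 powr (1 - p) / \<mu>"
  define Y where "Y s = (z s powr (1 - p) - k) * exp (- ((p - 1) * \<mu>) * s)" for s
  have zpos: "0 < z s" if "s \<in> {0..t}" for s using z_ge[OF that] \<gamma> by linarith
  have "Y t \<le> Y 0"
  proof (rule DERIV_nonpos_imp_decreasing_open[OF t0])
    fix s assume s: "0 < s" "s < t"
    then have zp: "0 < z s" using zpos by simp
    have "((\<lambda>s. z s powr (1 - p)) has_real_derivative (1 - p) * z s powr (1 - p - 1) * (2 * N (z s) s)) (at s)"
      using DERIV_chain2[OF has_real_derivative_powr[OF zp] zD[OF s]] .
    moreover have "((\<lambda>s. exp (- ((p - 1) * \<mu>) * s)) has_real_derivative
        exp (- ((p - 1) * \<mu>) * s) * (- ((p - 1) * \<mu>))) (at s)"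
      by (auto intro!: derivative_eq_intros)
    ultimately have D: "(Y has_real_derivative (1 - p) * z s powr (1 - p - 1) * (2 * N (z s) s) * exp (- ((p - 1) * \<mu>) * s)
        + (z s powr (1 - p) - k) * (exp (- ((p - 1) * \<mu>) * s) * (- ((p - 1) * \<mu>)))) (at s)"
      unfolding Y_def by (rule DERIV_cong[OF DERIV_mult[OF DERIV_diff[OF _ DERIV_const]]]) simp
    have a: "z s powr (- p) * z s powr p = 1" using zp by (simp add: powr_minus)
    have b: "z s powr (- p) * z s = z s powr (1 - p)" using zp by (simp add: powr_diff powr_minus_divide)
    have c: "2 * 2 powr (- p) = (2 :: real) powr (1 - p)" by (simp add: powr_diff powr_minus_divide)
    have "z s powr (1 - p - 1) * (2 * N (z s) s) =
        2 * 2 powr (- p) * (z s powr (- p) * z s powr p) - \<mu> / (1 + s) * (z s powr (- p) * z s)"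
    proof -
      have "q * (2 * (A * B - X * (y / 2))) = 2 * A * (q * B) - X * (q * y)" for q A B X y :: real
        by (simp add: algebra_simps)
      moreover have "1 - p - 1 = - p" by simp
      ultimately show ?thesis using zp by (simp only: N_def abs_of_pos)
    qed
    also have "\<dots> = 2 powr (1 - p) - \<mu> / (1 + s) * z s powr (1 - p)" by (simp only: a b c mult_1_right)
    also have "2 powr (1 - p) = \<mu> * k" using \<mu> by (simp add: k_def)
    finally have d: "z s powr (1 - p - 1) * (2 * N (z s) s) = \<mu> * k - \<mu> / (1 + s) * z s powr (1 - p)" .
    have "(1 - p) * z s powr (1 - p - 1) * (2 * N (z s) s) * exp (- ((p - 1) * \<mu>) * s)
        + (z s powr (1 - p) - k) * (exp (- ((p - 1) * \<mu>) * s) * (- ((p - 1) * \<mu>)))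
      = - ((p - 1) * exp (- ((p - 1) * \<mu>) * s)) *
          (z s powr (1 - p - 1) * (2 * N (z s) s) + \<mu> * (z s powr (1 - p) - k))"
      by (simp add: algebra_simps)
    also have "\<dots> = - ((p - 1) * exp (- ((p - 1) * \<mu>) * s)) * ((\<mu> - \<mu> / (1 + s)) * z s powr (1 - p))"
      unfolding d by (simp add: algebra_simps)
    also have "\<dots> \<le> 0"
    proof -
      have "\<mu> / (1 + s) \<le> \<mu> / 1" using \<mu> s by (intro divide_left_mono) auto
      then show ?thesis using p by (auto intro!: mult_nonpos_nonneg mult_nonneg_nonneg)
    qed
    finally show "\<exists>y. (Y has_real_derivative y) (at s) \<and> y \<le> 0" using D by blast
  next
    show "continuous_on {0..t} Y"
      unfolding Y_def using zpos by (intro continuous_intros zc) force+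
  qed
  moreover have "z 0 = \<gamma>1 + \<gamma>2" using zeq[of 0] t0 by simp
  ultimately have "(z t powr (1 - p) - k) * exp (- ((p - 1) * \<mu>) * t) \<le> (\<gamma>1 + \<gamma>2) powr (1 - p) - k"
    by (simp add: Y_def)
  \<comment> \<open>Strict since z t powr (1 - p) > 0; this expresses that z is still finite at time
    t.\<close>
  moreover have "- k * exp (- ((p - 1) * \<mu>) * t) < (z t powr (1 - p) - k) * exp (- ((p - 1) * \<mu>) * t)"
    using zpos[of t] t0 by (intro mult_strict_right_mono) auto
  ultimately have "k - (\<gamma>1 + \<gamma>2) powr (1 - p) < k * exp (- ((p - 1) * \<mu>) * t)" by simp
  then have "(k - (\<gamma>1 + \<gamma>2) powr (1 - p)) * exp ((p - 1) * \<mu> * t) <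
      k * exp (- ((p - 1) * \<mu>) * t) * exp ((p - 1) * \<mu> * t)" by (rule mult_strict_right_mono) simp
  also have "\<dots> = k" by (simp add: mult.assoc flip: exp_add)
  finally show ?thesis by (simp add: k_def)
qed

end

section \<open>Blow-up curve and rescaling\<close>

text \<open>\<open>deriv\<close> is two-sided and is identified with \<open>D 1\<close> only in the
  interior; boundedness comes from the compact closed interval.\<close>

lemma C4_closed_deriv:
  assumes "C4_closed f a b"
  shows "\<And>x. x \<in> {a<..<b} \<Longrightarrow> (f has_real_derivative deriv f x) (at x)"
    and "\<exists>B. \<forall>x\<in>{a<..<b}. \<bar>deriv f x\<bar> \<le> B"
proof -
  obtain D :: "nat \<Rightarrow> real \<Rightarrow> real" where D0: "\<And>x. x \<in> {a..b} \<Longrightarrow> D 0 x = f x"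
    and DS: "\<And>k x. k < 4 \<Longrightarrow> x \<in> {a..b} \<Longrightarrow> (D k has_real_derivative D (Suc k) x) (at x within {a..b})"
    and Dc: "\<And>k. k \<le> 4 \<Longrightarrow> continuous_on {a..b} (D k)"
    using assms unfolding C4_closed_def by blast
  have f: "(f has_real_derivative D 1 x) (at x)" if x: "x \<in> {a<..<b}" for x
  proof -
    have "(D 0 has_real_derivative D 1 x) (at x)" using DS[of 0 x] x by (simp add: at_within_Icc_at)
    then show ?thesis
      by (rule has_field_derivative_transform_within_open[where S = "{a<..<b}"]) (use x D0 in auto)
  qed
  then have d: "deriv f x = D 1 x" if "x \<in> {a<..<b}" for x using that by (intro DERIV_imp_deriv)
  show "(f has_real_derivative deriv f x) (at x)" if "x \<in> {a<..<b}" for x using f d that by simp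
  have "bounded (D 1 ` {a..b})" using Dc[of 1] by (intro compact_imp_bounded compact_continuous_image) auto
  then obtain B where "\<forall>z\<in>D 1 ` {a..b}. norm z \<le> B" unfolding bounded_iff by blast
  then have B: "\<bar>D 1 x\<bar> \<le> B" if "x \<in> {a..b}" for x using that by auto
  have "\<bar>deriv f x\<bar> \<le> B" if "x \<in> {a<..<b}" for x using B[of x] d[OF that] that by simp
  then show "\<exists>B. \<forall>x\<in>{a<..<b}. \<bar>deriv f x\<bar> \<le> B" by blast
qed

lemma C3_on_imp_C1_on:
  assumes "C3_on U u"
  shows "C1_on U u (pd [True] u) (pd [False] u)"
  unfolding C1_on_def
proof (intro conjI ballI)
  fix z assume z: "z \<in> U"
  obtain y s where ys: "z = (y, s)" by (cases z)
  have "(\<lambda>y. pd [] u y s) differentiable (at y)" "(\<lambda>s. pd [] u y s) differentiable (at s)"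
    using conjunct1[OF assms[unfolded C3_on_def], rule_format, OF _ z, of "[]"] ys by simp_all
  then show "case z of (y, s) \<Rightarrow> ((\<lambda>y. u y s) has_real_derivative pd [True] u y s) (at y) \<and>
      (u y has_real_derivative pd [False] u y s) (at s)"
    by (simp add: ys pdy_def pds_def DERIV_deriv_iff_real_differentiable)
next
  have "continuous_on U (\<lambda>(y, s). pd w u y s)" if "length w \<le> 3" for w
    using assms that unfolding C3_on_def by blast
  from this[of "[True]"] this[of "[False]"]
  show "continuous_on U (\<lambda>(y, s). pd [True] u y s)" "continuous_on U (\<lambda>(y, s). pd [False] u y s)"
    by (simp_all del: pd.simps)
qed

section \<open>Lipschitz bound and lower rate for the blow-up time\<close>

locale blowup = picard p \<mu> \<gamma>1 \<gamma>2 "Rs + Ts" M \<epsilon> f g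
  for p \<mu> \<gamma>1 \<gamma>2 Rs Ts M \<epsilon> :: real and f g :: "real \<Rightarrow> real" +
  assumes Rs: "0 < Rs" and Ts: "0 < Ts"
    and T1: "1 / ((p - 1) * \<mu>) *
      ln ((2 powr (1 - p) / \<mu>) / (2 powr (1 - p) / \<mu> - (\<gamma>1 + \<gamma>2) powr (1 - p))) < Ts"
begin

abbreviation "T \<equiv> Tblow p \<mu> \<gamma>1 \<gamma>2 f g Ts"
definition "\<kappa> = 1 / (1 + \<epsilon>)"

lemma \<kappa>: "0 < \<kappa>" "\<kappa> < 1" "(1 + \<epsilon>) * \<kappa> = 1"
  using \<epsilon> by (auto simp: \<kappa>_def)

lemma T_eq: "T x = Sup {t \<in> {0<..<Ts}. fin x t}"
  by (simp add: Tblow_def fin_def)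

lemma fin_lt_T1:
  assumes x: "\<bar>x\<bar> < Rs" and t: "0 < t" "t < Ts" and fin: "fin x t"
  shows "t \<le> 1 / ((p - 1) * \<mu>) *
      ln ((2 powr (1 - p) / \<mu>) / (2 powr (1 - p) / \<mu> - (\<gamma>1 + \<gamma>2) powr (1 - p)))"
proof -
  define k where "k = 2 powr (1 - p) / \<mu>"
  define c where "c = (\<gamma>1 + \<gamma>2) powr (1 - p)"
  have k: "0 < k" using \<mu> by (simp add: k_def)
  have pm: "0 < (p - 1) * \<mu>" using p \<mu> by simp
  \<comment> \<open>Positivity of the denominator in T_1, needed before logarithms are
    taken.\<close>
  have "c < k"
  proof -
    have "c = 1 / (\<gamma>1 + \<gamma>2) powr (p - 1)" using \<gamma> by (simp add: c_def powr_diff)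
    also have "\<dots> < 1 / (\<mu> * p * 2 powr p)"
      using big p \<mu> \<gamma> by (intro divide_strict_left_mono mult_pos_pos) auto
    also have "\<dots> \<le> 1 / (\<mu> * (1 / 2) * 2 powr p)"
      using p \<mu> by (intro divide_left_mono mult_pos_pos mult_right_mono mult_left_mono) auto
    also have "\<dots> = k" by (simp add: k_def powr_diff)
    finally show ?thesis .
  qed
  have "(x, t) \<in> Dom" using x t by simp
  from blowup_time_bound[OF this fin] have "(k - c) * exp ((p - 1) * \<mu> * t) < k" by (simp add: k_def c_def)
  then have "exp ((p - 1) * \<mu> * t) < k / (k - c)" using \<open>c < k\<close> by (simp add: pos_less_divide_eq mult.commute)
  then have "(p - 1) * \<mu> * t < ln (k / (k - c))"
    using \<open>c < k\<close> k by (subst ln_exp[symmetric], subst ln_less_cancel_iff) auto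
  then have "t < ln (k / (k - c)) / ((p - 1) * \<mu>)" using pm by (simp add: pos_less_divide_eq mult.commute)
  then show ?thesis by (simp add: k_def c_def)
qed

lemma fin_imp_le_T:
  assumes "0 < t" "t < Ts" "fin x t" shows "t \<le> T x"
  unfolding T_eq by (rule cSup_upper) (use assms in \<open>auto intro!: bdd_aboveI[of _ Ts]\<close>)

text \<open>As a supremum over times below T*, T x could equal T* without any blow-up; (A1) excludes
  this, so T x is a true blow-up time with room above it.\<close>

lemma T_bounds:
  assumes x: "\<bar>x\<bar> < Rs" shows "0 < T x" "T x < Ts"
proof -
  obtain t where t: "0 < t" "t < Ts" "fin x t"
    using fin_initial[of x Ts] x Ts by auto
  show "0 < T x" using fin_imp_le_T[OF t] t by linarith
  have "T x \<le> 1 / ((p - 1) * \<mu>) *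
      ln ((2 powr (1 - p) / \<mu>) / (2 powr (1 - p) / \<mu> - (\<gamma>1 + \<gamma>2) powr (1 - p)))"
    unfolding T_eq by (rule cSup_least) (use t fin_lt_T1[OF x] in auto)
  then show "T x < Ts" using T1 by linarith
qed

lemma Dom_T:
  assumes "\<bar>x\<bar> < Rs" "0 \<le> t" "t < Ts" shows "(x, t) \<in> Dom"
  using assms by simp

lemma T_fin:
  assumes x: "\<bar>x\<bar> < Rs" and t: "0 \<le> t" "t < T x"
  shows "fin x t"
proof -
  obtain t' where t': "0 < t'" "t' < Ts" "fin x t'" "t < t'"
  proof -
    obtain t0 where "0 < t0" "t0 < Ts" "fin x t0" using fin_initial[of x Ts] x Ts by auto
    then have "{t \<in> {0<..<Ts}. fin x t} \<noteq> {}" "bdd_above {t \<in> {0<..<Ts}. fin x t}"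
      by (auto intro!: bdd_aboveI[of _ Ts])
    then show thesis using t(2) that unfolding T_eq by (auto simp: less_cSup_iff)
  qed
  show ?thesis
    by (rule fin_cone(1)[OF Dom_T Dom_T, of x t x t']) (use x t t' \<epsilon> in auto)
qed

text \<open>Finiteness at (x, t) spreads to (x', t - \<kappa> * |x - x'|) by
  \<open>fin_cone\<close>. For t close to T x this would exceed T x' if the bound failed.\<close>

lemma T_lip:
  assumes "\<bar>x\<bar> < Rs" "\<bar>x'\<bar> < Rs"
  shows "\<bar>T x - T x'\<bar> \<le> \<kappa> * \<bar>x - x'\<bar>"
proof -
  have "T x - \<kappa> * \<bar>x - x'\<bar> \<le> T x'" if x: "\<bar>x\<bar> < Rs" "\<bar>x'\<bar> < Rs" for x x'
  proof (rule ccontr)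
    assume "\<not> ?thesis"
    then have "T x' + \<kappa> * \<bar>x - x'\<bar> < T x" by simp
    then obtain t where t: "T x' + \<kappa> * \<bar>x - x'\<bar> < t" "t < T x" using dense by blast
    define s where "s = t - \<kappa> * \<bar>x - x'\<bar>"
    have kx: "0 \<le> \<kappa> * \<bar>x - x'\<bar>" using \<kappa> by simp
    have s: "T x' < s" "s \<le> t" "0 < s" "s < Ts" "0 \<le> t" "t < Ts"
      using t kx T_bounds[OF x(1)] T_bounds[OF x(2)] by (auto simp: s_def)
    have "\<bar>x - x'\<bar> \<le> (1 + \<epsilon>) * (t - s)"
      using \<kappa>(3) by (simp add: s_def flip: mult.assoc)
    then have "fin x' s"
      by (intro fin_cone(1)[OF Dom_T Dom_T, of x' s x t] T_fin) (use x s t in auto)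
    then show False using fin_imp_le_T[of s x'] s by auto
  qed
  from this[OF assms] this[OF assms(2,1)] show ?thesis by (simp add: abs_minus_commute abs_le_iff)
qed

text \<open>Otherwise \<open>fin_extend\<close> would carry finiteness beyond T x. The step W powr
  (1 - p) / 2 is the largest with \<delta> * W powr p <= W / 2, and the minimum with t keeps the
  restarting slice at a nonnegative time.\<close>

lemma T_lower:
  assumes x: "\<bar>x\<bar> < Rs" and t: "0 < t" "t < T x"
  shows "(1 - \<kappa>) * min (W x t powr (1 - p) / 2) t \<le> T x - t"
proof (rule ccontr)
  define \<delta> where "\<delta> = min (W x t powr (1 - p) / 2) t"
  assume "\<not> ?thesis"
  then have "T x < t + (1 - \<kappa>) * \<delta>" by (simp add: \<delta>_def)
  then have "T x < min Ts (t + (1 - \<kappa>) * \<delta>)" using T_bounds[OF x] by simp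
  then obtain t' where t': "T x < t'" "t' < min Ts (t + (1 - \<kappa>) * \<delta>)" using dense by blast
  \<comment> \<open>The step for which \<open>fin_extend\<close> lands exactly at t', which lies
    beyond T x but still below Ts.\<close>
  define \<delta>' where "\<delta>' = (t' - t) / (1 - \<kappa>)"
  have eq: "t' = t + (1 - \<kappa>) * \<delta>'" using \<kappa> by (simp add: \<delta>'_def)
  have fin: "fin x t" using T_fin[OF x] t by simp
  have D: "(x, t) \<in> Dom" "(x, t') \<in> Dom" using x t t' T_bounds[OF x] by auto
  have W0: "0 < W x t" using \<Phi>_ge[OF D(1) fin] \<gamma> by linarith
  have \<delta>'0: "0 \<le> \<delta>'" using t t' \<kappa> by (simp add: \<delta>'_def)
  have "(1 - \<kappa>) * \<delta>' < (1 - \<kappa>) * \<delta>" using t' eq by simp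
  then have \<delta>': "\<delta>' \<le> \<delta>" using \<kappa> by simp
  have \<delta>: "\<delta> \<le> t" "\<delta> \<le> W x t powr (1 - p) / 2" by (simp_all add: \<delta>_def)
  have "fin x (t + (1 - 1 / (1 + \<epsilon>)) * \<delta>')"
  proof (rule fin_extend[OF D(1) _ fin \<delta>'0])
    show "(x, t + (1 - 1 / (1 + \<epsilon>)) * \<delta>') \<in> Dom" using D(2) eq by (simp add: \<kappa>_def)
    have "\<kappa> * \<delta>' \<le> \<delta>'" using \<kappa> \<delta>'0 by (simp add: mult_left_le_one_le)
    then show "1 / (1 + \<epsilon>) * \<delta>' \<le> t" using \<delta> \<delta>' by (simp add: \<kappa>_def)
    have "\<delta>' * W x t powr p \<le> W x t powr (1 - p) / 2 * W x t powr p"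
      using \<delta> \<delta>' by (intro mult_right_mono) auto
    also have "\<dots> = W x t / 2" using W0 by (simp add: powr_diff)
    finally show "\<delta>' * W x t powr p \<le> W x t / 2" .
  qed
  then have "fin x t'" using eq by (simp add: \<kappa>_def)
  then show False using fin_imp_le_T[of t' x] t t' T_bounds[OF x] by auto
qed

end

section \<open>Blow-up limits as ancient profiles, from pointwise convergence\<close>

locale rescaling = blowup p \<mu> \<gamma>1 \<gamma>2 Rs Ts M \<epsilon> f g
  for p \<mu> \<gamma>1 \<gamma>2 Rs Ts M \<epsilon> :: real and f g :: "real \<Rightarrow> real" +
  fixes x0 :: real and lam :: "nat \<Rightarrow> real" and T0 :: "real \<Rightarrow> real" and v1 v2 :: "real \<Rightarrow> real \<Rightarrow> real"
  assumes x0: "\<bar>x0\<bar> < Rs" and lam_pos: "\<And>n. 0 < lam n" and lam_lim: "lam \<longlonglongrightarrow> 0"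
    and T0: "\<And>y. (\<lambda>n. T_resc p \<mu> \<gamma>1 \<gamma>2 f g Ts x0 (lam n) y) \<longlonglongrightarrow> T0 y"
    and v1: "\<And>y s. s < T0 y \<Longrightarrow> (\<lambda>n. phi_resc p \<mu> \<gamma>1 \<gamma>2 f g Ts x0 (lam n) y s) \<longlonglongrightarrow> v1 y s"
    and v2: "\<And>y s. s < T0 y \<Longrightarrow> (\<lambda>n. psi_resc p \<mu> \<gamma>1 \<gamma>2 f g Ts x0 (lam n) y s) \<longlonglongrightarrow> v2 y s"
begin

definition "X n y = x0 + lam n * y"
definition "\<tau> n s = T x0 + lam n * s"
definition "q = 1 / (p - 1)"
definition "Tr n y = (T (X n y) - T x0) / lam n"
definition "wr n y s = lam n powr q * W (X n y) (\<tau> n s)"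
definition "good n y s \<longleftrightarrow> \<bar>X n y\<bar> < Rs \<and> 0 < \<tau> n s \<and> \<tau> n s < T (X n y)"

lemma Tr_lim: "(\<lambda>n. Tr n y) \<longlonglongrightarrow> T0 y"
  using T0[of y] by (simp add: T_resc_def Tr_def X_def)

lemma resc_lim:
  assumes "s < T0 y"
  shows "(\<lambda>n. lam n powr q * \<Phi> (X n y) (\<tau> n s)) \<longlonglongrightarrow> v1 y s"
    "(\<lambda>n. lam n powr q * \<Psi> (X n y) (\<tau> n s)) \<longlonglongrightarrow> v2 y s"
  using v1[OF assms] v2[OF assms]
  by (simp_all add: phi_resc_def psi_resc_def \<Phi>_def \<Psi>_def X_def \<tau>_def q_def)

lemma wr_lim: "s < T0 y \<Longrightarrow> (\<lambda>n. wr n y s) \<longlonglongrightarrow> v1 y s + v2 y s"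
  using tendsto_add[OF resc_lim] by (simp add: wr_def W_def distrib_left)

lemma X_lim: "(\<lambda>n. X n y) \<longlonglongrightarrow> x0" and \<tau>_lim: "(\<lambda>n. \<tau> n s) \<longlonglongrightarrow> T x0"
  using tendsto_add[OF tendsto_const[of x0] tendsto_mult[OF lam_lim tendsto_const[of y]]]
    tendsto_add[OF tendsto_const[of "T x0"] tendsto_mult[OF lam_lim tendsto_const[of s]]]
  by (simp_all add: X_def \<tau>_def)

lemma X_small: "\<forall>\<^sub>F n in sequentially. \<bar>X n y\<bar> < Rs"
  using tendsto_rabs[OF X_lim[of y]] x0 by (rule order_tendstoD)

lemma good: "s < T0 y \<Longrightarrow> \<forall>\<^sub>F n in sequentially. good n y s"
proof -
  assume s: "s < T0 y"
  have "\<forall>\<^sub>F n in sequentially. 0 < \<tau> n s"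
    using \<tau>_lim T_bounds(1)[OF x0] by (rule order_tendstoD)
  moreover have "\<forall>\<^sub>F n in sequentially. s < Tr n y" using Tr_lim s by (rule order_tendstoD)
  ultimately show ?thesis using X_small[of y]
    by eventually_elim (use lam_pos in \<open>auto simp: good_def Tr_def \<tau>_def pos_less_divide_eq mult.commute\<close>)
qed

lemma goodD:
  assumes "good n y s"
  shows "(X n y, \<tau> n s) \<in> Dom" "fin (X n y) (\<tau> n s)" "0 \<le> \<tau> n s"
  using assms T_fin[of "X n y" "\<tau> n s"] T_bounds[of "X n y"] by (auto simp: good_def)

lemma T0_0: "T0 0 = 0"
  using Tr_lim[of 0] LIMSEQ_unique[OF _ tendsto_const[of 0]] by (simp add: Tr_def X_def)

lemma T0_lip: "\<bar>T0 y - T0 y'\<bar> \<le> \<kappa> * \<bar>y - y'\<bar>"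
proof (rule tendsto_upperbound)
  show "(\<lambda>n. \<bar>Tr n y - Tr n y'\<bar>) \<longlonglongrightarrow> \<bar>T0 y - T0 y'\<bar>" by (intro tendsto_intros Tr_lim)
  show "\<forall>\<^sub>F n in sequentially. \<bar>Tr n y - Tr n y'\<bar> \<le> \<kappa> * \<bar>y - y'\<bar>"
    using X_small[of y] X_small[of y']
  proof eventually_elim
    case (elim n)
    have "\<bar>T (X n y) - T (X n y')\<bar> \<le> \<kappa> * \<bar>X n y - X n y'\<bar>" by (rule T_lip[OF elim])
    also have "X n y - X n y' = lam n * (y - y')" by (simp add: X_def algebra_simps)
    finally have "\<bar>T (X n y) - T (X n y')\<bar> \<le> \<kappa> * \<bar>y - y'\<bar> * lam n"
      using lam_pos[of n] by (simp add: abs_mult mult_ac)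
    moreover have "Tr n y - Tr n y' = (T (X n y) - T (X n y')) / lam n" by (simp add: Tr_def diff_divide_distrib)
    ultimately show ?case using lam_pos[of n] by (simp add: abs_divide pos_divide_le_eq)
  qed
qed simp

lemma v_nonneg:
  assumes s: "s < T0 y" shows "0 \<le> v1 y s" "0 \<le> v2 y s"
proof -
  have "\<forall>\<^sub>F n in sequentially. 0 \<le> lam n powr q * \<Phi> (X n y) (\<tau> n s) \<and> 0 \<le> lam n powr q * \<Psi> (X n y) (\<tau> n s)"
    using good[OF s]
  proof eventually_elim
    case (elim n)
    show ?case using \<Phi>_ge(1,2)[OF goodD(1,2)[OF elim]] \<gamma> by simp
  qed
  then have ev: "\<forall>\<^sub>F n in sequentially. 0 \<le> lam n powr q * \<Phi> (X n y) (\<tau> n s)"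
    "\<forall>\<^sub>F n in sequentially. 0 \<le> lam n powr q * \<Psi> (X n y) (\<tau> n s)"
    unfolding eventually_conj_iff by blast+
  show "0 \<le> v1 y s" by (rule tendsto_lowerbound[OF resc_lim(1)[OF s] ev(1)]) simp
  show "0 \<le> v2 y s" by (rule tendsto_lowerbound[OF resc_lim(2)[OF s] ev(2)]) simp
qed

lemma v_mono:
  assumes s: "s < T0 y" "s' < T0 y'" and c: "\<kappa> * \<bar>y' - y\<bar> \<le> s' - s"
  shows "v1 y s \<le> v1 y' s'" "v2 y s \<le> v2 y' s'"
proof -
  have "0 \<le> \<kappa> * \<bar>y' - y\<bar>" using \<kappa> by simp
  then have ss: "s \<le> s'" using c by linarith
  have "(1 + \<epsilon>) * (\<kappa> * \<bar>y' - y\<bar>) \<le> (1 + \<epsilon>) * (s' - s)" using c \<epsilon> by (intro mult_left_mono) auto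
  then have c': "\<bar>y' - y\<bar> \<le> (1 + \<epsilon>) * (s' - s)" using \<kappa>(3) by (simp flip: mult.assoc)
  have "\<forall>\<^sub>F n in sequentially. lam n powr q * \<Phi> (X n y) (\<tau> n s) \<le> lam n powr q * \<Phi> (X n y') (\<tau> n s') \<and>
      lam n powr q * \<Psi> (X n y) (\<tau> n s) \<le> lam n powr q * \<Psi> (X n y') (\<tau> n s')"
    using good[OF s(1)] good[OF s(2)]
  proof eventually_elim
    case (elim n)
    have "X n y' - X n y = lam n * (y' - y)" by (simp add: X_def algebra_simps)
    then have "\<bar>X n y' - X n y\<bar> = lam n * \<bar>y' - y\<bar>" using lam_pos[of n] by (simp add: abs_mult)
    also have "\<dots> \<le> lam n * ((1 + \<epsilon>) * (s' - s))" using c' lam_pos[of n] by (intro mult_left_mono) auto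
    also have "\<dots> = (1 + \<epsilon>) * (\<tau> n s' - \<tau> n s)" by (simp add: \<tau>_def algebra_simps)
    finally have "\<bar>X n y' - X n y\<bar> \<le> (1 + \<epsilon>) * (\<tau> n s' - \<tau> n s)" .
    moreover have "\<tau> n s \<le> \<tau> n s'" using ss lam_pos[of n] by (simp add: \<tau>_def)
    ultimately show ?case
      using fin_cone(2,3)[OF goodD(1)[OF elim(1)] goodD(1)[OF elim(2)] _ _ goodD(2)[OF elim(2)]]
      by (auto intro!: mult_left_mono)
  qed
  then have ev: "\<forall>\<^sub>F n in sequentially. lam n powr q * \<Phi> (X n y) (\<tau> n s) \<le> lam n powr q * \<Phi> (X n y') (\<tau> n s')"
    "\<forall>\<^sub>F n in sequentially. lam n powr q * \<Psi> (X n y) (\<tau> n s) \<le> lam n powr q * \<Psi> (X n y') (\<tau> n s')"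
    unfolding eventually_conj_iff by blast+
  show "v1 y s \<le> v1 y' s'"
    by (rule tendsto_le[OF _ resc_lim(1)[OF s(2)] resc_lim(1)[OF s(1)] ev(1)]) simp
  show "v2 y s \<le> v2 y' s'"
    by (rule tendsto_le[OF _ resc_lim(2)[OF s(2)] resc_lim(2)[OF s(1)] ev(2)]) simp
qed

lemma pq: "q * (1 - p) = - 1" "q + 1 = q * p" "0 < q"
  using p by (auto simp: q_def field_simps)

text \<open>\<open>T_lower\<close> in rescaled variables. The limit is taken in the lower bound for
  \<open>wr\<close>, rather than in the equivalent bound for its power 1 - p, because this also
  yields positivity of the limit.\<close>

lemma v_low:
  fixes y s
  defines "C \<equiv> 2 / (1 - \<kappa>)"
  assumes s: "s < T0 y"
  shows "0 < v1 y s + v2 y s" "(v1 y s + v2 y s) powr (1 - p) \<le> C * (T0 y - s)"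
proof -
  have C: "0 < C" using \<kappa> by (simp add: C_def)
  \<comment> \<open>The distance to the blow-up time tends to 0 while (1 - \<kappa>) * \<tau> n s
    tends to a positive number, so eventually \<tau> n s cannot attain the minimum in
    \<open>T_lower\<close>.\<close>
  have "(\<lambda>n. lam n * (Tr n y - s)) \<longlonglongrightarrow> 0 * (T0 y - s)" by (intro tendsto_intros lam_lim Tr_lim)
  moreover have "(\<lambda>n. (1 - \<kappa>) * \<tau> n s) \<longlonglongrightarrow> (1 - \<kappa>) * T x0" by (intro tendsto_intros \<tau>_lim)
  ultimately have "(\<lambda>n. (1 - \<kappa>) * \<tau> n s - lam n * (Tr n y - s)) \<longlonglongrightarrow> (1 - \<kappa>) * T x0 - 0 * (T0 y - s)"
    by (rule tendsto_diff[rotated])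
  moreover have "0 < (1 - \<kappa>) * T x0 - 0 * (T0 y - s)" using \<kappa> T_bounds(1)[OF x0] by simp
  ultimately have "\<forall>\<^sub>F n in sequentially. 0 < (1 - \<kappa>) * \<tau> n s - lam n * (Tr n y - s)" by (rule order_tendstoD)
  moreover have "\<forall>\<^sub>F n in sequentially. s < Tr n y" using Tr_lim s by (rule order_tendstoD)
  ultimately have ev: "\<forall>\<^sub>F n in sequentially. (C * (Tr n y - s)) powr (- q) \<le> wr n y s"
    using good[OF s]
  proof eventually_elim
    case (elim n)
    define V where "V = W (X n y) (\<tau> n s)"
    have V: "0 < V" using \<Phi>_ge(3)[OF goodD(1,2)[OF elim(3)]] \<gamma> by (simp add: V_def)
    have dist: "T (X n y) - \<tau> n s = lam n * (Tr n y - s)"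
    proof -
      have "lam n * Tr n y = T (X n y) - T x0" using lam_pos[of n] by (simp add: Tr_def)
      then show ?thesis by (simp add: \<tau>_def right_diff_distrib)
    qed
    have "(1 - \<kappa>) * min (V powr (1 - p) / 2) (\<tau> n s) \<le> lam n * (Tr n y - s)"
      using T_lower[of "X n y" "\<tau> n s"] elim(3) dist by (simp add: good_def V_def)
    then have "(1 - \<kappa>) * (V powr (1 - p) / 2) \<le> lam n * (Tr n y - s)"
      using elim(1) by (cases "V powr (1 - p) / 2 \<le> \<tau> n s") (auto simp: min_def)
    then have "V powr (1 - p) \<le> C * (lam n * (Tr n y - s))" using \<kappa> by (simp add: C_def field_simps)
    then have "(C * (lam n * (Tr n y - s))) powr (- q) \<le> (V powr (1 - p)) powr (- q)"
      using V pq by (intro powr_mono2') auto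
    moreover have "(V powr (1 - p)) powr (- q) = V" using V pq(1) by (simp add: powr_powr mult.commute)
    moreover have "(C * (lam n * (Tr n y - s))) powr (- q) = lam n powr (- q) * (C * (Tr n y - s)) powr (- q)"
      using C elim(2) lam_pos[of n] by (simp add: powr_mult mult_ac)
    ultimately have "lam n powr q * (lam n powr (- q) * (C * (Tr n y - s)) powr (- q)) \<le> lam n powr q * V"
      by (intro mult_left_mono) auto
    moreover have "lam n powr q * lam n powr (- q) = 1" using lam_pos[of n] by (simp add: powr_minus)
    ultimately show ?case by (simp add: wr_def V_def flip: mult.assoc)
  qed
  have pos: "0 < C * (T0 y - s)" using C s by simp
  have "(\<lambda>n. (C * (Tr n y - s)) powr (- q)) \<longlonglongrightarrow> (C * (T0 y - s)) powr (- q)"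
    using C s by (intro tendsto_intros Tr_lim) auto
  from tendsto_le[OF _ wr_lim[OF s] this ev] have le: "(C * (T0 y - s)) powr (- q) \<le> v1 y s + v2 y s" by simp
  moreover have "0 < (C * (T0 y - s)) powr (- q)" using C s by simp
  ultimately show "0 < v1 y s + v2 y s" by linarith
  have "(v1 y s + v2 y s) powr (1 - p) \<le> ((C * (T0 y - s)) powr (- q)) powr (1 - p)"
    using le \<open>0 < (C * (T0 y - s)) powr (- q)\<close> p by (intro powr_mono2') auto
  also have "\<dots> = C * (T0 y - s)" using pos pq(1) by (simp add: powr_powr)
  finally show "(v1 y s + v2 y s) powr (1 - p) \<le> C * (T0 y - s)" .
qed

lemma past_T0:
  assumes e: "\<bar>e\<bar> = 1" and h: "0 \<le> h" "s + h < T0 (y - e * h)" and \<sigma>: "0 \<le> \<sigma>" "\<sigma> \<le> h"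
  shows "s + \<sigma> < T0 (y - e * \<sigma>)"
proof -
  have "(y - e * h) - (y - e * \<sigma>) = e * (\<sigma> - h)" by (simp add: algebra_simps)
  then have "\<bar>(y - e * h) - (y - e * \<sigma>)\<bar> = h - \<sigma>" using e \<sigma> by (simp add: abs_mult)
  then have "T0 (y - e * h) \<le> T0 (y - e * \<sigma>) + \<kappa> * (h - \<sigma>)"
    using T0_lip[of "y - e * h" "y - e * \<sigma>"] by simp
  moreover have "\<kappa> * (h - \<sigma>) \<le> h - \<sigma>" using \<kappa> \<sigma> by (simp add: mult_left_le_one_le)
  ultimately show ?thesis using h by linarith
qed

text \<open>With \<open>\<Theta>\<close>, \<open>u\<close> and \<open>e\<close> left open, one proof
  serves both families. Pointwise limits suffice: monotonicity along the characteristic bounds the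
  rescaled integrand by its value at the upper end, and dominated convergence applies.\<close>

lemma v_char:
  fixes \<Theta> u :: "real \<Rightarrow> real \<Rightarrow> real"
  assumes e: "\<bar>e\<bar> = 1"
    and char: "\<And>x t s. (x, t) \<in> Dom \<Longrightarrow> fin x t \<Longrightarrow> 0 \<le> s \<Longrightarrow> s \<le> t \<Longrightarrow>
      \<Theta> x t = \<Theta> (x + e * (t - s)) s + integral {s..t} (\<lambda>\<sigma>. N (W (x + e * (t - \<sigma>)) \<sigma>) \<sigma>)"
    and lim: "\<And>y s. s < T0 y \<Longrightarrow> (\<lambda>n. lam n powr q * \<Theta> (X n y) (\<tau> n s)) \<longlonglongrightarrow> u y s"
    and h: "0 \<le> h" "s + h < T0 (y - e * h)"
  shows "u (y - e * h) (s + h) =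
    u y s + integral {0..h} (\<lambda>\<sigma>. 2 powr (- p) * (v1 (y - e * \<sigma>) (s + \<sigma>) + v2 (y - e * \<sigma>) (s + \<sigma>)) powr p)"
proof -
  note past = past_T0[OF e h]
  have s0: "s < T0 y" using past[of 0] h by simp
  \<comment> \<open>The exponent consists of q from the amplitude of \<Theta> and 1 from the
    substitution in time; q + 1 = q * p makes the power term scale invariant.\<close>
  define k where "k n \<sigma> = lam n powr (q + 1) * N (W (X n (y - e * \<sigma>)) (\<tau> n (s + \<sigma>))) (\<tau> n (s + \<sigma>))" for n \<sigma>
  define v where "v \<sigma> = v1 (y - e * \<sigma>) (s + \<sigma>) + v2 (y - e * \<sigma>) (s + \<sigma>)" for \<sigma>
  have "\<forall>\<^sub>F n in sequentially. wr n (y - e * h) (s + h) < v h + 1"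
    using wr_lim[OF h(2)] by (rule order_tendstoD) (simp add: v_def)
  with good[OF s0] good[OF h(2)]
  have "\<forall>\<^sub>F n in sequentially. good n y s \<and> good n (y - e * h) (s + h) \<and> wr n (y - e * h) (s + h) < v h + 1"
    by eventually_elim simp
  then obtain n0 where n0: "\<And>n. n0 \<le> n \<Longrightarrow>
      good n y s \<and> good n (y - e * h) (s + h) \<and> wr n (y - e * h) (s + h) < v h + 1"
    by (auto simp: eventually_sequentially)
  have seg: "X n (y - e * h) + e * (\<tau> n (s + h) - \<tau> n (s + \<sigma>)) = X n (y - e * \<sigma>)" for n \<sigma>
    by (simp add: X_def \<tau>_def algebra_simps)
  have kint: "k n integrable_on {0..h}"
    and keq: "lam n powr q * \<Theta> (X n (y - e * h)) (\<tau> n (s + h)) = lam n powr q * \<Theta> (X n y) (\<tau> n s) + integral {0..h} (k n)"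
    and kle: "\<And>\<sigma>. \<sigma> \<in> {0..h} \<Longrightarrow> norm (k n \<sigma>) \<le> 2 powr (- p) * (v h + 1) powr p"
    if n: "n0 \<le> n" for n
  proof -
    note g = n0[OF n, THEN conjunct1] n0[OF n, THEN conjunct2, THEN conjunct1]
    define x t s' where "x = X n (y - e * h)" and "t = \<tau> n (s + h)" and "s' = \<tau> n s"
    have l: "0 < lam n" by (rule lam_pos)
    have D: "(x, t) \<in> Dom" "fin x t" "0 \<le> s'" "s' \<le> t"
      using goodD[OF g(2)] goodD[OF g(1)] h(1) l by (auto simp: x_def t_def s'_def \<tau>_def)
    define F where "F \<sigma> = N (W (x + e * (t - \<sigma>)) \<sigma>) \<sigma>" for \<sigma>
    have Fi: "F integrable_on {s'..t}" unfolding F_def by (rule char_limit(1)[OF D(1) e D(2-4)])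
    have ends: "lam n * 0 + s' = s'" "lam n * h + s' = t" by (simp_all add: s'_def t_def \<tau>_def algebra_simps)
    have \<sigma>eq: "lam n * \<sigma> + s' = \<tau> n (s + \<sigma>)" for \<sigma> by (simp add: s'_def \<tau>_def algebra_simps)
    have kF: "k n \<sigma> = lam n powr (q + 1) * F (lam n * \<sigma> + s')" for \<sigma>
      unfolding k_def F_def \<sigma>eq using seg[of n \<sigma>] by (simp add: x_def t_def)
    have hi: "((\<lambda>\<sigma>. F (lam n * \<sigma> + s')) has_integral integral {s'..t} F / lam n) {0..h}"
      using has_integral_affine_real[OF l, of F s' "integral {s'..t} F" 0 h] Fi unfolding ends
      by (simp add: integrable_integral)
    have kh: "(k n has_integral lam n powr (q + 1) * (integral {s'..t} F / lam n)) {0..h}"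
      unfolding kF[abs_def] by (rule has_integral_mult_right[OF hi])
    then show "k n integrable_on {0..h}" by (auto simp: integrable_on_def)
    have "integral {0..h} (k n) = lam n powr q * integral {s'..t} F"
      using integral_unique[OF kh] l by (simp add: powr_add)
    moreover have "\<Theta> x t = \<Theta> (X n y) s' + integral {s'..t} F"
      using char[OF D] seg[of n 0] unfolding F_def[abs_def] by (simp add: x_def t_def s'_def)
    ultimately show "lam n powr q * \<Theta> (X n (y - e * h)) (\<tau> n (s + h)) =
        lam n powr q * \<Theta> (X n y) (\<tau> n s) + integral {0..h} (k n)"
      by (simp add: x_def t_def s'_def distrib_left)
    fix \<sigma> assume \<sigma>: "\<sigma> \<in> {0..h}"
    have \<tau>\<sigma>: "0 \<le> \<tau> n (s + \<sigma>)" "\<tau> n (s + \<sigma>) \<le> t"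
      using \<sigma> l D(3) goodD[OF g(1)] by (auto simp: t_def \<tau>_def s'_def algebra_simps)
    note c = fin_char[OF D(1) e D(2) \<tau>\<sigma>]
    have Wc: "\<gamma>1 + \<gamma>2 \<le> W (x + e * (t - \<tau> n (s + \<sigma>))) (\<tau> n (s + \<sigma>))" by (rule \<Phi>_ge(3)[OF c(1,2)])
    have W0: "0 \<le> W x t" using \<Phi>_ge(3)[OF D(1,2)] \<gamma> by linarith
    have "0 \<le> F (\<tau> n (s + \<sigma>))" unfolding F_def using Wc \<tau>\<sigma> by (intro N_nonneg)
    moreover have "F (\<tau> n (s + \<sigma>)) \<le> 2 powr (- p) * W x t powr p"
    proof -
      have "F (\<tau> n (s + \<sigma>)) \<le> N (W x t) t" unfolding F_def using Wc c(3) \<tau>\<sigma> by (intro N_mono)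
      also have "\<dots> \<le> 2 powr (- p) * W x t powr p" using W0 \<tau>\<sigma> by (intro N_le) auto
      finally show ?thesis .
    qed
    ultimately have "norm (k n \<sigma>) \<le> lam n powr (q + 1) * (2 powr (- p) * W x t powr p)"
      unfolding kF \<sigma>eq by (auto simp: abs_mult intro!: mult_left_mono)
    also have "\<dots> = 2 powr (- p) * (lam n powr q * W x t) powr p"
      using W0 l pq(2) by (simp add: powr_mult powr_powr)
    also have "\<dots> \<le> 2 powr (- p) * (v h + 1) powr p"
      using n0[OF n] W0 p by (intro mult_left_mono powr_mono2) (auto simp: wr_def x_def t_def)
    finally show "norm (k n \<sigma>) \<le> 2 powr (- p) * (v h + 1) powr p" .
  qed
  have kconv: "(\<lambda>n. k n \<sigma>) \<longlonglongrightarrow> 2 powr (- p) * v \<sigma> powr p" if \<sigma>: "\<sigma> \<in> {0..h}" for \<sigma>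
  proof -
    have sT: "s + \<sigma> < T0 (y - e * \<sigma>)" using past \<sigma> by simp
    have vpos: "0 < v \<sigma>" using v_low(1)[OF sT] by (simp add: v_def)
    \<comment> \<open>After rescaling, the damping keeps a spare factor lam n and disappears in the
      limit.\<close>
    have "(\<lambda>n. 2 powr (- p) * wr n (y - e * \<sigma>) (s + \<sigma>) powr p
        - lam n * (\<mu> / (1 + \<tau> n (s + \<sigma>))) * (wr n (y - e * \<sigma>) (s + \<sigma>) / 2)) \<longlonglongrightarrow>
        2 powr (- p) * v \<sigma> powr p - 0 * (\<mu> / (1 + T x0)) * (v \<sigma> / 2)"
      using vpos T_bounds(1)[OF x0] unfolding v_def
      by (intro tendsto_intros wr_lim[OF sT] lam_lim \<tau>_lim) auto
    then have "(\<lambda>n. 2 powr (- p) * wr n (y - e * \<sigma>) (s + \<sigma>) powr p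
        - lam n * (\<mu> / (1 + \<tau> n (s + \<sigma>))) * (wr n (y - e * \<sigma>) (s + \<sigma>) / 2)) \<longlonglongrightarrow> 2 powr (- p) * v \<sigma> powr p"
      by simp
    then show ?thesis
    proof (rule Lim_transform_eventually)
      show "\<forall>\<^sub>F n in sequentially. 2 powr (- p) * wr n (y - e * \<sigma>) (s + \<sigma>) powr p
        - lam n * (\<mu> / (1 + \<tau> n (s + \<sigma>))) * (wr n (y - e * \<sigma>) (s + \<sigma>) / 2) = k n \<sigma>"
        using good[OF sT]
      proof eventually_elim
        case (elim n)
        have l: "0 < lam n" by (rule lam_pos)
        define V where "V = W (X n (y - e * \<sigma>)) (\<tau> n (s + \<sigma>))"
        have V: "0 \<le> V" using \<Phi>_ge(3)[OF goodD(1,2)[OF elim]] \<gamma> by (simp add: V_def)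
        have "(lam n powr q * V) powr p = lam n powr (q + 1) * V powr p"
          using V l pq(2) by (simp add: powr_mult powr_powr)
        moreover have "lam n powr (q + 1) = lam n * lam n powr q" using l by (simp add: powr_add)
        ultimately show ?case
          using V unfolding k_def N_def wr_def V_def[symmetric]
          by (simp add: right_diff_distrib mult_ac)
      qed
    qed
  qed
  have "(\<lambda>n. integral {0..h} (k (n + n0))) \<longlonglongrightarrow> integral {0..h} (\<lambda>\<sigma>. 2 powr (- p) * v \<sigma> powr p)"
    by (rule dominated_convergence(2)[where h = "\<lambda>_. 2 powr (- p) * (v h + 1) powr p"])
      (use kint kle LIMSEQ_ignore_initial_segment[OF kconv, of _ n0] in auto)
  then have "(\<lambda>n. lam (n + n0) powr q * \<Theta> (X (n + n0) y) (\<tau> (n + n0) s) + integral {0..h} (k (n + n0))) \<longlonglongrightarrow>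
      u y s + integral {0..h} (\<lambda>\<sigma>. 2 powr (- p) * v \<sigma> powr p)"
    by (intro tendsto_add LIMSEQ_ignore_initial_segment[OF lim[OF s0]])
  then have "(\<lambda>n. lam (n + n0) powr q * \<Theta> (X (n + n0) (y - e * h)) (\<tau> (n + n0) (s + h))) \<longlonglongrightarrow>
      u y s + integral {0..h} (\<lambda>\<sigma>. 2 powr (- p) * v \<sigma> powr p)"
    by (simp add: keq)
  then show ?thesis
    using LIMSEQ_ignore_initial_segment[OF lim[OF h(2)], of n0] LIMSEQ_unique unfolding v_def by blast
qed

lemma v_eq:
  assumes "0 \<le> h"
  shows "s + h < T0 (y - h) \<Longrightarrow> v1 (y - h) (s + h) =
      v1 y s + integral {0..h} (\<lambda>\<sigma>. 2 powr (- p) * (v1 (y - \<sigma>) (s + \<sigma>) + v2 (y - \<sigma>) (s + \<sigma>)) powr p)"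
    and "s + h < T0 (y + h) \<Longrightarrow> v2 (y + h) (s + h) =
      v2 y s + integral {0..h} (\<lambda>\<sigma>. 2 powr (- p) * (v1 (y + \<sigma>) (s + \<sigma>) + v2 (y + \<sigma>) (s + \<sigma>)) powr p)"
  using v_char[of 1 \<Phi> v1 h s y, OF _ char_eq(1) resc_lim(1)] v_char[of "- 1" \<Psi> v2 h s y, OF _ char_eq(2) resc_lim(2)] assms
  by simp_all

lemma ancient_profile:
  assumes "C1_on {(y, s). s < T0 y} v1 v1y v1s" "C1_on {(y, s). s < T0 y} v2 v2y v2s"
  shows "ancient_profile p \<kappa> (2 / (1 - \<kappa>)) T0 v1 v2 v1y v1s v2y v2s"
  by unfold_locales (use p \<kappa> T0_lip assms v_nonneg v_mono v_low v_eq in auto)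

end

theorem theorem3p4:
  fixes p \<mu> Rs Ts \<gamma>1 \<gamma>2 x0 :: real
    and f g T0 :: "real \<Rightarrow> real"
    and lam :: "nat \<Rightarrow> real"
    and v\<phi> v\<psi> :: "real \<Rightarrow> real \<Rightarrow> real"
  assumes hp: "p > 1" and h\<mu>: "\<mu> > 0" and hpmu: "p < 1 + 2 / \<mu>"
    and hRs: "Rs > 0" and hTs: "Ts > 0"
    and h\<gamma>1: "\<gamma>1 > 0" and h\<gamma>2: "\<gamma>2 > 0"
    and h\<gamma>: "\<gamma>1 + \<gamma>2 > max 1 ((\<mu> * p * 2 powr p) powr (1 / (p - 1)))"
    and A1: "1 / ((p - 1) * \<mu>) *
               ln ((2 powr (1 - p) / \<mu>) / (2 powr (1 - p) / \<mu> - (\<gamma>1 + \<gamma>2) powr (1 - p))) < Ts"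
    and A2: "\<forall>x. \<bar>x\<bar> < Rs + Ts \<longrightarrow> f x \<ge> \<gamma>1 \<and> g x \<ge> \<gamma>2"
    and A3: "C4_closed f (- (Rs + Ts)) (Rs + Ts)" "C4_closed g (- (Rs + Ts)) (Rs + Ts)"
    and A4: "\<exists>\<epsilon>0 > 0. 2 powr (- p) * (\<gamma>1 + \<gamma>2) powr p - \<mu> / 2 * (\<gamma>1 + \<gamma>2)
               \<ge> (2 + \<epsilon>0) * (SUP x \<in> {- (Rs + Ts)<..<Rs + Ts}. \<bar>deriv f x\<bar> + \<bar>deriv g x\<bar>)"
    and A5: "\<exists>\<epsilon>1. \<epsilon>1 \<noteq> -1 \<and>
               2 powr (- p) * (2 * p - 1) * (1 + \<epsilon>1 / (2 * (1 + \<epsilon>1))) * (1 - 1 / (2 * p))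
                 - 2 powr (- p + 1) * p - \<mu> > 0 \<and>
               2 powr (- p) * (\<gamma>1 + \<gamma>2) powr p - \<mu> / 2 * (\<gamma>1 + \<gamma>2)
                 \<ge> (2 + \<epsilon>1) * (SUP x \<in> {- (Rs + Ts)<..<Rs + Ts}. \<bar>deriv f x\<bar> + \<bar>deriv g x\<bar>)"
    and hx0: "\<bar>x0\<bar> < Rs"
    and hlam_pos: "\<forall>n. lam n > 0" and hlam_dec: "decseq lam" and hlam_lim: "lam \<longlonglongrightarrow> 0"
    and hT0: "\<forall>K. compact K \<longrightarrow>
               uniform_limit K (\<lambda>n. T_resc p \<mu> \<gamma>1 \<gamma>2 f g Ts x0 (lam n)) T0 sequentially"
    and hv\<phi>: "conv_C3_loc {(y, s). s < T0 y} (\<lambda>n. phi_resc p \<mu> \<gamma>1 \<gamma>2 f g Ts x0 (lam n)) v\<phi>"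
    and hv\<psi>: "conv_C3_loc {(y, s). s < T0 y} (\<lambda>n. psi_resc p \<mu> \<gamma>1 \<gamma>2 f g Ts x0 (lam n)) v\<psi>"
  shows "\<exists>\<alpha>. -1 < \<alpha> \<and> \<alpha> < 1 \<and> (\<forall>y. T0 y = \<alpha> * y) \<and>
           (\<forall>y s. s < T0 y \<longrightarrow> v\<phi> y s = V_phi p \<alpha> y s \<and> v\<psi> y s = V_psi p \<alpha> y s)"
proof -
  define S where "S = {- (Rs + Ts)<..<Rs + Ts}"
  define M where "M = (SUP x \<in> S. \<bar>deriv f x\<bar> + \<bar>deriv g x\<bar>)"
  obtain \<epsilon> where \<epsilon>: "\<epsilon> > 0"
    "(2 + \<epsilon>) * M \<le> 2 powr (- p) * (\<gamma>1 + \<gamma>2) powr p - \<mu> / 2 * (\<gamma>1 + \<gamma>2)"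
    using A4 unfolding M_def S_def by auto
  obtain Bf Bg where B: "\<And>x. x \<in> S \<Longrightarrow> \<bar>deriv f x\<bar> \<le> Bf" "\<And>x. x \<in> S \<Longrightarrow> \<bar>deriv g x\<bar> \<le> Bg"
    using C4_closed_deriv(2)[OF A3(1)] C4_closed_deriv(2)[OF A3(2)] unfolding S_def by blast
  \<comment> \<open>Boundedness makes the supremum in (A4) a genuine upper bound for the
    derivatives, hence a Lipschitz constant.\<close>
  have "bdd_above ((\<lambda>x. \<bar>deriv f x\<bar> + \<bar>deriv g x\<bar>) ` S)"
    using B by (intro bdd_aboveI[of _ "Bf + Bg"]) (auto intro: add_mono)
  then have le: "\<bar>deriv f x\<bar> + \<bar>deriv g x\<bar> \<le> M" if "x \<in> S" for x
    unfolding M_def by (rule cSUP_upper[OF that])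
  have M: "\<bar>deriv f x\<bar> \<le> M" "\<bar>deriv g x\<bar> \<le> M" if "x \<in> S" for x using le[OF that] by auto
  have "0 \<in> S" using hRs hTs by (simp add: S_def)
  then have M0: "0 \<le> M" using M(1) by fastforce
  have lip: "\<bar>f x - f y\<bar> \<le> M * \<bar>x - y\<bar> \<and> \<bar>g x - g y\<bar> \<le> M * \<bar>x - y\<bar>"
    if "\<bar>x\<bar> < Rs + Ts" "\<bar>y\<bar> < Rs + Ts" for x y
  proof -
    have xy: "x \<in> S" "y \<in> S" using that by (auto simp: S_def)
    have cS: "convex S" by (simp add: S_def)
    have "norm (f x - f y) \<le> M * norm (x - y)"
      by (rule field_differentiable_bound[OF cS _ _ xy(1,2)], rule has_field_derivative_at_within)
        (use C4_closed_deriv(1)[OF A3(1)] M in \<open>auto simp: S_def\<close>)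
    moreover have "norm (g x - g y) \<le> M * norm (x - y)"
      by (rule field_differentiable_bound[OF cS _ _ xy(1,2)], rule has_field_derivative_at_within)
        (use C4_closed_deriv(1)[OF A3(2)] M in \<open>auto simp: S_def\<close>)
    ultimately show ?thesis by simp
  qed
  have big: "\<mu> * p * 2 powr p < (\<gamma>1 + \<gamma>2) powr (p - 1)"
  proof -
    have "((\<mu> * p * 2 powr p) powr (1 / (p - 1))) powr (p - 1) < (\<gamma>1 + \<gamma>2) powr (p - 1)"
      using h\<gamma> hp by (intro powr_less_mono2) auto
    then show ?thesis using hp h\<mu> by (simp add: powr_powr)
  qed
  interpret rescaling p \<mu> \<gamma>1 \<gamma>2 Rs Ts M \<epsilon> f g x0 lam T0 v\<phi> v\<psi>
  proof unfold_locales
    show "(\<lambda>n. T_resc p \<mu> \<gamma>1 \<gamma>2 f g Ts x0 (lam n) y) \<longlonglongrightarrow> T0 y" for y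
      using hT0[rule_format, of "{y}"] by (auto intro: tendsto_uniform_limitI)
    have pw: "(\<lambda>n. F n y s) \<longlonglongrightarrow> v y s" if c: "conv_C3_loc {(y, s). s < T0 y} F v" and s: "s < T0 y" for F v y s
    proof -
      have "uniform_limit {(y, s)} (\<lambda>n (y, s). pd [] (F n) y s) (\<lambda>(y, s). pd [] v y s) sequentially"
      proof -
        have "uniform_limit K (\<lambda>n (y, s). pd w (F n) y s) (\<lambda>(y, s). pd w v y s) sequentially"
          if "compact K" "K \<subseteq> {(y, s). s < T0 y}" "length w \<le> 3" for K w
          using c that unfolding conv_C3_loc_def by blast
        from this[of "{(y, s)}" "[]"] show ?thesis using s by simp
      qed
      from tendsto_uniform_limitI[OF this, of "(y, s)"] show ?thesis by simp
    qed
    show "(\<lambda>n. phi_resc p \<mu> \<gamma>1 \<gamma>2 f g Ts x0 (lam n) y s) \<longlonglongrightarrow> v\<phi> y s" if "s < T0 y" for y s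
      by (rule pw[OF hv\<phi> that])
    show "(\<lambda>n. psi_resc p \<mu> \<gamma>1 \<gamma>2 f g Ts x0 (lam n) y s) \<longlonglongrightarrow> v\<psi> y s" if "s < T0 y" for y s
      by (rule pw[OF hv\<psi> that])
  qed (use hp h\<mu> h\<gamma>1 h\<gamma>2 big A2 M0 \<epsilon> lip hRs hTs A1 hx0 hlam_pos hlam_lim in auto)
  have "C3_on {(y, s). s < T0 y} v\<phi>" "C3_on {(y, s). s < T0 y} v\<psi>"
    using hv\<phi> hv\<psi> unfolding conv_C3_loc_def by auto
  from this[THEN C3_on_imp_C1_on] interpret P: ancient_profile p \<kappa> "2 / (1 - \<kappa>)" T0 v\<phi> v\<psi>
    "pd [True] v\<phi>" "pd [False] v\<phi>" "pd [True] v\<psi>" "pd [False] v\<psi>"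
    by (rule ancient_profile)
  show ?thesis by (rule P.classification[OF T0_0])
qed

end
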